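(* Let $X$ be an affine variety over an algebraically closed field $\mathbb{K}$ with $\operatorname{char}\mathbb{K} = 0$. Let $x_1,\dots,x_N \in \mathbb{K}[X]\setminus\mathbb{K}$ be such that $\mathbb{K}[X] = \mathbb{K} + (x_1,\dots,x_N)\mathbb{K}[X]$. Let $V_1,\dots,V_n$ be vector fields on $X$ that span the tangent space $T_xX$ at every point $x\in X$. Let $H$ be a vector field on $X$ that induces a $\mathbb{G}_m$-action on $X$, and hence a $\mathbb{Z}$-grading on $\mathbb{K}[X]$. Assume further: (1) $[H,V_k] = c_k V_k$ with $c_k \in \mathbb{Z}$ for $k=1,\dots,n$; let $M = \#\{k\in\{1,\dots,n\} : c_k = 0\}$. (2) $H(x_\ell) = d_\ell x_\ell$ with $d_\ell \in \mathbb{Z}\setminus\{0\}$ for $\ell = 1,\dots,N$. (3) For each $k$ with $c_k = 0$ there exist vector fields $W_k, W_k'$ on $X$ such that $[W_k,W_k'] = V_k$. Then the following hold. (a) If $V_k(x_\ell) \in (x_1,\dots,x_N)\mathbb{K}[X]$ for all $k=1,\dots,n$ and $\ell=1,\dots,N$, then the bracket width of the Lie algebra $\operatorname{Vec}(X)$ of polynomial vector fields on $X$ is at most $1+N+M$. (b) If $V_k(x_\ell) \notin (x_1,\dots,x_N)\mathbb{K}[X]$ for some $k\in\{1,\dots,n\}$ and $\ell\in\{1,\dots,N\}$, then the bracket width of $\operatorname{Vec}(X)$ is at most $1+N+M+\Delta$, where $\Delta$ is the number of brackets needed to write $H$ modulo $(x_1,\dots,x_N)\mathbb{K}[X]\cdot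 H$.
   Context: $\operatorname{Vec}(X)$ denotes the Lie algebra over $\mathbb{K}$ of (polynomial) vector fields on $X$, i.e. the $\mathbb{K}$-linear derivations of the coordinate ring $\mathbb{K}[X]$, with the commutator bracket. $(x_1,\dots,x_N)\mathbb{K}[X]$ denotes the ideal generated by $x_1,\dots,x_N$. That $H$ induces a $\mathbb{G}_m$-action means that $H$ is the infinitesimal generator of an algebraic action of $\mathbb{G}_m=\mathbb{K}^*$ on $X$; the induced grading is $\mathbb{K}[X]=\bigoplus_{q\in\mathbb{Z}}\mathbb{K}[X]_q$ with $\mathbb{K}[X]_q=\{f\in\mathbb{K}[X] : H(f)=qf\}$. The number $\Delta$ is the smallest $m$ for which there are $A_1,B_1,\dots,A_m,B_m\in\operatorname{Vec}(X)$ and $r\in(x_1,\dots,x_N)\mathbb{K}[X]$ with $\sum_{i=1}^m[A_i,B_i] = H + rH$ (if no such $m$ exists, $\Delta=\infty$ and the bound is void). For a Lie algebra $L$ and $z \in [L,L]$ (the derived algebra), let $\ell(z)$ be the smallest $m$ such that $z = \sum_{i=1}^m [y_i,y_i']$ for some $y_i,y_i' \in L$. The bracket width of $L$ is $\sup\{\ell(z) : z \in [L,L]\}$. *)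

theory Defs
  imports
    "HOL-Analysis.Finite_Cartesian_Product"
    "HOL-Computational_Algebra.Polynomial"
    "HOL-Library.Function_Algebras"
    "HOL-Library.Extended_Nat"
begin

section \<open>Affine varieties and their coordinate rings\<close>

text \<open>
  Functions are added and multiplied pointwise (Function_Algebras). Over an infinite field
  a polynomial is the same thing as the function it induces on affine space.
\<close>

inductive_set poly_funs :: "('k::comm_ring_1 ^ 'i \<Rightarrow> 'k) set" where
  const: "(\<lambda>_. c) \<in> poly_funs"
| coord: "(\<lambda>p. p $ j) \<in> poly_funs"
| add: "f \<in> poly_funs \<Longrightarrow> g \<in> poly_funs \<Longrightarrow> f + g \<in> poly_funs"
| mult: "f \<in> poly_funs \<Longrightarrow> g \<in> poly_funs \<Longrightarrow> f * g \<in> poly_funs"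

definition affine_variety :: "('k::comm_ring_1 ^ 'i) set \<Rightarrow> bool" where
  "affine_variety X \<longleftrightarrow> (\<exists>S \<subseteq> poly_funs. X = {p. \<forall>f\<in>S. f p = 0})"

text \<open>
  A regular function on \<open>X\<close> is represented by its extension by zero to the ambient space, so
  that equality, sums and products in the coordinate ring are those of functions; the unit
  element is \<open>const_on X 1\<close>.
\<close>

definition restrict0 :: "'a set \<Rightarrow> ('a \<Rightarrow> 'k::zero) \<Rightarrow> 'a \<Rightarrow> 'k" where
  "restrict0 X f = (\<lambda>p. if p \<in> X then f p else 0)"

definition coord_ring :: "('k::comm_ring_1 ^ 'i) set \<Rightarrow> ('k ^ 'i \<Rightarrow> 'k) set" where
  "coord_ring X = restrict0 X ` poly_funs"

definition const_on :: "('k::comm_ring_1 ^ 'i) set \<Rightarrow> 'k \<Rightarrow> 'k ^ 'i \<Rightarrow> 'k" where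
  "const_on X c = restrict0 X (\<lambda>_. c)"

definition gen_ideal ::
  "('k::comm_ring_1 ^ 'i) set \<Rightarrow> nat \<Rightarrow> (nat \<Rightarrow> 'k ^ 'i \<Rightarrow> 'k) \<Rightarrow> ('k ^ 'i \<Rightarrow> 'k) set" where
  "gen_ideal X N x = {\<Sum>l\<in>{1..N}. x l * g l | g. \<forall>l\<in>{1..N}. g l \<in> coord_ring X}"


section \<open>Vector fields and tangent spaces\<close>

definition fscale :: "'k::times \<Rightarrow> ('a \<Rightarrow> 'k) \<Rightarrow> 'a \<Rightarrow> 'k" where
  "fscale c f = (\<lambda>p. c * f p)"

definition vscale :: "'k::times \<Rightarrow> ('b \<Rightarrow> 'a \<Rightarrow> 'k) \<Rightarrow> 'b \<Rightarrow> 'a \<Rightarrow> 'k" where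
  "vscale c D = (\<lambda>f. fscale c (D f))"

lemma module_fscale: "module (fscale :: 'k::comm_ring_1 \<Rightarrow> ('a \<Rightarrow> 'k) \<Rightarrow> 'a \<Rightarrow> 'k)"
  by unfold_locales (auto simp: fscale_def fun_eq_iff algebra_simps)

lemma module_vscale:
  "module (vscale :: 'k::comm_ring_1 \<Rightarrow> ('b \<Rightarrow> 'a \<Rightarrow> 'k) \<Rightarrow> 'b \<Rightarrow> 'a \<Rightarrow> 'k)"
  by unfold_locales (auto simp: vscale_def fscale_def fun_eq_iff algebra_simps)

text \<open>
  Derivations of the coordinate ring are set to zero on arguments outside it, so that
  two vector fields are equal iff they agree on the coordinate ring. The same convention is
  used for the tangent space.
\<close>

definition vector_fields ::
  "('k::comm_ring_1 ^ 'i) set \<Rightarrow> (('k ^ 'i \<Rightarrow> 'k) \<Rightarrow> 'k ^ 'i \<Rightarrow> 'k) set" where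
  "vector_fields X = {D.
     (\<forall>f. f \<notin> coord_ring X \<longrightarrow> D f = 0) \<and>
     (\<forall>f\<in>coord_ring X. D f \<in> coord_ring X) \<and>
     (\<forall>f\<in>coord_ring X. \<forall>g\<in>coord_ring X. D (f + g) = D f + D g) \<and>
     (\<forall>c. \<forall>f\<in>coord_ring X. D (fscale c f) = fscale c (D f)) \<and>
     (\<forall>f\<in>coord_ring X. \<forall>g\<in>coord_ring X. D (f * g) = f * D g + g * D f)}"

definition vf_bracket :: "('f::ab_group_add \<Rightarrow> 'f) \<Rightarrow> ('f \<Rightarrow> 'f) \<Rightarrow> 'f \<Rightarrow> 'f" where
  "vf_bracket A B = (\<lambda>f. A (B f) - B (A f))"

definition vf_mult :: "'f::times \<Rightarrow> ('f \<Rightarrow> 'f) \<Rightarrow> 'f \<Rightarrow> 'f" where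
  "vf_mult r D = (\<lambda>f. r * D f)"

text \<open>The Zariski tangent space at \<open>p\<close>, as the space of point derivations.\<close>

definition tangent_space ::
  "('k::comm_ring_1 ^ 'i) set \<Rightarrow> 'k ^ 'i \<Rightarrow> (('k ^ 'i \<Rightarrow> 'k) \<Rightarrow> 'k) set" where
  "tangent_space X p = {\<delta>.
     (\<forall>f. f \<notin> coord_ring X \<longrightarrow> \<delta> f = 0) \<and>
     (\<forall>f\<in>coord_ring X. \<forall>g\<in>coord_ring X. \<delta> (f + g) = \<delta> f + \<delta> g) \<and>
     (\<forall>c. \<forall>f\<in>coord_ring X. \<delta> (fscale c f) = c * \<delta> f) \<and>
     (\<forall>f\<in>coord_ring X. \<forall>g\<in>coord_ring X. \<delta> (f * g) = f p * \<delta> g + g p * \<delta> f)}"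

definition vf_at ::
  "(('k ^ 'i \<Rightarrow> 'k) \<Rightarrow> 'k ^ 'i \<Rightarrow> 'k) \<Rightarrow> 'k ^ 'i \<Rightarrow> ('k ^ 'i \<Rightarrow> 'k) \<Rightarrow> 'k" where
  "vf_at D p = (\<lambda>f. D f p)"

definition spans_tangent_spaces ::
  "('k::comm_ring_1 ^ 'i) set \<Rightarrow> nat \<Rightarrow> (nat \<Rightarrow> ('k ^ 'i \<Rightarrow> 'k) \<Rightarrow> 'k ^ 'i \<Rightarrow> 'k) \<Rightarrow> bool" where
  "spans_tangent_spaces X n V \<longleftrightarrow>
     (\<forall>p\<in>X. module.span fscale ((\<lambda>k. vf_at (V k) p) ` {1..n}) = tangent_space X p)"


section \<open>Actions of the multiplicative group\<close>

text \<open>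
  The coordinate ring of \<open>\<bbbG>\<^sub>m \<times> X\<close> is the tensor product of the Laurent polynomials in \<open>t\<close>
  with that of \<open>X\<close>: its elements are the finite sums of \<open>t\<^sup>q f\<^sub>q(p)\<close> with \<open>q\<close> an integer.
  The predicate below says that \<open>F\<close> is the regular function given by the \<open>f\<^sub>q\<close>, \<open>q \<in> Q\<close>.
\<close>

definition laurent_expansion ::
  "('k::field ^ 'i) set \<Rightarrow> ('k \<Rightarrow> 'k ^ 'i \<Rightarrow> 'k) \<Rightarrow> int set \<Rightarrow> (int \<Rightarrow> 'k ^ 'i \<Rightarrow> 'k) \<Rightarrow> bool" where
  "laurent_expansion X F Q fq \<longleftrightarrow>
     finite Q \<and> (\<forall>q\<in>Q. fq q \<in> coord_ring X) \<and>
     (\<forall>t p. t \<noteq> 0 \<longrightarrow> p \<in> X \<longrightarrow> F t p = (\<Sum>q\<in>Q. t powi q * fq q p))"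

text \<open>
  Algebraicity: the pullback along the action map of every regular function on \<open>X\<close>
  is regular on \<open>\<bbbG>\<^sub>m \<times> X\<close>.
\<close>

definition algebraic_Gm_action ::
  "('k::field ^ 'i) set \<Rightarrow> ('k \<Rightarrow> 'k ^ 'i \<Rightarrow> 'k ^ 'i) \<Rightarrow> bool" where
  "algebraic_Gm_action X \<phi> \<longleftrightarrow>
     (\<forall>t p. t \<noteq> 0 \<longrightarrow> p \<in> X \<longrightarrow> \<phi> t p \<in> X) \<and>
     (\<forall>p\<in>X. \<phi> 1 p = p) \<and>
     (\<forall>s t p. s \<noteq> 0 \<longrightarrow> t \<noteq> 0 \<longrightarrow> p \<in> X \<longrightarrow> \<phi> (s * t) p = \<phi> s (\<phi> t p)) \<and>
     (\<forall>f\<in>coord_ring X. \<exists>Q fq. laurent_expansion X (\<lambda>t p. f (\<phi> t p)) Q fq)"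

text \<open>
  The infinitesimal generator is the vector field \<open>H(f)(p) = d/dt f(\<phi>(t,p))\<close> at \<open>t = 1\<close>;
  the formal derivative of \<open>t\<^sup>q\<close> at \<open>1\<close> is \<open>q\<close>. Laurent expansions are unique up to zero
  terms, since the field is infinite wherever this is used.
\<close>

definition infinitesimal_generator ::
  "('k::field ^ 'i) set \<Rightarrow> ('k \<Rightarrow> 'k ^ 'i \<Rightarrow> 'k ^ 'i) \<Rightarrow>
   (('k ^ 'i \<Rightarrow> 'k) \<Rightarrow> 'k ^ 'i \<Rightarrow> 'k) \<Rightarrow> bool" where
  "infinitesimal_generator X \<phi> H \<longleftrightarrow> H \<in> vector_fields X \<and>
     (\<forall>f\<in>coord_ring X. \<forall>Q fq. laurent_expansion X (\<lambda>t p. f (\<phi> t p)) Q fq \<longrightarrow>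
        H f = (\<Sum>q\<in>Q. fscale (of_int q) (fq q)))"

definition induces_Gm_action ::
  "('k::field ^ 'i) set \<Rightarrow> (('k ^ 'i \<Rightarrow> 'k) \<Rightarrow> 'k ^ 'i \<Rightarrow> 'k) \<Rightarrow> bool" where
  "induces_Gm_action X H \<longleftrightarrow>
     (\<exists>\<phi>. algebraic_Gm_action X \<phi> \<and> infinitesimal_generator X \<phi> H)"


section \<open>Bracket width\<close>

definition sum_of_brackets :: "('v \<Rightarrow> 'v \<Rightarrow> 'v) \<Rightarrow> 'v set \<Rightarrow> nat \<Rightarrow> 'v::ab_group_add \<Rightarrow> bool" where
  "sum_of_brackets br L m z \<longleftrightarrow>
     (\<exists>y y'. (\<forall>i\<in>{1..m}. y i \<in> L \<and> y' i \<in> L) \<and> z = (\<Sum>i\<in>{1..m::nat}. br (y i) (y' i)))"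

definition derived_algebra ::
  "('k::comm_ring_1 \<Rightarrow> 'v \<Rightarrow> 'v) \<Rightarrow> ('v \<Rightarrow> 'v \<Rightarrow> 'v) \<Rightarrow> 'v set \<Rightarrow> 'v::ab_group_add set" where
  "derived_algebra sc br L = module.span sc {br y z | y z. y \<in> L \<and> z \<in> L}"

text \<open>Infima are taken in the extended naturals, so the infimum of the empty set is \<open>\<infinity>\<close>.\<close>

definition bracket_length :: "('v \<Rightarrow> 'v \<Rightarrow> 'v) \<Rightarrow> 'v set \<Rightarrow> 'v::ab_group_add \<Rightarrow> enat" where
  "bracket_length br L z = (INF m\<in>{m. sum_of_brackets br L m z}. enat m)"

definition bracket_width ::
  "('k::comm_ring_1 \<Rightarrow> 'v \<Rightarrow> 'v) \<Rightarrow> ('v \<Rightarrow> 'v \<Rightarrow> 'v) \<Rightarrow> 'v::ab_group_add set \<Rightarrow> enat" where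
  "bracket_width sc br L = (SUP z\<in>derived_algebra sc br L. bracket_length br L z)"

definition bracket_number_mod ::
  "('k::comm_ring_1 ^ 'i) set \<Rightarrow> nat \<Rightarrow> (nat \<Rightarrow> 'k ^ 'i \<Rightarrow> 'k) \<Rightarrow>
   (('k ^ 'i \<Rightarrow> 'k) \<Rightarrow> 'k ^ 'i \<Rightarrow> 'k) \<Rightarrow> enat" where
  "bracket_number_mod X N x H =
     (INF m\<in>{m. \<exists>r\<in>gen_ideal X N x.
         sum_of_brackets vf_bracket (vector_fields X) m (H + vf_mult r H)}. enat m)"

end

theory Submission
  imports Defs "HOL-Analysis.Cartesian_Space"
begin

text \<open>
  Nakayama's lemma together with the Nullstellensatz shows that the \<open>V\<^sub>k\<close> generate the
  \<open>\<bbbK>[X]\<close>-module of vector fields. Since \<open>\<bbbK>[X] = \<bbbK> + (x\<^sub>1, \<dots>, x\<^sub>N)\<close> is spanned by homogeneous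
  elements, every vector field is a sum of terms \<open>a V\<^sub>k\<close> and \<open>x\<^sub>l g V\<^sub>k\<close> with \<open>a\<close> constant and \<open>g\<close>
  homogeneous. Terms of nonzero weight are collected in a single bracket with \<open>H\<close>. If
  \<open>U = g V\<^sub>k\<close> has weight \<open>- d\<^sub>l\<close>, then \<open>[x\<^sub>l H, U] = - d\<^sub>l x\<^sub>l U - U(x\<^sub>l) H\<close>, so that the terms of
  weight zero cost \<open>N\<close> brackets, at most one more for each \<open>V\<^sub>k\<close> with \<open>c\<^sub>k = 0\<close>, and leave an error \<open>f H\<close>.
  If \<open>f\<close> lies in the ideal, the error is absorbed in the same \<open>1 + N\<close> brackets, because
  \<open>[x\<^sub>l H, g H] = - 2 d\<^sub>l x\<^sub>l g H\<close> for \<open>g\<close> of weight \<open>- d\<^sub>l\<close>; a constant multiple of \<open>H\<close> costs \<open>\<Delta>\<close> further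
  brackets.
\<close>

section \<open>Extending points along ring extensions\<close>

text \<open>The number of brackets is uniform because the left entries \<open>H\<close> and
  \<open>x l * H\<close> do not depend on the vector field: a bracket is linear in its right entry,
  so any number of homogeneous terms, for all \<open>k\<close> together, merges into the same
  \<open>1 + N\<close> brackets. Constant multiples of a \<open>V k\<close> with
  \<open>c k = 0\<close> escape this: \<open>H\<close> commutes with them, and they carry no factor
  \<open>x l\<close> that could be traded for a bracket. Hypothesis (3) is spent on them. A constant
  multiple of \<open>H\<close> escapes for the same reason, which is where \<Delta> comes from.

  On the geometric side the obstacle is that spanning is known one point at a time, and only in
  Zariski tangent spaces. A relation at \<open>p\<close> is spread out to one with a denominator
  that does not vanish at \<open>p\<close>; the denominators that serve a given vector field form an
  ideal, and an ideal without common zeros contains 1. Denominators take the place of localizations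
  throughout, and "all coefficients lie in \<open>P\<close>" takes the place of a quotient ring, so
  that every computation stays in one ring of functions.\<close>

definition subring_set :: "'a::comm_ring_1 set \<Rightarrow> bool" where
  "subring_set A \<longleftrightarrow> 1 \<in> A \<and> (\<forall>x\<in>A. \<forall>y\<in>A. x - y \<in> A \<and> x * y \<in> A)"

definition ideal_of :: "'a::comm_ring_1 set \<Rightarrow> 'a set \<Rightarrow> bool" where
  "ideal_of R I \<longleftrightarrow> I \<subseteq> R \<and> 0 \<in> I \<and> (\<forall>x\<in>I. \<forall>y\<in>I. x + y \<in> I) \<and> (\<forall>r\<in>R. \<forall>x\<in>I. r * x \<in> I)"

definition prime_ideal_of :: "'a::comm_ring_1 set \<Rightarrow> 'a set \<Rightarrow> bool" where
  "prime_ideal_of R P \<longleftrightarrow>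
     ideal_of R P \<and> 1 \<notin> P \<and> (\<forall>x\<in>R. \<forall>y\<in>R. x * y \<in> P \<longrightarrow> x \<in> P \<or> y \<in> P)"

definition coeffs_in :: "'a::zero set \<Rightarrow> 'a poly set" where
  "coeffs_in A = {f. \<forall>i. coeff f i \<in> A}"

lemma subring_set_closed:
  assumes "subring_set A"
  shows "0 \<in> A" "1 \<in> A" "x \<in> A \<Longrightarrow> - x \<in> A"
    "x \<in> A \<Longrightarrow> y \<in> A \<Longrightarrow> x + y \<in> A"
    "x \<in> A \<Longrightarrow> y \<in> A \<Longrightarrow> x - y \<in> A"
    "x \<in> A \<Longrightarrow> y \<in> A \<Longrightarrow> x * y \<in> A"
proof -
  show one: "1 \<in> A" and diff: "x \<in> A \<Longrightarrow> y \<in> A \<Longrightarrow> x - y \<in> A" for x y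
    using assms by (auto simp: subring_set_def)
  show zero: "0 \<in> A" using diff[OF one one] by simp
  show uminus: "x \<in> A \<Longrightarrow> - x \<in> A" for x using diff[OF zero, of x] by simp
  show "x \<in> A \<Longrightarrow> y \<in> A \<Longrightarrow> x + y \<in> A" using diff[of x "- y"] uminus[of y] by simp
  show "x \<in> A \<Longrightarrow> y \<in> A \<Longrightarrow> x * y \<in> A" using assms by (auto simp: subring_set_def)
qed

lemma subring_set_sum:
  assumes "subring_set A" "\<And>i. i \<in> S \<Longrightarrow> f i \<in> A"
  shows "sum f S \<in> A"
  using assms(2) by (induction S rule: infinite_finite_induct) (auto simp: subring_set_closed[OF assms(1)])

lemma subring_set_power: "subring_set A \<Longrightarrow> x \<in> A \<Longrightarrow> x ^ k \<in> A"
  by (induction k) (auto simp: subring_set_closed)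

lemma ideal_of_closed:
  assumes "subring_set R" "ideal_of R I"
  shows "0 \<in> I" "x \<in> I \<Longrightarrow> x \<in> R" "x \<in> I \<Longrightarrow> - x \<in> I"
    "x \<in> I \<Longrightarrow> y \<in> I \<Longrightarrow> x + y \<in> I"
    "x \<in> I \<Longrightarrow> y \<in> I \<Longrightarrow> x - y \<in> I"
    "r \<in> R \<Longrightarrow> x \<in> I \<Longrightarrow> r * x \<in> I"
    "r \<in> R \<Longrightarrow> x \<in> I \<Longrightarrow> x * r \<in> I"
proof -
  show "0 \<in> I" "x \<in> I \<Longrightarrow> x \<in> R"
    using assms(2) by (auto simp: ideal_of_def)
  show add: "x \<in> I \<Longrightarrow> y \<in> I \<Longrightarrow> x + y \<in> I" and mult: "r \<in> R \<Longrightarrow> x \<in> I \<Longrightarrow> r * x \<in> I" for r x y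
    using assms(2) by (auto simp: ideal_of_def)
  show "r \<in> R \<Longrightarrow> x \<in> I \<Longrightarrow> x * r \<in> I" using mult[of r x] by (simp add: mult.commute)
  show uminus: "x \<in> I \<Longrightarrow> - x \<in> I" for x
    using mult[of "- 1" x] subring_set_closed(2,3)[OF assms(1)] by simp
  show "x \<in> I \<Longrightarrow> y \<in> I \<Longrightarrow> x - y \<in> I" using add[of x "- y"] uminus[of y] by simp
qed

lemma ideal_of_sum:
  assumes "ideal_of R I" "\<And>i. i \<in> S \<Longrightarrow> f i \<in> I"
  shows "sum f S \<in> I"
  using assms(2) by (induction S rule: infinite_finite_induct) (use assms(1) in \<open>auto simp: ideal_of_def\<close>)

lemma prime_ideal_of_power:
  assumes "subring_set R" "prime_ideal_of R P" "x \<in> R" "x \<notin> P"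
  shows "x ^ k \<notin> P"
proof (induction k)
  case (Suc k)
  have "x ^ k \<in> R" using assms(1,3) by (rule subring_set_power)
  with Suc show ?case using assms(2-4) by (auto simp: prime_ideal_of_def)
qed (use assms(2) in \<open>simp add: prime_ideal_of_def\<close>)

section \<open>Polynomials with coefficients in a subring\<close>

lemma coeffs_in_closed:
  assumes "subring_set A"
  shows "0 \<in> coeffs_in A" "f \<in> coeffs_in A \<Longrightarrow> g \<in> coeffs_in A \<Longrightarrow> f + g \<in> coeffs_in A"
    "f \<in> coeffs_in A \<Longrightarrow> g \<in> coeffs_in A \<Longrightarrow> f - g \<in> coeffs_in A"
    "f \<in> coeffs_in A \<Longrightarrow> g \<in> coeffs_in A \<Longrightarrow> f * g \<in> coeffs_in A"
    "a \<in> A \<Longrightarrow> f \<in> coeffs_in A \<Longrightarrow> smult a f \<in> coeffs_in A"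
    "a \<in> A \<Longrightarrow> monom a n \<in> coeffs_in A"
    "a \<in> A \<Longrightarrow> [:a:] \<in> coeffs_in A"
  by (auto simp: coeffs_in_def coeff_mult coeff_pCons subring_set_closed[OF assms]
      intro!: subring_set_sum[OF assms] split: nat.splits)

lemma poly_mem_subring:
  assumes "subring_set R" "f \<in> coeffs_in R" "b \<in> R"
  shows "poly f b \<in> R"
  using assms by (auto simp: poly_altdef coeffs_in_def
      intro!: subring_set_sum subring_set_closed(6) subring_set_power)

lemma poly_mem_ideal:
  assumes "subring_set R" "ideal_of R I" "f \<in> coeffs_in I" "b \<in> R"
  shows "poly f b \<in> I"
  unfolding poly_altdef
  using assms by (auto simp: coeffs_in_def
      intro!: ideal_of_sum[OF assms(2)] ideal_of_closed(7) subring_set_power)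

text \<open>Since \<open>coeff p m\<close> need not be a unit, \<open>f\<close> is multiplied by a
  power of it before dividing. The numbers \<open>m\<close> and \<open>n\<close> are formal degree
  bounds, so that the lemma applies to polynomials whose degree is known only through vanishing
  coefficients. The bound on \<open>q\<close> serves to see that a quotient has smaller degree than
  the dividend.\<close>

lemma pseudo_division:
  fixes p :: "'a::comm_ring_1 poly"
  assumes A: "subring_set A" and p: "p \<in> coeffs_in A" "\<forall>i>m. coeff p i = 0"
    and f: "f \<in> coeffs_in A" "\<forall>i\<ge>n. coeff f i = 0"
  shows "\<exists>k q r. q \<in> coeffs_in A \<and> r \<in> coeffs_in A \<and> (\<forall>i\<ge>m. coeff r i = 0)
      \<and> (\<forall>i. n \<le> i + m \<longrightarrow> coeff q i = 0) \<and> smult (coeff p m ^ k) f = q * p + r"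
  using f
proof (induction n arbitrary: f)
  case 0
  then show ?case
    by (intro exI[of _ 0] exI[of _ f]) (auto simp: coeffs_in_closed[OF A])
next
  case (Suc n)
  show ?case
  proof (cases "Suc n \<le> m")
    case True
    then show ?thesis using Suc.prems
      by (intro exI[of _ 0] exI[of _ f]) (auto simp: coeffs_in_closed[OF A])
  next
    case False
    define a c where "a = coeff p m" and "c = coeff f n"
    have ac: "a \<in> A" "c \<in> A" using p(1) Suc.prems(1) by (auto simp: a_def c_def coeffs_in_def)
    \<comment> \<open>The top coefficient \<open>c\<close> of \<open>f\<close> cancels in
      \<open>f'\<close>; each such round costs one factor \<open>a\<close>.\<close>
    define f' where "f' = smult a f - monom c (n - m) * p"
    have "f' \<in> coeffs_in A"
      unfolding f'_def using ac p(1) Suc.prems(1) by (intro coeffs_in_closed[OF A])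
    moreover have "coeff f' i = 0" if "n \<le> i" for i
    proof (cases "i = n")
      case True
      then show ?thesis using False by (simp add: f'_def coeff_monom_mult a_def c_def)
    next
      case ne: False
      then have "coeff f i = 0" using that Suc.prems(2) by simp
      moreover have "coeff p (i - (n - m)) = 0" using p(2) ne that False by auto
      ultimately show ?thesis by (simp add: f'_def coeff_monom_mult)
    qed
    ultimately obtain k q r where IH: "q \<in> coeffs_in A" "r \<in> coeffs_in A" "\<forall>i\<ge>m. coeff r i = 0"
      "\<forall>i. n \<le> i + m \<longrightarrow> coeff q i = 0" "smult (a ^ k) f' = q * p + r"
      using Suc.IH[of f'] unfolding a_def by blast
    define q' where "q' = q + monom (a ^ k * c) (n - m)"
    have "smult (a ^ Suc k) f = smult (a ^ k) f' + monom (a ^ k * c) (n - m) * p"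
    proof -
      have "monom (a ^ k * c) (n - m) = smult (a ^ k) (monom c (n - m))" by (simp add: smult_monom)
      then show ?thesis by (simp add: f'_def smult_diff_right mult.commute)
    qed
    then have "smult (a ^ Suc k) f = q' * p + r"
      by (simp add: IH(5) q'_def algebra_simps)
    moreover have "q' \<in> coeffs_in A"
      unfolding q'_def using IH(1) ac
      by (intro coeffs_in_closed[OF A] subring_set_closed(6)[OF A] subring_set_power[OF A])
    moreover have "\<forall>i. Suc n \<le> i + m \<longrightarrow> coeff q' i = 0"
      using IH(4) False by (auto simp: q'_def)
    ultimately show ?thesis using IH(2,3) unfolding a_def by blast
  qed
qed

text \<open>For a subring \<open>A\<close> this is a unital ring homomorphism from \<open>A\<close>
  modulo \<open>A \<inter> P\<close>, stated without the quotient. Compatibility with the constants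
  is left out here and is tracked in \<open>separated\<close>.\<close>

definition point_hom :: "'a::comm_ring_1 set \<Rightarrow> 'a set \<Rightarrow> ('a \<Rightarrow> 'k::comm_ring_1) \<Rightarrow> bool" where
  "point_hom A P \<phi> \<longleftrightarrow> \<phi> 1 = 1 \<and> (\<forall>x\<in>A. \<forall>y\<in>A. \<phi> (x + y) = \<phi> x + \<phi> y \<and> \<phi> (x * y) = \<phi> x * \<phi> y)
     \<and> (\<forall>x\<in>A \<inter> P. \<phi> x = 0)"

text \<open>Reduction modulo \<open>P\<close> of polynomials over \<open>A\<close>, without quotient rings: a polynomial is
  regarded as zero if all its coefficients lie in \<open>P\<close>.\<close>

locale prime_extension =
  fixes R P A :: "'a::comm_ring_1 set" and b :: 'a
  assumes R: "subring_set R" and P: "prime_ideal_of R P"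
    and A: "subring_set A" "A \<subseteq> R" and b: "b \<in> R"
begin

lemma idP: "ideal_of R P" using P by (simp add: prime_ideal_of_def)

lemmas P_closed = ideal_of_closed[OF R idP]

lemma primeD: "x * y \<in> P \<Longrightarrow> x \<in> R \<Longrightarrow> y \<in> R \<Longrightarrow> x \<in> P \<or> y \<in> P"
  using P by (auto simp: prime_ideal_of_def)

lemma coeffs_AR: "f \<in> coeffs_in A \<Longrightarrow> f \<in> coeffs_in R"
  using A(2) by (auto simp: coeffs_in_def)

lemma poly_in_R: "f \<in> coeffs_in A \<Longrightarrow> poly f b \<in> R"
  by (intro poly_mem_subring R coeffs_AR b)

lemma poly_in_P: "f \<in> coeffs_in P \<Longrightarrow> poly f b \<in> P"
  by (rule poly_mem_ideal[OF R idP _ b])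

lemma coeffs_P_mult: "f \<in> coeffs_in P \<Longrightarrow> g \<in> coeffs_in R \<Longrightarrow> f * g \<in> coeffs_in P"
  by (auto simp: coeffs_in_def coeff_mult intro!: ideal_of_sum[OF idP] P_closed(7))

lemma coeffs_P_add: "f \<in> coeffs_in P \<Longrightarrow> g \<in> coeffs_in P \<Longrightarrow> f + g \<in> coeffs_in P"
  by (auto simp: coeffs_in_def intro: P_closed)

text \<open>Replacing the coefficients that lie in \<open>P\<close> by zero changes the value at
  \<open>b\<close> only by an element of \<open>P\<close>, which the assumption on \<open>N\<close>
  tolerates. After this cleaning the leading coefficient lies outside \<open>P\<close>, and a least
  degree can be taken. With \<open>N = P\<close> the result is a minimal polynomial of
  \<open>b\<close> modulo \<open>P\<close>; the other use takes for \<open>N\<close> the multiples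
  of a fixed \<open>poly g b\<close> modulo \<open>P\<close>.\<close>

lemma exists_minimal_degree:
  assumes N: "\<And>x y. x \<in> N \<Longrightarrow> y \<in> P \<Longrightarrow> x - y \<in> N"
    and f: "f \<in> coeffs_in A" "poly f b \<in> N" "f \<notin> coeffs_in P"
  obtains p m where "p \<in> coeffs_in A" "poly p b \<in> N" "coeff p m \<notin> P" "\<forall>i>m. coeff p i = 0"
    "\<And>f. f \<in> coeffs_in A \<Longrightarrow> poly f b \<in> N \<Longrightarrow> \<forall>i\<ge>m. coeff f i = 0 \<Longrightarrow> f \<in> coeffs_in P"
proof -
  define Q where "Q m \<longleftrightarrow> (\<exists>p. p \<in> coeffs_in A \<and> poly p b \<in> N \<and> coeff p m \<notin> P \<and> (\<forall>i>m. coeff p i = 0))" for m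
  have clean: "\<exists>m<n. Q m"
    if f: "f \<in> coeffs_in A" "poly f b \<in> N" "f \<notin> coeffs_in P" "\<forall>i\<ge>n. coeff f i = 0" for f n
  proof -
    define \<rho> where "\<rho> a = (if a \<in> P then 0 else a)" for a
    define g where "g = map_poly \<rho> f"
    have cg: "coeff g i = \<rho> (coeff f i)" for i
      unfolding g_def by (rule coeff_map_poly) (simp add: \<rho>_def)
    have gA: "g \<in> coeffs_in A"
      using f(1) subring_set_closed(1)[OF A(1)] by (auto simp: coeffs_in_def cg \<rho>_def)
    have "f - g \<in> coeffs_in P"
      by (auto simp: coeffs_in_def cg \<rho>_def P_closed(1))
    then have "poly f b - poly (f - g) b \<in> N"
      by (intro N f poly_in_P)
    then have gN: "poly g b \<in> N" by simp
    obtain i where i: "coeff f i \<notin> P" using f(3) by (auto simp: coeffs_in_def)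
    have "coeff g i \<noteq> 0" using i P_closed(1) by (auto simp: cg \<rho>_def)
    then have "g \<noteq> 0" by auto
    define m where "m = degree g"
    have lc: "coeff g m \<noteq> 0" using \<open>g \<noteq> 0\<close> by (simp add: m_def)
    then have "coeff g m \<notin> P" by (auto simp: cg \<rho>_def split: if_splits)
    moreover have "m < n"
      using lc f(4) by (metis cg \<rho>_def P_closed(1) not_le)
    ultimately show ?thesis using gA gN coeff_eq_0[of g] by (auto simp: Q_def m_def)
  qed
  have ex: "\<exists>m. Q m"
    using clean[OF f, of "Suc (degree f)"] coeff_eq_0[of f] by auto
  define m where "m = (LEAST m. Q m)"
  have "Q m" unfolding m_def using ex by (rule LeastI_ex)
  then obtain p where "p \<in> coeffs_in A" "poly p b \<in> N" "coeff p m \<notin> P" "\<forall>i>m. coeff p i = 0"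
    by (auto simp: Q_def)
  moreover have "f \<in> coeffs_in P"
    if "f \<in> coeffs_in A" "poly f b \<in> N" "\<forall>i\<ge>m. coeff f i = 0" for f
    using clean[of f m] that not_less_Least[of _ Q] unfolding m_def by blast
  ultimately show ?thesis using that by blast
qed

lemma point_hom_poly:
  fixes \<phi> :: "'a \<Rightarrow> 'k::field"
  assumes \<phi>: "point_hom A P \<phi>"
  shows "f \<in> coeffs_in A \<Longrightarrow> g \<in> coeffs_in A \<Longrightarrow> map_poly \<phi> (f + g) = map_poly \<phi> f + map_poly \<phi> g"
    "f \<in> coeffs_in A \<Longrightarrow> g \<in> coeffs_in A \<Longrightarrow> map_poly \<phi> (f * g) = map_poly \<phi> f * map_poly \<phi> g"
    "f \<in> coeffs_in A \<Longrightarrow> f \<in> coeffs_in P \<Longrightarrow> map_poly \<phi> f = 0"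
    "coeff (map_poly \<phi> f) i = \<phi> (coeff f i)"
proof -
  have \<phi>_sum: "\<phi> (sum h S) = (\<Sum>i\<in>S. \<phi> (h i))" if "\<And>i. i \<in> S \<Longrightarrow> h i \<in> A" for h and S :: "nat set"
    using that
  proof (induction S rule: infinite_finite_induct)
    case (insert i S)
    then have "sum h S \<in> A" by (intro subring_set_sum[OF A(1)]) auto
    with insert show ?case using \<phi> by (simp add: point_hom_def)
  qed (use \<phi> P_closed(1) subring_set_closed(1)[OF A(1)] in \<open>auto simp: point_hom_def\<close>)
  have \<phi>0: "\<phi> 0 = 0" using \<phi>_sum[of "{}" "\<lambda>_. 0"] by simp
  show c: "coeff (map_poly \<phi> f) i = \<phi> (coeff f i)" for f i by (rule coeff_map_poly[of \<phi>, OF \<phi>0])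
  show "f \<in> coeffs_in A \<Longrightarrow> g \<in> coeffs_in A \<Longrightarrow> map_poly \<phi> (f + g) = map_poly \<phi> f + map_poly \<phi> g"
    using \<phi> by (intro poly_eqI) (simp add: c coeffs_in_def point_hom_def)
  show "f \<in> coeffs_in A \<Longrightarrow> f \<in> coeffs_in P \<Longrightarrow> map_poly \<phi> f = 0"
    using \<phi> by (intro poly_eqI) (simp add: c coeffs_in_def point_hom_def)
  assume fg: "f \<in> coeffs_in A" "g \<in> coeffs_in A"
  show "map_poly \<phi> (f * g) = map_poly \<phi> f * map_poly \<phi> g"
  proof (rule poly_eqI)
    fix n
    have "\<phi> (coeff (f * g) n) = (\<Sum>i\<le>n. \<phi> (coeff f i * coeff g (n - i)))"
      unfolding coeff_mult using fg
      by (intro \<phi>_sum) (auto simp: coeffs_in_def subring_set_closed[OF A(1)])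
    also have "\<dots> = (\<Sum>i\<le>n. \<phi> (coeff f i) * \<phi> (coeff g (n - i)))"
      using \<phi> fg by (intro sum.cong) (auto simp: coeffs_in_def point_hom_def)
    finally show "coeff (map_poly \<phi> (f * g)) n = coeff (map_poly \<phi> f * map_poly \<phi> g) n"
      by (simp add: c coeff_mult)
  qed
qed

text \<open>The substitution \<open>b \<mapsto> t\<close> extends \<open>\<phi>\<close> to \<open>A[b]\<close> as soon as \<open>t\<close> satisfies every relation
  that \<open>b\<close> satisfies modulo \<open>P\<close>.\<close>

lemma extend_point_hom:
  fixes \<phi> :: "'a \<Rightarrow> 'k::field"
  assumes \<phi>: "point_hom A P \<phi>"
    and t: "\<And>f. f \<in> coeffs_in A \<Longrightarrow> poly f b \<in> P \<Longrightarrow> poly (map_poly \<phi> f) t = 0"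
  obtains \<psi> where "point_hom ((\<lambda>f. poly f b) ` coeffs_in A) P \<psi>"
    "\<And>f. f \<in> coeffs_in A \<Longrightarrow> \<psi> (poly f b) = poly (map_poly \<phi> f) t"
proof -
  define \<psi> where "\<psi> x = poly (map_poly \<phi> (SOME f. f \<in> coeffs_in A \<and> poly f b = x)) t" for x
  have eq: "\<psi> (poly f b) = poly (map_poly \<phi> f) t" if f: "f \<in> coeffs_in A" for f
  proof -
    define g where "g = (SOME g. g \<in> coeffs_in A \<and> poly g b = poly f b)"
    have g: "g \<in> coeffs_in A \<and> poly g b = poly f b"
      unfolding g_def by (rule someI[of _ f]) (simp add: f)
    have d: "f - g \<in> coeffs_in A" using f g coeffs_in_closed[OF A(1)] by blast
    have "map_poly \<phi> f = map_poly \<phi> (g + (f - g))" by simp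
    also have "\<dots> = map_poly \<phi> g + map_poly \<phi> (f - g)"
      using g d by (intro point_hom_poly[OF \<phi>]) auto
    finally have "poly (map_poly \<phi> f) t = poly (map_poly \<phi> g) t"
      using t[OF d] g P_closed(1) by simp
    then show ?thesis unfolding \<psi>_def g_def by simp
  qed
  have 1: "[:1:] \<in> coeffs_in A" using coeffs_in_closed(7)[OF A(1)] subring_set_closed(2)[OF A(1)] .
  have "\<psi> 1 = 1"
    using eq[OF 1] \<phi> by (simp add: map_poly_def point_hom_def)
  moreover have "\<psi> (poly f b + poly g b) = \<psi> (poly f b) + \<psi> (poly g b)"
    "\<psi> (poly f b * poly g b) = \<psi> (poly f b) * \<psi> (poly g b)"
    if "f \<in> coeffs_in A" "g \<in> coeffs_in A" for f g
    using eq[of "f + g"] eq[of "f * g"] eq[of f] eq[of g] that coeffs_in_closed(2,4)[OF A(1)]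
      point_hom_poly(1,2)[OF \<phi>, of f g] by auto
  ultimately have "point_hom ((\<lambda>f. poly f b) ` coeffs_in A) P \<psi>"
    using eq t by (auto simp: point_hom_def)
  then show ?thesis using eq that by blast
qed

text \<open>When \<open>b\<close> is algebraic modulo \<open>P\<close>, a nonzero element of
  \<open>A[b]\<close> modulo \<open>P\<close> divides a nonzero element of \<open>A\<close>. That
  element is the polynomial \<open>w\<close> of least degree whose value is a multiple of
  \<open>poly g b\<close> modulo \<open>P\<close>: two divisions with remainder show that
  \<open>w\<close> is constant.\<close>

lemma inverse_mod_algebraic:
  assumes p: "p \<in> coeffs_in A" "poly p b \<in> P" "coeff p m \<notin> P" "\<forall>i>m. coeff p i = 0"
    and min: "\<And>f. f \<in> coeffs_in A \<Longrightarrow> poly f b \<in> P \<Longrightarrow> \<forall>i\<ge>m. coeff f i = 0 \<Longrightarrow> f \<in> coeffs_in P"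
    and g: "g \<in> coeffs_in A" "poly g b \<notin> P"
  shows "\<exists>c\<in>A - P. \<exists>y\<in>coeffs_in A. c - poly g b * poly y b \<in> P"
proof -
  define u where "u = poly g b"
  have uR: "u \<in> R" unfolding u_def by (intro poly_in_R g)
  define N where "N = {x. \<exists>y\<in>coeffs_in A. x - u * poly y b \<in> P}"
  have NP: "x - y \<in> N" if "x \<in> N" "y \<in> P" for x y
  proof -
    from that(1) obtain z where z: "z \<in> coeffs_in A" "x - u * poly z b \<in> P" by (auto simp: N_def)
    then have "(x - u * poly z b) - y \<in> P" using that(2) P_closed(5) by blast
    then show ?thesis using z(1) by (auto simp: N_def algebra_simps)
  qed
  have N_diff: "x * poly f b - y * poly h b \<in> N"
    if xy: "x \<in> N" "y \<in> N" and fh: "f \<in> coeffs_in A" "h \<in> coeffs_in A" for x y f h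
  proof -
    from xy obtain z w where zw: "z \<in> coeffs_in A" "x - u * poly z b \<in> P"
      "w \<in> coeffs_in A" "y - u * poly w b \<in> P" by (auto simp: N_def)
    have "(x - u * poly z b) * poly f b - (y - u * poly w b) * poly h b \<in> P"
      by (rule P_closed(5)[OF P_closed(7)[OF poly_in_R[OF fh(1)] zw(2)]
            P_closed(7)[OF poly_in_R[OF fh(2)] zw(4)]])
    moreover have "(x - u * poly z b) * poly f b - (y - u * poly w b) * poly h b =
      (x * poly f b - y * poly h b) - u * poly (z * f - w * h) b"
      by (simp add: algebra_simps)
    moreover have "z * f - w * h \<in> coeffs_in A"
      using zw fh by (intro coeffs_in_closed[OF A(1)])
    ultimately show ?thesis
      unfolding N_def mem_Collect_eq by (intro bexI[of _ "z * f - w * h"]) simp_all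
  qed
  have PN: "x \<in> N" if "x \<in> P" for x
    using that coeffs_in_closed(1)[OF A(1)] by (auto simp: N_def intro!: bexI[of _ 0])
  have uN: "u \<in> N"
    using coeffs_in_closed(7)[OF A(1) subring_set_closed(2)[OF A(1)]] P_closed(1)
    by (auto simp: N_def intro!: bexI[of _ "[:1:]"])
  have g': "g \<notin> coeffs_in P" using g(2) poly_in_P by blast
  obtain w e where w: "w \<in> coeffs_in A" "poly w b \<in> N" "coeff w e \<notin> P" "\<forall>i>e. coeff w i = 0"
    and w_min: "\<And>f. f \<in> coeffs_in A \<Longrightarrow> poly f b \<in> N \<Longrightarrow> \<forall>i\<ge>e. coeff f i = 0 \<Longrightarrow> f \<in> coeffs_in P"
    using exists_minimal_degree[of N g] NP g(1) uN g' unfolding u_def by blast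
  have coeff_R: "coeff f i \<in> R" if "f \<in> coeffs_in A" for f i
    using that A(2) by (auto simp: coeffs_in_def)
  have powA: "[:coeff f i ^ k:] \<in> coeffs_in A" if "f \<in> coeffs_in A" for f i k
    using that A(1) by (intro coeffs_in_closed subring_set_power) (auto simp: coeffs_in_def)
  \<comment> \<open>Otherwise the remainder of \<open>g\<close> on division by \<open>p\<close> has
    degree below \<open>e\<close> and a value in \<open>N\<close>, so it is zero modulo
    \<open>P\<close>. Then a power of the leading coefficient of \<open>p\<close> times
    \<open>u\<close> lies in \<open>P\<close>, against primality.\<close>
  have "e < m"
  proof (rule ccontr)
    assume "\<not> e < m"
    obtain k q r where qr: "q \<in> coeffs_in A" "r \<in> coeffs_in A" "\<forall>i\<ge>m. coeff r i = 0"
      "smult (coeff p m ^ k) g = q * p + r"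
      using pseudo_division[OF A(1) p(1,4) g(1), of "Suc (degree g)"] coeff_eq_0[of g] by auto
    have r: "poly r b = coeff p m ^ k * u - poly q b * poly p b"
      using arg_cong[OF qr(4), of "\<lambda>f. poly f b"] by (simp add: u_def)
    have "poly r b \<in> N"
      using N_diff[OF uN PN[OF p(2)] powA[OF p(1), of m k] qr(1)] by (simp add: r algebra_simps)
    then have "r \<in> coeffs_in P" using qr \<open>\<not> e < m\<close> by (intro w_min) auto
    then have "poly r b + poly q b * poly p b \<in> P"
      using p(2) qr(1) by (intro P_closed(4)[OF poly_in_P P_closed(6)[OF poly_in_R]])
    then have "coeff p m ^ k * u \<in> P" by (simp add: r)
    moreover have "coeff p m ^ k \<notin> P" "coeff p m ^ k \<in> R"
      using prime_ideal_of_power[OF R P coeff_R[OF p(1)] p(3)] coeff_R[OF p(1)] R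
      by (auto intro: subring_set_power)
    ultimately show False using primeD uR g(2) u_def by blast
  qed
  \<comment> \<open>For \<open>e > 0\<close> both the quotient \<open>q\<close> of \<open>p\<close>
    by \<open>w\<close> and \<open>w\<close> itself have degree below \<open>m\<close>. The
    remainder is zero modulo \<open>P\<close>, so the product of the values of \<open>q\<close> and
    \<open>w\<close> lies in \<open>P\<close>; by primality one of them is a relation for
    \<open>b\<close> shorter than \<open>p\<close>, hence trivial, and this contradicts a leading
    coefficient outside \<open>P\<close>.\<close>
  have "e = 0"
  proof (rule ccontr)
    assume "e \<noteq> 0"
    obtain k q r where qr: "q \<in> coeffs_in A" "r \<in> coeffs_in A" "\<forall>i\<ge>e. coeff r i = 0"
      "\<forall>i. Suc m \<le> i + e \<longrightarrow> coeff q i = 0" "smult (coeff w e ^ k) p = q * w + r"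
      using pseudo_division[OF A(1) w(1,4) p(1), of "Suc m"] p(4) by auto
    have r: "poly r b = coeff w e ^ k * poly p b - poly q b * poly w b"
      using arg_cong[OF qr(5), of "\<lambda>f. poly f b"] by simp
    have "poly r b \<in> N"
      using N_diff[OF PN[OF p(2)] w(2) powA[OF w(1), of e k] qr(1)] by (simp add: r algebra_simps)
    then have rP: "r \<in> coeffs_in P" using qr by (intro w_min) auto
    have "coeff w e ^ k \<in> R" using coeff_R[OF w(1)] R by (auto intro: subring_set_power)
    then have "coeff w e ^ k * poly p b - poly r b \<in> P"
      by (rule P_closed(5)[OF P_closed(6)[OF _ p(2)] poly_in_P[OF rP]])
    then have "poly q b * poly w b \<in> P" by (simp add: r)
    then consider "poly q b \<in> P" | "poly w b \<in> P"
      using primeD poly_in_R qr(1) w(1) by blast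
    then show False
    proof cases
      case 1
      have "q \<in> coeffs_in P" using qr(1,4) 1 \<open>e \<noteq> 0\<close> by (intro min) auto
      then have "q * w + r \<in> coeffs_in P" using rP w(1)
        by (intro coeffs_P_add coeffs_P_mult coeffs_AR)
      then have "coeff w e ^ k * coeff p m \<in> P"
        unfolding qr(5)[symmetric] by (auto simp: coeffs_in_def)
      then show False
        using primeD \<open>coeff w e ^ k \<in> R\<close> coeff_R[OF p(1)] p(3)
          prime_ideal_of_power[OF R P coeff_R[OF w(1)] w(3)] by blast
    next
      case 2
      then have "w \<in> coeffs_in P" using w(1,4) \<open>e < m\<close> by (intro min) auto
      then show False using w(3) by (auto simp: coeffs_in_def)
    qed
  qed
  then have "w = [:coeff w 0:]" using w(4)
    by (intro poly_eqI) (auto simp: coeff_pCons split: nat.splits)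
  from arg_cong[OF this, of "\<lambda>f. poly f b"] have "poly w b = coeff w 0" by simp
  moreover have "coeff w 0 \<in> A - P" using w(1,3) \<open>e = 0\<close> by (auto simp: coeffs_in_def)
  ultimately show ?thesis using w(2) by (auto simp: N_def u_def)
qed

text \<open>The condition that \<open>v\<close> is not mapped to zero cuts out an open set of points
  that lift to \<open>A[b]\<close> and stay off the zeros of \<open>poly g b\<close>. If
  \<open>b\<close> is transcendental modulo \<open>P\<close>, every value \<open>t\<close> is
  allowed, and an infinite field contains one that is not a root of the image of \<open>g\<close>.
  If \<open>b\<close> is algebraic, \<open>t\<close> has to be a root of the image of the minimal
  polynomial, and algebraic closedness provides it.\<close>

theorem point_hom_extension:
  assumes g: "g \<in> coeffs_in A" "poly g b \<notin> P"
  shows "\<exists>v\<in>A - P. \<forall>\<phi>::'a \<Rightarrow> 'k::{alg_closed_field, field_char_0}.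
    point_hom A P \<phi> \<longrightarrow> \<phi> v \<noteq> 0 \<longrightarrow>
    (\<exists>\<psi> t. point_hom ((\<lambda>f. poly f b) ` coeffs_in A) P \<psi> \<and> \<psi> (poly g b) \<noteq> 0 \<and>
      (\<forall>f\<in>coeffs_in A. \<psi> (poly f b) = poly (map_poly \<phi> f) t))"
proof (cases "\<forall>f\<in>coeffs_in A. poly f b \<in> P \<longrightarrow> f \<in> coeffs_in P")
  case True
  obtain i where i: "coeff g i \<notin> P" using g(2) poly_in_P by (auto simp: coeffs_in_def)
  show ?thesis
  proof (rule bexI[of _ "coeff g i"], intro allI impI)
    show "coeff g i \<in> A - P" using i g(1) by (auto simp: coeffs_in_def)
    fix \<phi> :: "'a \<Rightarrow> 'k" assume \<phi>: "point_hom A P \<phi>" "\<phi> (coeff g i) \<noteq> 0"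
    have "map_poly \<phi> g \<noteq> 0"
      using \<phi>(2) point_hom_poly(4)[OF \<phi>(1), of g i] by auto
    then have "finite {t. poly (map_poly \<phi> g) t = 0}" by (rule poly_roots_finite)
    then obtain t where t: "poly (map_poly \<phi> g) t \<noteq> 0"
      using infinite_UNIV_char_0[where ?'a = 'k] by (metis (mono_tags) UNIV_I finite_subset mem_Collect_eq subsetI)
    have "poly (map_poly \<phi> f) t = 0" if "f \<in> coeffs_in A" "poly f b \<in> P" for f
      using that True point_hom_poly(3)[OF \<phi>(1)] by auto
    then obtain \<psi> where "point_hom ((\<lambda>f. poly f b) ` coeffs_in A) P \<psi>"
      "\<And>f. f \<in> coeffs_in A \<Longrightarrow> \<psi> (poly f b) = poly (map_poly \<phi> f) t"
      using extend_point_hom[OF \<phi>(1)] by metis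
    then show "\<exists>\<psi> t. point_hom ((\<lambda>f. poly f b) ` coeffs_in A) P \<psi> \<and> \<psi> (poly g b) \<noteq> 0 \<and>
      (\<forall>f\<in>coeffs_in A. \<psi> (poly f b) = poly (map_poly \<phi> f) t)"
      using t g(1) by (intro exI[of _ \<psi>] exI[of _ t]) auto
  qed
next
  case False
  then obtain f where f: "f \<in> coeffs_in A" "poly f b \<in> P" "f \<notin> coeffs_in P" by blast
  obtain p m where p: "p \<in> coeffs_in A" "poly p b \<in> P" "coeff p m \<notin> P" "\<forall>i>m. coeff p i = 0"
    and min: "\<And>f. f \<in> coeffs_in A \<Longrightarrow> poly f b \<in> P \<Longrightarrow> \<forall>i\<ge>m. coeff f i = 0 \<Longrightarrow> f \<in> coeffs_in P"
    using exists_minimal_degree[OF _ f] P_closed(5) by blast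
  have m: "m > 0"
  proof (rule ccontr)
    assume "\<not> m > 0"
    then have "p = [:coeff p 0:]" using p(4)
      by (intro poly_eqI) (auto simp: coeff_pCons split: nat.splits)
    from arg_cong[OF this, of "\<lambda>f. poly f b"] have "poly p b = coeff p 0" by simp
    moreover have "m = 0" using \<open>\<not> m > 0\<close> by simp
    ultimately show False using p(2,3) by metis
  qed
  obtain c y where c: "c \<in> A" "c \<notin> P" and y: "y \<in> coeffs_in A" "c - poly g b * poly y b \<in> P"
    using inverse_mod_algebraic[OF p min g] by blast
  have a: "coeff p m \<in> A" using p(1) by (auto simp: coeffs_in_def)
  show ?thesis
  \<comment> \<open>The factor \<open>coeff p m\<close> preserves the degree of \<open>p\<close>
    under \<phi> and can be cancelled after pseudo-division. The factor \<open>c\<close> is a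
    multiple of \<open>poly g b\<close> modulo \<open>P\<close>, so the latter cannot be mapped to
    zero where \<open>c\<close> is not.\<close>
  proof (rule bexI[of _ "coeff p m * c"], intro allI impI)
    show "coeff p m * c \<in> A - P"
      using a c p(3) A primeD by (auto intro: subring_set_closed)
    fix \<phi> :: "'a \<Rightarrow> 'k" assume \<phi>: "point_hom A P \<phi>" "\<phi> (coeff p m * c) \<noteq> 0"
    have "\<phi> (coeff p m * c) = \<phi> (coeff p m) * \<phi> c" using \<phi>(1) a c by (auto simp: point_hom_def)
    then have nz: "\<phi> (coeff p m) \<noteq> 0" "\<phi> c \<noteq> 0" using \<phi>(2) by auto
    note hom = point_hom_poly[OF \<phi>(1)]
    have "degree (map_poly \<phi> p) > 0"
      using le_degree[of "map_poly \<phi> p" m] nz(1) m by (simp add: hom(4))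
    then obtain t where t: "poly (map_poly \<phi> p) t = 0" using alg_closed_imp_poly_has_root by blast
    have van: "poly (map_poly \<phi> f) t = 0" if f: "f \<in> coeffs_in A" "poly f b \<in> P" for f
    proof -
      obtain k q r where qr: "q \<in> coeffs_in A" "r \<in> coeffs_in A" "\<forall>i\<ge>m. coeff r i = 0"
        "smult (coeff p m ^ k) f = q * p + r"
        using pseudo_division[OF A(1) p(1,4) f(1), of "Suc (degree f)"] coeff_eq_0[of f] by auto
      have pk: "coeff p m ^ k \<in> A" using A(1) a by (rule subring_set_power)
      have r: "poly r b = coeff p m ^ k * poly f b - poly q b * poly p b"
        using arg_cong[OF qr(4), of "\<lambda>f. poly f b"] by simp
      have "poly r b \<in> P" unfolding r
        using f p(2) qr(1) pk A(2) poly_in_R by (intro P_closed(5) P_closed(6)) auto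
      then have "r \<in> coeffs_in P" using qr by (intro min) auto
      then have "map_poly \<phi> r = 0" using hom(3) qr(2) by blast
      then have "map_poly \<phi> (q * p + r) = map_poly \<phi> q * map_poly \<phi> p"
        using hom(1)[of "q * p" r] hom(2)[of q p] qr(1,2) p(1) coeffs_in_closed[OF A(1)] by auto
      moreover have "map_poly \<phi> ([:coeff p m ^ k:] * f) = map_poly \<phi> [:coeff p m ^ k:] * map_poly \<phi> f"
        using pk f(1) A(1) by (intro hom(2) coeffs_in_closed(7))
      moreover have "[:coeff p m ^ k:] * f = q * p + r" using qr(4) by simp
      ultimately have "poly (map_poly \<phi> [:coeff p m ^ k:]) t * poly (map_poly \<phi> f) t = 0"
        using t by (metis mult_zero_right poly_mult)
      moreover have "\<phi> (coeff p m ^ j) = \<phi> (coeff p m) ^ j" for j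
      proof (induction j)
        case (Suc j)
        then show ?case using \<phi>(1) a subring_set_power[OF A(1) a, of j] by (simp add: point_hom_def)
      qed (use \<phi>(1) in \<open>simp add: point_hom_def\<close>)
      moreover have "poly (map_poly \<phi> [:coeff p m ^ k:]) t = \<phi> (coeff p m ^ k)"
      proof -
        have "map_poly \<phi> [:coeff p m ^ k:] = [:\<phi> (coeff p m ^ k):]"
          using hom(4)[of "[:coeff p m ^ k:]"] hom(4)[of 0 0]
          by (intro poly_eqI) (auto simp: coeff_pCons split: nat.splits)
        then show ?thesis by simp
      qed
      ultimately show ?thesis using nz(1) by auto
    qed
    then obtain \<psi> where \<psi>: "point_hom ((\<lambda>f. poly f b) ` coeffs_in A) P \<psi>"
      "\<And>f. f \<in> coeffs_in A \<Longrightarrow> \<psi> (poly f b) = poly (map_poly \<phi> f) t"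
      using extend_point_hom[OF \<phi>(1)] by metis
    have cA: "[:c:] \<in> coeffs_in A" using coeffs_in_closed(7)[OF A(1) c(1)] .
    have "map_poly \<phi> [:c:] = [:\<phi> c:]"
      using hom(4)[of "[:c:]"] hom(4)[of 0 0]
      by (intro poly_eqI) (auto simp: coeff_pCons split: nat.splits)
    moreover have d: "[:c:] - g * y \<in> coeffs_in A"
      using coeffs_in_closed(3)[OF A(1) cA coeffs_in_closed(4)[OF A(1) g(1) y(1)]] .
    moreover have "poly (map_poly \<phi> ([:c:] - g * y)) t = 0"
      using y(2) by (intro van d) simp
    moreover have "map_poly \<phi> [:c:] = map_poly \<phi> ([:c:] - g * y) + map_poly \<phi> g * map_poly \<phi> y"
      using hom(1)[OF d, of "g * y"] hom(2)[OF g(1) y(1)] g(1) y(1) coeffs_in_closed(4)[OF A(1)] by auto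
    ultimately have "poly [:\<phi> c:] t = poly (map_poly \<phi> g) t * poly (map_poly \<phi> y) t"
      by (metis add_0 poly_add poly_mult)
    then have "\<phi> c = poly (map_poly \<phi> g) t * poly (map_poly \<phi> y) t" by simp
    then have "\<psi> (poly g b) \<noteq> 0" using nz(2) \<psi>(2)[OF g(1)] by auto
    then show "\<exists>\<psi> t. point_hom ((\<lambda>f. poly f b) ` coeffs_in A) P \<psi> \<and> \<psi> (poly g b) \<noteq> 0 \<and>
      (\<forall>f\<in>coeffs_in A. \<psi> (poly f b) = poly (map_poly \<phi> f) t)"
      using \<psi> by (intro exI[of _ \<psi>] exI[of _ t]) auto
  qed
qed

end

section \<open>The Nullstellensatz\<close>

text \<open>Zorn's lemma gives a maximal proper ideal \<open>M\<close> above \<open>I\<close>, and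
  it is prime because every element outside \<open>M\<close> is invertible modulo
  \<open>M\<close>.\<close>

lemma ideal_of_subset_prime:
  assumes R: "subring_set R" and I: "ideal_of R I" "1 \<notin> I"
  obtains P where "prime_ideal_of R P" "I \<subseteq> P"
proof -
  define \<A> where "\<A> = {J. ideal_of R J \<and> I \<subseteq> J \<and> 1 \<notin> J}"
  have "I \<in> \<A>" using I by (simp add: \<A>_def)
  have "\<exists>M\<in>\<A>. \<forall>J\<in>\<A>. M \<subseteq> J \<longrightarrow> J = M"
  proof (rule subset_Zorn_nonempty)
    show "\<A> \<noteq> {}" using \<open>I \<in> \<A>\<close> by blast
    fix \<C> assume \<C>: "\<C> \<noteq> {}" "subset.chain \<A> \<C>"
    have sub: "\<C> \<subseteq> \<A>" and tot: "\<And>J K. J \<in> \<C> \<Longrightarrow> K \<in> \<C> \<Longrightarrow> J \<subseteq> K \<or> K \<subseteq> J"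
      using \<C>(2) by (auto simp: subset_chain_def)
    then have mem: "ideal_of R J" "I \<subseteq> J" "1 \<notin> J" if "J \<in> \<C>" for J
      using that by (auto simp: \<A>_def)
    have "x + y \<in> \<Union>\<C>" if xy: "x \<in> \<Union>\<C>" "y \<in> \<Union>\<C>" for x y
    proof -
      from xy obtain J K where JK: "J \<in> \<C>" "K \<in> \<C>" "x \<in> J" "y \<in> K" by blast
      then obtain L where "L \<in> \<C>" "x \<in> L" "y \<in> L" using tot[of J K] by blast
      then show ?thesis using mem(1)[of L] by (auto simp: ideal_of_def)
    qed
    moreover have "\<Union>\<C> \<subseteq> R" "\<And>r x. r \<in> R \<Longrightarrow> x \<in> \<Union>\<C> \<Longrightarrow> r * x \<in> \<Union>\<C>" "1 \<notin> \<Union>\<C>"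
      using mem unfolding ideal_of_def by blast+
    moreover have "0 \<in> \<Union>\<C>" "I \<subseteq> \<Union>\<C>"
      using \<C>(1) mem unfolding ideal_of_def by blast+
    ultimately show "\<Union>\<C> \<in> \<A>" by (auto simp: \<A>_def ideal_of_def)
  qed
  then obtain M where M: "ideal_of R M" "I \<subseteq> M" "1 \<notin> M"
    and max: "\<And>J. ideal_of R J \<Longrightarrow> I \<subseteq> J \<Longrightarrow> 1 \<notin> J \<Longrightarrow> M \<subseteq> J \<Longrightarrow> J = M"
    by (auto simp: \<A>_def)
  note M_closed = ideal_of_closed[OF R M(1)]
  note R_closed = subring_set_closed[OF R]
  have comax: "\<exists>r\<in>R. 1 - r * x \<in> M" if x: "x \<in> R" "x \<notin> M" for x
  proof (rule ccontr)
    assume no: "\<not> (\<exists>r\<in>R. 1 - r * x \<in> M)"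
    \<comment> \<open>This is the ideal generated by \<open>M\<close> and \<open>x\<close>; it is
      proper exactly when \<open>x\<close> has no inverse modulo \<open>M\<close>.\<close>
    define J where "J = {y. \<exists>r\<in>R. y - r * x \<in> M}"
    have J: "y \<in> J" if "r \<in> R" "y - r * x \<in> M" for y r using that by (auto simp: J_def)
    have MJ: "M \<subseteq> J" using R_closed(1) J[of 0] by auto
    have "y \<in> R" if yJ: "y \<in> J" for y
    proof -
      obtain r where r: "r \<in> R" "y - r * x \<in> M" using yJ by (auto simp: J_def)
      then have "(y - r * x) + r * x \<in> R" using x(1) M_closed(2) R_closed(4,6) by blast
      then show ?thesis by simp
    qed
    moreover have "y + z \<in> J" if yz: "y \<in> J" "z \<in> J" for y z
    proof -
      from yz obtain r s where rs: "r \<in> R" "y - r * x \<in> M" "s \<in> R" "z - s * x \<in> M"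
        by (auto simp: J_def)
      have "(y - r * x) + (z - s * x) \<in> M" using rs M_closed(4) by blast
      then have "y + z - (r + s) * x \<in> M" by (simp add: algebra_simps)
      then show ?thesis using J rs(1,3) R_closed(4) by blast
    qed
    moreover have "s * y \<in> J" if sy: "s \<in> R" "y \<in> J" for s y
    proof -
      obtain r where r: "r \<in> R" "y - r * x \<in> M" using sy by (auto simp: J_def)
      have "s * (y - r * x) \<in> M" using r sy(1) M_closed(6) by blast
      then have "s * y - (s * r) * x \<in> M" by (simp add: algebra_simps)
      then show ?thesis using J r(1) sy(1) R_closed(6) by blast
    qed
    ultimately have "ideal_of R J"
      using MJ M_closed(1) by (auto simp: ideal_of_def)
    moreover have "1 \<notin> J" using no by (auto simp: J_def)
    ultimately have "J = M" using max MJ M(2) by blast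
    moreover have "x \<in> J" using J[of 1 x] R_closed(2) M_closed(1) by simp
    ultimately show False using x(2) by blast
  qed
  have "x \<in> M \<or> y \<in> M" if xy: "x \<in> R" "y \<in> R" "x * y \<in> M" for x y
  proof (rule ccontr)
    assume "\<not> (x \<in> M \<or> y \<in> M)"
    then obtain r where r: "r \<in> R" "1 - r * x \<in> M" and "y \<notin> M" using comax[OF xy(1)] by blast
    have "y * (1 - r * x) + r * (x * y) \<in> M"
      by (rule M_closed(4)[OF M_closed(6)[OF xy(2) r(2)] M_closed(6)[OF r(1) xy(3)]])
    then show False using \<open>y \<notin> M\<close> by (simp add: algebra_simps)
  qed
  then have "prime_ideal_of R M" using M by (auto simp: prime_ideal_of_def)
  then show ?thesis using that M(2) by blast
qed

section \<open>Common zeros of an ideal of polynomial functions\<close>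

lemma poly_funs_subring: "subring_set (poly_funs :: ('k::comm_ring_1 ^ 'i \<Rightarrow> 'k) set)"
proof -
  have "(\<lambda>_. 1) \<in> (poly_funs :: ('k ^ 'i \<Rightarrow> 'k) set)" by (rule poly_funs.const)
  then have 1: "1 \<in> (poly_funs :: ('k ^ 'i \<Rightarrow> 'k) set)" by (simp add: one_fun_def)
  have "f - g \<in> poly_funs" if "f \<in> poly_funs" "g \<in> poly_funs" for f g :: "'k ^ 'i \<Rightarrow> 'k"
  proof -
    have "f + (\<lambda>_. - 1) * g \<in> poly_funs"
      using that by (intro poly_funs.intros)
    then show ?thesis by (simp add: fun_diff_def plus_fun_def times_fun_def)
  qed
  with 1 show ?thesis by (auto simp: subring_set_def poly_funs.mult)
qed

text \<open>This is the statement that survives the adjunction of a coordinate. The existence of a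
  single homomorphism would not: lifting one to \<open>A[b]\<close> requires it to be nonzero at an
  element \<open>v\<close> that depends on the \<open>g\<close> under consideration.\<close>

definition separated :: "('k::comm_ring_1 ^ 'i \<Rightarrow> 'k) set \<Rightarrow> ('k ^ 'i \<Rightarrow> 'k) set \<Rightarrow> bool" where
  "separated A P \<longleftrightarrow> (\<forall>u\<in>A - P. \<exists>\<phi>. point_hom A P \<phi> \<and> (\<forall>c. \<phi> (\<lambda>_. c) = c) \<and> \<phi> u \<noteq> (0::'k))"

lemma separated_adjoin:
  fixes P :: "('k::{alg_closed_field, field_char_0} ^ 'i \<Rightarrow> 'k) set"
  assumes "prime_extension poly_funs P A b" and const: "range (\<lambda>c _. c) \<subseteq> A" and sep: "separated A P"
  shows "separated ((\<lambda>f. poly f b) ` coeffs_in A) P"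
  unfolding separated_def
proof
  interpret prime_extension poly_funs P A b by fact
  fix u assume "u \<in> (\<lambda>f. poly f b) ` coeffs_in A - P"
  then obtain g where g: "g \<in> coeffs_in A" "poly g b \<notin> P" "u = poly g b" by auto
  obtain v where v: "v \<in> A - P" and ext: "\<And>\<phi>::_ \<Rightarrow> 'k.
    point_hom A P \<phi> \<Longrightarrow> \<phi> v \<noteq> 0 \<Longrightarrow>
    (\<exists>\<psi> t. point_hom ((\<lambda>f. poly f b) ` coeffs_in A) P \<psi> \<and> \<psi> (poly g b) \<noteq> 0 \<and>
      (\<forall>f\<in>coeffs_in A. \<psi> (poly f b) = poly (map_poly \<phi> f) t))"
    using point_hom_extension[OF g(1,2), where ?'k = 'k] by blast
  obtain \<phi> :: "_ \<Rightarrow> 'k" where \<phi>: "point_hom A P \<phi>" "\<And>c. \<phi> (\<lambda>_. c) = c" "\<phi> v \<noteq> 0"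
    using sep v unfolding separated_def by blast
  obtain \<psi> t where \<psi>: "point_hom ((\<lambda>f. poly f b) ` coeffs_in A) P \<psi>" "\<psi> u \<noteq> 0"
    "\<And>f. f \<in> coeffs_in A \<Longrightarrow> \<psi> (poly f b) = poly (map_poly \<phi> f) t"
    using ext[OF \<phi>(1,3)] g(3) by blast
  have "\<psi> (\<lambda>_. c) = c" for c
  proof -
    have "[:\<lambda>_. c:] \<in> coeffs_in A" using const A(1) by (intro coeffs_in_closed(7)) auto
    moreover have "map_poly \<phi> [:\<lambda>_. c:] = [:c:]"
      using point_hom_poly(4)[OF \<phi>(1), of "[:\<lambda>_. c:]"] point_hom_poly(4)[OF \<phi>(1), of 0 0] \<phi>(2)
      by (intro poly_eqI) (auto simp: coeff_pCons split: nat.splits)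
    ultimately show ?thesis using \<psi>(3)[of "[:\<lambda>_. c:]"] by simp
  qed
  then show "\<exists>\<phi>. point_hom ((\<lambda>f. poly f b) ` coeffs_in A) P \<phi> \<and> (\<forall>c. \<phi> (\<lambda>_. c) = c) \<and> \<phi> u \<noteq> 0"
    using \<psi> by blast
qed

text \<open>Adjoining the coordinates one after the other to the constants reaches all of
  \<open>poly_funs\<close>. A homomorphism on it that fixes the constants is evaluation at the point
  formed by the images of the coordinates; if it vanishes on a prime ideal above \<open>I\<close>,
  that point is a common zero of \<open>I\<close>.\<close>

theorem nullstellensatz:
  fixes I :: "('k::{alg_closed_field, field_char_0} ^ 'i \<Rightarrow> 'k) set"
  assumes I: "ideal_of poly_funs I" "\<And>p. \<exists>f\<in>I. f p \<noteq> 0"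
  shows "1 \<in> I"
proof (rule ccontr)
  let ?R = "poly_funs :: ('k ^ 'i \<Rightarrow> 'k) set"
  assume "1 \<notin> I"
  then obtain P where P: "prime_ideal_of ?R P" and IP: "I \<subseteq> P"
    using ideal_of_subset_prime[OF poly_funs_subring I(1)] by blast
  have idP: "ideal_of ?R P" and "1 \<notin> P" using P by (auto simp: prime_ideal_of_def)
  have "\<exists>A. subring_set A \<and> A \<subseteq> ?R \<and> range (\<lambda>c _. c) \<subseteq> A \<and> (\<forall>j\<in>J. (\<lambda>p. p $ j) \<in> A) \<and> separated A P"
    if "finite J" for J :: "'i set"
    using that
  proof (induction J)
    case empty
    let ?C = "range (\<lambda>c _. c) :: ('k ^ 'i \<Rightarrow> 'k) set"
    have "subring_set ?C"
      by (auto simp: subring_set_def one_fun_def fun_diff_def times_fun_def)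
    moreover have "?C \<subseteq> ?R" by (auto intro: poly_funs.const)
    moreover have "separated ?C P"
      unfolding separated_def
    proof
      fix u assume u: "u \<in> ?C - P"
      \<comment> \<open>A nonzero constant is a unit and cannot lie in \<open>P\<close>. So
        evaluation at any point, here at the origin, vanishes on the constants in
        \<open>P\<close>.\<close>
      have CP: "f = 0" if f: "f \<in> ?C \<inter> P" for f
      proof (rule ccontr)
        obtain c where c: "f = (\<lambda>_. c)" using f by auto
        assume "f \<noteq> 0"
        then have "c \<noteq> 0" using c by (auto simp: zero_fun_def)
        have "(\<lambda>_. inverse c) * f \<in> P"
          using f ideal_of_closed(6)[OF poly_funs_subring idP] poly_funs.const by blast
        moreover have "(\<lambda>_. inverse c) * f = 1" using c \<open>c \<noteq> 0\<close> by (simp add: fun_eq_iff)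
        ultimately show False using \<open>1 \<notin> P\<close> by simp
      qed
      have "u \<noteq> 0" using u ideal_of_closed(1)[OF poly_funs_subring idP] by auto
      moreover have "f 0 = 0" if "f \<in> ?C \<inter> P" for f using CP[OF that] by simp
      ultimately show "\<exists>\<phi>. point_hom ?C P \<phi> \<and> (\<forall>c. \<phi> (\<lambda>_. c) = c) \<and> \<phi> u \<noteq> 0"
        using u by (intro exI[of _ "\<lambda>f. f 0"]) (auto simp: point_hom_def zero_fun_def)
    qed
    ultimately show ?case by (intro exI[of _ ?C]) auto
  next
    case (insert j J)
    then obtain A where A: "subring_set A" "A \<subseteq> ?R" "range (\<lambda>c _. c) \<subseteq> A"
      "\<forall>j\<in>J. (\<lambda>p. p $ j) \<in> A" "separated A P" by blast
    let ?b = "\<lambda>p :: 'k ^ 'i. p $ j"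
    have ext: "prime_extension ?R P A ?b"
      using A P poly_funs_subring poly_funs.coord by unfold_locales auto
    let ?B = "(\<lambda>f. poly f ?b) ` coeffs_in A"
    have mem: "poly f ?b \<in> ?B" if "f \<in> coeffs_in A" for f using that by blast
    have AB: "A \<subseteq> ?B"
    proof
      fix a assume "a \<in> A"
      then show "a \<in> ?B" using mem[OF coeffs_in_closed(7)[OF A(1)], of a] by simp
    qed
    have "subring_set ?B"
      using AB subring_set_closed(2)[OF A(1)]
      by (auto simp: subring_set_def simp flip: poly_diff poly_mult
          intro!: mem coeffs_in_closed[OF A(1)])
    moreover have "?B \<subseteq> ?R"
      using prime_extension.poly_in_R[OF ext] by blast
    moreover have "?b \<in> ?B"
    proof -
      have "monom 1 1 \<in> coeffs_in A" by (intro coeffs_in_closed[OF A(1)] subring_set_closed[OF A(1)])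
      from mem[OF this] show ?thesis by (simp add: poly_monom)
    qed
    moreover have "separated ?B P" by (rule separated_adjoin[OF ext A(3,5)])
    ultimately show ?case using A(3,4) AB by (intro exI[of _ ?B]) blast
  qed
  from this[of UNIV] obtain A where A: "subring_set A" "A \<subseteq> ?R" "range (\<lambda>c _. c) \<subseteq> A"
    "\<And>j. (\<lambda>p. p $ j) \<in> A" "separated A P" by auto
  have A_all: "f \<in> A" if "f \<in> ?R" for f
    using that A by (induction rule: poly_funs.induct) (auto intro: subring_set_closed)
  obtain \<phi> where \<phi>: "point_hom A P \<phi>" "\<And>c. \<phi> (\<lambda>_. c) = c"
    using A(1,5) \<open>1 \<notin> P\<close> subring_set_closed(2) unfolding separated_def by blast
  define p where "p = (\<chi> j. \<phi> (\<lambda>p. p $ j))"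
  have ev: "\<phi> f = f p" if "f \<in> ?R" for f
    using that
  proof (induction rule: poly_funs.induct)
    case (add f g)
    then have "\<phi> (f + g) = (f + g) p" using \<phi>(1) A_all by (simp add: point_hom_def)
    then show ?case by (simp add: plus_fun_def)
  next
    case (mult f g)
    then have "\<phi> (f * g) = (f * g) p" using \<phi>(1) A_all by (simp add: point_hom_def)
    then show ?case by (simp add: times_fun_def)
  qed (auto simp: \<phi>(2) p_def)
  obtain f where f: "f \<in> I" "f p \<noteq> 0" using I(2) by blast
  have "f \<in> ?R" "f \<in> P" using f(1) IP I(1) by (auto simp: ideal_of_def)
  then have "\<phi> f = 0" using \<phi>(1) A_all by (auto simp: point_hom_def)
  then show False using ev \<open>f \<in> ?R\<close> f(2) by simp
qed

section \<open>Local generation of vector fields\<close>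

context module
begin

text \<open>The \<open>u j\<close> are eliminated one at a time: the coefficient
  \<open>h - \<mu> t\<close> of \<open>u t\<close> is 1 modulo \<open>I\<close>, and multiplying the
  other relations by it allows \<open>u t\<close> to be substituted. The applications start with
  \<open>h = 1\<close>; the general \<open>h\<close> in the assumption is there because an
  elimination produces such factors.\<close>

lemma nakayama:
  assumes R: "subring_set R" and I: "ideal_of R I"
    and W: "0 \<in> W" "\<And>x y. x \<in> W \<Longrightarrow> y \<in> W \<Longrightarrow> x + y \<in> W" "\<And>r x. r \<in> R \<Longrightarrow> x \<in> W \<Longrightarrow> scale r x \<in> W"
    and J: "finite J"
    and u: "\<And>j. j \<in> J \<Longrightarrow> \<exists>h w \<mu>. 1 - h \<in> I \<and> w \<in> W \<and> (\<forall>l\<in>J. \<mu> l \<in> I) \<and>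
              scale h (u j) = w + (\<Sum>l\<in>J. scale (\<mu> l) (u l))"
  shows "\<exists>h. 1 - h \<in> I \<and> (\<forall>j\<in>J. scale h (u j) \<in> W)"
  using J u
proof (induction J)
  case empty
  show ?case using ideal_of_closed(1)[OF R I] by (intro exI[of _ 1]) simp
next
  case (insert t J)
  note I_closed = ideal_of_closed[OF R I]
  note R_closed = subring_set_closed[OF R]
  have in_R: "h \<in> R" if "1 - h \<in> I" for h
  proof -
    have "1 - (1 - h) \<in> R" using that R_closed(2,5) I_closed(2) by blast
    then show ?thesis by simp
  qed
  have mult1: "1 - g * h \<in> I" if "1 - g \<in> I" "1 - h \<in> I" for g h
  proof -
    have "(1 - g) + g * (1 - h) \<in> I"
      by (rule I_closed(4)[OF that(1) I_closed(6)[OF in_R[OF that(1)] that(2)]])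
    then show ?thesis by (simp add: algebra_simps)
  qed
  obtain h w \<mu> where h: "1 - h \<in> I" "w \<in> W" "\<forall>l\<in>insert t J. \<mu> l \<in> I"
    "scale h (u t) = w + (\<Sum>l\<in>insert t J. scale (\<mu> l) (u l))"
    using insert.prems[of t] by blast
  define k where "k = h - \<mu> t"
  have "(1 - h) + \<mu> t \<in> I" using h I_closed(4) by blast
  then have k1: "1 - k \<in> I" by (simp add: k_def algebra_simps)
  have kt: "scale k (u t) = w + (\<Sum>l\<in>J. scale (\<mu> l) (u l))"
    using h(4) insert.hyps by (simp add: k_def scale_left_diff_distrib algebra_simps)
  have "\<exists>h w \<mu>. 1 - h \<in> I \<and> w \<in> W \<and> (\<forall>l\<in>J. \<mu> l \<in> I) \<and>
              scale h (u j) = w + (\<Sum>l\<in>J. scale (\<mu> l) (u l))" if jJ: "j \<in> J" for j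
  proof -
    obtain h' w' \<mu>' where h': "1 - h' \<in> I" "w' \<in> W" "\<forall>l\<in>insert t J. \<mu>' l \<in> I"
      "scale h' (u j) = w' + (\<Sum>l\<in>insert t J. scale (\<mu>' l) (u l))"
      using insert.prems[of j] jJ by blast
    have "scale (k * h') (u j) = scale k (w' + scale (\<mu>' t) (u t) + (\<Sum>l\<in>J. scale (\<mu>' l) (u l)))"
      using h'(4) insert.hyps by (simp flip: scale_scale add: add.assoc)
    also have "\<dots> = scale k w' + scale (\<mu>' t) (scale k (u t)) + (\<Sum>l\<in>J. scale (k * \<mu>' l) (u l))"
      by (simp add: scale_right_distrib scale_sum_right mult.commute)
    also have "\<dots> = (scale k w' + scale (\<mu>' t) w) + (\<Sum>l\<in>J. scale (\<mu>' t * \<mu> l + k * \<mu>' l) (u l))"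
      by (simp add: kt scale_right_distrib scale_sum_right scale_left_distrib sum.distrib algebra_simps)
    finally have "scale (k * h') (u j) =
      (scale k w' + scale (\<mu>' t) w) + (\<Sum>l\<in>J. scale (\<mu>' t * \<mu> l + k * \<mu>' l) (u l))" .
    moreover have "1 - k * h' \<in> I" by (rule mult1[OF k1 h'(1)])
    moreover have \<mu>t: "\<mu>' t \<in> R" using h'(3) I_closed(2) by blast
    have "scale k w' + scale (\<mu>' t) w \<in> W"
      by (rule W(2)[OF W(3)[OF in_R[OF k1] h'(2)] W(3)[OF \<mu>t h(2)]])
    moreover have "\<mu>' t * \<mu> l + k * \<mu>' l \<in> I" if "l \<in> J" for l
      using h(3) h'(3) that
      by (intro I_closed(4)[OF I_closed(6)[OF \<mu>t] I_closed(6)[OF in_R[OF k1]]]) auto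
    ultimately show ?thesis
      by (intro exI[of _ "k * h'"] exI[of _ "scale k w' + scale (\<mu>' t) w"]
          exI[of _ "\<lambda>l. \<mu>' t * \<mu> l + k * \<mu>' l"]) simp
  qed
  then obtain g where g: "1 - g \<in> I" "\<forall>j\<in>J. scale g (u j) \<in> W"
    using insert.IH by blast
  have W_sum: "(\<Sum>l\<in>S. f l) \<in> W" if "\<And>l. l \<in> S \<Longrightarrow> f l \<in> W" for S :: "'c set" and f
    using that by (induction S rule: infinite_finite_induct) (auto intro: W)
  have "scale (k * g) (u j) \<in> W" if "j \<in> J" for j
    using W(3)[OF in_R[OF k1]] g(2) that by (metis scale_scale)
  moreover have "scale (k * g) (u t) \<in> W"
  proof -
    have "scale (k * g) (u t) = scale g (scale k (u t))" by (simp add: mult.commute)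
    also have "\<dots> = scale g w + (\<Sum>l\<in>J. scale (\<mu> l) (scale g (u l)))"
      by (simp add: kt scale_right_distrib scale_sum_right mult.commute)
    also have "\<dots> \<in> W"
      by (rule W(2)[OF W(3)[OF in_R[OF g(1)] h(2)] W_sum[OF W(3)]])
        (use h(3) g(2) I_closed(2) in auto)
    finally show ?thesis .
  qed
  ultimately show ?case using mult1[OF k1 g(1)] by (intro exI[of _ "k * g"]) auto
qed

end

section \<open>Directional derivatives, read off from restrictions to lines\<close>

definition dir_deriv :: "'k::field_char_0 ^ 'i \<Rightarrow> 'k ^ 'i \<Rightarrow> ('k ^ 'i \<Rightarrow> 'k) \<Rightarrow> 'k" where
  "dir_deriv p v f = coeff (THE q. \<forall>t. poly q t = f (p + t *s v)) 1"

text \<open>The definite description is meaningful because over a field of characteristic zero a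
  polynomial is determined by its values.\<close>

lemma dir_deriv_eqI:
  fixes f :: "'k::field_char_0 ^ 'i \<Rightarrow> 'k"
  assumes "\<And>t. poly q t = f (p + t *s v)"
  shows "dir_deriv p v f = coeff q 1"
proof -
  have "(THE q. \<forall>t. poly q t = f (p + t *s v)) = q"
  proof (rule the_equality)
    fix r assume "\<forall>t. poly r t = f (p + t *s v)"
    then have "poly r = poly q" using assms by auto
    then show "r = q" by (simp add: poly_eq_poly_eq_iff)
  qed (use assms in auto)
  then show ?thesis by (simp add: dir_deriv_def)
qed

lemma poly_funs_on_line:
  assumes "f \<in> (poly_funs :: ('k::field_char_0 ^ 'i \<Rightarrow> 'k) set)"
  shows "\<exists>q. \<forall>t. poly q t = f (p + t *s v)"
  using assms
proof (induction rule: poly_funs.induct)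
  case (const c)
  show ?case by (intro exI[of _ "[:c:]"]) simp
next
  case (coord j)
  show ?case by (intro exI[of _ "[:p $ j, v $ j:]"]) (simp add: mult.commute)
next
  case (add f g)
  then show ?case by (metis plus_fun_apply poly_add)
next
  case (mult f g)
  then show ?case by (metis times_fun_apply poly_mult)
qed

lemma dir_deriv_const [simp]: "dir_deriv p v (\<lambda>_. c) = 0"
  by (subst dir_deriv_eqI[of "[:c:]"]) auto

lemma dir_deriv_coord [simp]: "dir_deriv p v (\<lambda>p. p $ j) = v $ j"
  by (subst dir_deriv_eqI[of "[:p $ j, v $ j:]"]) auto

lemma
  assumes "f \<in> poly_funs" "g \<in> poly_funs"
  shows dir_deriv_add: "dir_deriv p v (f + g) = dir_deriv p v f + dir_deriv p v g"
    and dir_deriv_mult: "dir_deriv p v (f * g) = f p * dir_deriv p v g + g p * dir_deriv p v f"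
proof -
  obtain q r where q: "\<And>t. poly q t = f (p + t *s v)" and r: "\<And>t. poly r t = g (p + t *s v)"
    using poly_funs_on_line[OF assms(1), of p v] poly_funs_on_line[OF assms(2), of p v] by blast
  have "dir_deriv p v (f + g) = coeff (q + r) 1"
    by (rule dir_deriv_eqI) (simp add: q r)
  then show "dir_deriv p v (f + g) = dir_deriv p v f + dir_deriv p v g"
    using dir_deriv_eqI[of q, OF q] dir_deriv_eqI[of r, OF r] by simp
  have "dir_deriv p v (f * g) = coeff (q * r) 1"
    by (rule dir_deriv_eqI) (simp add: q r)
  moreover have "coeff q 0 = f p" "coeff r 0 = g p"
    using q[of 0] r[of 0] by (auto simp: poly_0_coeff_0)
  ultimately show "dir_deriv p v (f * g) = f p * dir_deriv p v g + g p * dir_deriv p v f"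
    using dir_deriv_eqI[of q, OF q] dir_deriv_eqI[of r, OF r] by (simp add: coeff_mult mult.commute)
qed

lemma dir_deriv_scale: "f \<in> poly_funs \<Longrightarrow> dir_deriv p v ((\<lambda>_. c) * f) = c * dir_deriv p v f"
  by (simp add: dir_deriv_mult poly_funs.const)

text \<open>The \<open>G j\<close> are the partial derivatives. Their existence yields both
  linearity in \<open>v\<close> and, for fixed \<open>v\<close>, polynomial dependence on the
  point.\<close>

lemma dir_deriv_gradient:
  fixes f :: "'k::field_char_0 ^ 'i \<Rightarrow> 'k"
  assumes "f \<in> poly_funs"
  shows "\<exists>G. (\<forall>j. G j \<in> poly_funs) \<and> (\<forall>p v. dir_deriv p v f = (\<Sum>j\<in>UNIV. G j p * v $ j))"
  using assms
proof (induction rule: poly_funs.induct)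
  case (const c)
  show ?case by (intro exI[of _ "\<lambda>_ _. 0"]) (auto intro: poly_funs.const)
next
  case (coord j)
  show ?case by (intro exI[of _ "\<lambda>i _. if i = j then 1 else 0"])
      (auto intro: poly_funs.const simp: if_distrib[of "\<lambda>x. x * _"] cong: if_cong)
next
  case (add f g)
  then obtain F G where FG: "\<forall>j. F j \<in> poly_funs" "\<forall>p v. dir_deriv p v f = (\<Sum>j\<in>UNIV. F j p * v $ j)"
    "\<forall>j. G j \<in> poly_funs" "\<forall>p v. dir_deriv p v g = (\<Sum>j\<in>UNIV. G j p * v $ j)" by blast
  have "dir_deriv p v (f + g) = (\<Sum>j\<in>UNIV. (F j + G j) p * v $ j)" for p v
    unfolding dir_deriv_add[OF add(1,2)] using FG by (simp add: sum.distrib algebra_simps)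
  moreover have "\<forall>j. F j + G j \<in> poly_funs" using FG by (auto intro: poly_funs.intros)
  ultimately show ?case by (intro exI[of _ "\<lambda>j. F j + G j"]) blast
next
  case (mult f g)
  then obtain F G where FG: "\<forall>j. F j \<in> poly_funs" "\<forall>p v. dir_deriv p v f = (\<Sum>j\<in>UNIV. F j p * v $ j)"
    "\<forall>j. G j \<in> poly_funs" "\<forall>p v. dir_deriv p v g = (\<Sum>j\<in>UNIV. G j p * v $ j)" by blast
  have "dir_deriv p v (f * g) = (\<Sum>j\<in>UNIV. (f * G j + g * F j) p * v $ j)" for p v
    unfolding dir_deriv_mult[OF mult(1,2)] using FG
    by (simp add: sum.distrib algebra_simps sum_distrib_left)
  moreover have "\<forall>j. f * G j + g * F j \<in> poly_funs" using FG mult(1,2) by (auto intro!: poly_funs.intros)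
  ultimately show ?case by (intro exI[of _ "\<lambda>j. f * G j + g * F j"]) blast
qed

lemma dir_deriv_poly_funs:
  assumes "f \<in> poly_funs"
  shows "(\<lambda>q. dir_deriv q v f) \<in> poly_funs"
proof -
  obtain G where G: "\<forall>j. G j \<in> poly_funs" "\<forall>p v. dir_deriv p v f = (\<Sum>j\<in>UNIV. G j p * v $ j)"
    using dir_deriv_gradient[OF assms] by blast
  have "(\<lambda>q. dir_deriv q v f) = (\<Sum>j\<in>UNIV. G j * (\<lambda>_. v $ j))"
  proof
    fix q
    have "(\<Sum>j\<in>S. G j * (\<lambda>_. v $ j)) q = (\<Sum>j\<in>S. G j q * v $ j)" for S
      by (induction S rule: infinite_finite_induct) auto
    then show "dir_deriv q v f = (\<Sum>j\<in>UNIV. G j * (\<lambda>_. v $ j)) q" using G by simp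
  qed
  also have "\<dots> \<in> poly_funs"
    using G by (intro subring_set_sum[OF poly_funs_subring] poly_funs.intros) auto
  finally show ?thesis .
qed

lemma linear_dir_deriv:
  assumes "f \<in> poly_funs"
  shows "Vector_Spaces.linear (*s) (*) (\<lambda>v. dir_deriv p v f)"
proof -
  obtain G where "\<forall>p v. dir_deriv p v f = (\<Sum>j\<in>UNIV. G j p * v $ j)"
    using dir_deriv_gradient[OF assms] by blast
  then show ?thesis
    by unfold_locales (auto simp: algebra_simps sum.distrib sum_distrib_left)
qed

lemma sum_fun_apply: "(\<Sum>i\<in>S. f i) x = (\<Sum>i\<in>S. f i x)"
  for f :: "_ \<Rightarrow> _ \<Rightarrow> 'a::comm_monoid_add"
  by (induction S rule: infinite_finite_induct) auto

text \<open>The vectors in \<open>E\<close> also index the functionals, \<open>g a\<close> being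
  dual to \<open>a\<close>. The vectors of a dual family are independent, which bounds its size, so
  a largest one exists; a common zero of its functionals at which some member of \<open>F\<close> is
  nonzero would enlarge it.\<close>

lemma exists_dual_family:
  fixes F :: "('k::field ^ 'i \<Rightarrow> 'k) set"
  assumes lin: "\<And>f. f \<in> F \<Longrightarrow> Vector_Spaces.linear (*s) (*) f"
    and F: "\<And>f g. f \<in> F \<Longrightarrow> g \<in> F \<Longrightarrow> (\<lambda>v. f v + g v) \<in> F" "\<And>f c. f \<in> F \<Longrightarrow> (\<lambda>v. c * f v) \<in> F"
  shows "\<exists>E g. finite E \<and> (\<forall>a\<in>E. g a \<in> F) \<and>
    (\<forall>a\<in>E. \<forall>b\<in>E. g a b = (if a = b then 1 else 0)) \<and>
    (\<forall>v. (\<forall>a\<in>E. g a v = 0) \<longrightarrow> (\<forall>f\<in>F. f v = 0))"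
proof -
  define dual where "dual E g \<longleftrightarrow> finite E \<and> (\<forall>a\<in>E. g a \<in> F) \<and> (\<forall>a\<in>E. \<forall>b\<in>E. g a b = (if a = b then 1 else 0))"
    for E :: "('k ^ 'i) set" and g
  have lin_sum: "f (\<Sum>b\<in>S. c b *s b) = (\<Sum>b\<in>S. c b * f b)" if "f \<in> F" for f c S
  proof -
    interpret f: Vector_Spaces.linear "(*s)" "(*)" f using lin[OF that] .
    show ?thesis by (simp add: f.sum f.scale)
  qed
  have bound: "card E \<le> CARD('i)" if d: "dual E g" for E g
  proof -
    have "vec.independent E"
    proof (rule vec.independent_if_scalars_zero)
      fix c b assume z: "(\<Sum>b\<in>E. c b *s b) = 0" and b: "b \<in> E"
      interpret f: Vector_Spaces.linear "(*s)" "(*)" "g b" using lin d b by (auto simp: dual_def)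
      have "0 = g b (\<Sum>b\<in>E. c b *s b)" using z f.zero by simp
      also have "\<dots> = (\<Sum>a\<in>E. c a * g b a)" using d b by (intro lin_sum) (auto simp: dual_def)
      also have "\<dots> = (\<Sum>a\<in>E. if a = b then c b else 0)"
        using d b by (intro sum.cong) (auto simp: dual_def)
      finally show "c b = 0" using d b by (simp add: dual_def)
    qed (use d in \<open>simp add: dual_def\<close>)
    then show ?thesis using vec.independent_bound_general[of E] vec.dim_subset_UNIV[of E]
      by (simp add: vec.dimension_def card_cart_basis)
  qed
  have "\<exists>E g. dual E g \<and> (\<forall>E' g'. dual E' g' \<longrightarrow> card E' \<le> card E)"
  proof -
    have "dual {} (\<lambda>_ _. 0)" by (simp add: dual_def)
    then have ex: "\<exists>n g E. dual E g \<and> card E = n" by blast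
    define m where "m = (GREATEST n. \<exists>g E. dual E g \<and> card E = n)"
    have "\<exists>g E. dual E g \<and> card E = m"
      unfolding m_def by (rule GreatestI_ex_nat[OF ex, of "CARD('i)"]) (use bound in blast)
    moreover have "card E' \<le> m" if "dual E' g'" for E' g'
      unfolding m_def by (rule Greatest_le_nat[where b = "CARD('i)"]) (use bound that in blast)+
    ultimately show ?thesis by blast
  qed
  then obtain E g where E: "dual E g" and max: "\<And>E' g'. dual E' g' \<Longrightarrow> card E' \<le> card E" by blast
  have F_sum: "(\<lambda>v. \<Sum>b\<in>S. c b * h b v) \<in> F" if "\<And>b. b \<in> S \<Longrightarrow> h b \<in> F" "f \<in> F" "finite S" for S h c f
    using that(3,1)
  proof (induction S)
    case empty
    show ?case using F(2)[OF that(2), of 0] by simp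
  next
    case (insert x S)
    then show ?case using F(1)[OF F(2)[of "h x" "c x"], of "\<lambda>v. \<Sum>b\<in>S. c b * h b v"] by simp
  qed
  have "f v = 0" if v: "\<And>a. a \<in> E \<Longrightarrow> g a v = 0" and f: "f \<in> F" for v f
  proof (rule ccontr)
    assume nz: "f v \<noteq> 0"
    \<comment> \<open>\<open>f\<close> is normalised to take the value 1 at \<open>v\<close>, and
      its components along the \<open>g a\<close> are removed so that it vanishes on
      \<open>E\<close>. Since the \<open>g a\<close> vanish at \<open>v\<close>, the pair of
      \<open>v\<close> and \<open>f'\<close> can be adjoined to the family.\<close>
    define f' where "f' w = inverse (f v) * f w + - 1 * (\<Sum>a\<in>E. (inverse (f v) * f a) * g a w)" for w
    have f'F: "f' \<in> F"
      unfolding f'_def using E f by (intro F F_sum) (auto simp: dual_def)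
    have f'v: "f' v = 1" using v nz by (simp add: f'_def)
    have f'E: "f' b = 0" if b: "b \<in> E" for b
    proof -
      have "(\<Sum>a\<in>E. (inverse (f v) * f a) * g a b) = (\<Sum>a\<in>E. if a = b then inverse (f v) * f b else 0)"
        using E b by (intro sum.cong) (auto simp: dual_def)
      also have "\<dots> = inverse (f v) * f b" using E b by (simp add: dual_def)
      finally show ?thesis by (simp add: f'_def)
    qed
    have "v \<notin> E" using f'E f'v by force
    have "dual (insert v E) (g(v := f'))"
      using E f'F f'v f'E v \<open>v \<notin> E\<close> by (auto simp: dual_def)
    from max[OF this] show False using E \<open>v \<notin> E\<close> by (simp add: dual_def)
  qed
  then show ?thesis using E by (intro exI[of _ E] exI[of _ g]) (simp add: dual_def)
qed

section \<open>Regular functions and the ambient vectors of vector fields\<close>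

lemma restrict0_apply [simp]: "p \<in> X \<Longrightarrow> restrict0 X f p = f p" "p \<notin> X \<Longrightarrow> restrict0 X f p = 0"
  by (auto simp: restrict0_def)

lemma restrict0_add: "restrict0 X (f + g) = restrict0 X f + (restrict0 X g :: _ \<Rightarrow> _::monoid_add)"
  by (auto simp: restrict0_def fun_eq_iff)

lemma restrict0_mult: "restrict0 X (f * g) = restrict0 X f * (restrict0 X g :: _ \<Rightarrow> _::mult_zero)"
  by (auto simp: restrict0_def fun_eq_iff)

lemma coord_ring_cases:
  assumes "f \<in> coord_ring X"
  obtains g where "g \<in> poly_funs" "f = restrict0 X g"
  using assms by (auto simp: coord_ring_def)

lemma restrict0_in_coord_ring: "f \<in> poly_funs \<Longrightarrow> restrict0 X f \<in> coord_ring X"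
  by (auto simp: coord_ring_def)

lemma coord_ring_outside: "f \<in> coord_ring X \<Longrightarrow> p \<notin> X \<Longrightarrow> f p = 0"
  by (auto simp: coord_ring_def)

lemma vector_fieldsD:
  assumes "D \<in> vector_fields X"
  shows "f \<notin> coord_ring X \<Longrightarrow> D f = 0" "f \<in> coord_ring X \<Longrightarrow> D f \<in> coord_ring X"
    "f \<in> coord_ring X \<Longrightarrow> g \<in> coord_ring X \<Longrightarrow> D (f + g) = D f + D g"
    "f \<in> coord_ring X \<Longrightarrow> D (fscale c f) = fscale c (D f)"
    "f \<in> coord_ring X \<Longrightarrow> g \<in> coord_ring X \<Longrightarrow> D (f * g) = f * D g + g * D f"
  using assms by (auto simp: vector_fields_def)

definition coord_on :: "('k::comm_ring_1 ^ 'i) set \<Rightarrow> 'i \<Rightarrow> 'k ^ 'i \<Rightarrow> 'k" where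
  "coord_on X j = restrict0 X (\<lambda>p. p $ j)"

definition vf_vec :: "('k::comm_ring_1 ^ 'i) set \<Rightarrow> (('k ^ 'i \<Rightarrow> 'k) \<Rightarrow> 'k ^ 'i \<Rightarrow> 'k) \<Rightarrow> 'k ^ 'i \<Rightarrow> 'k ^ 'i" where
  "vf_vec X D p = (\<chi> j. D (coord_on X j) p)"

lemma coord_on_in: "coord_on X j \<in> coord_ring X"
  by (simp add: coord_on_def restrict0_in_coord_ring poly_funs.coord)

text \<open>Both sides are derivations at \<open>p\<close> and agree on the coordinates, which
  together with the constants generate the polynomial functions.\<close>

lemma vf_eq_dir_deriv:
  fixes X :: "('k::field_char_0 ^ 'i) set"
  assumes D: "D \<in> vector_fields X" and f: "f \<in> poly_funs" and p: "p \<in> X"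
  shows "D (restrict0 X f) p = dir_deriv p (vf_vec X D p) f"
  using f
proof (induction rule: poly_funs.induct)
  case (const c)
  have 1: "restrict0 X (\<lambda>_. 1) \<in> coord_ring X"
    by (intro restrict0_in_coord_ring poly_funs.const)
  have "restrict0 X (\<lambda>_. 1) * restrict0 X (\<lambda>_. 1) = (restrict0 X (\<lambda>_. 1) :: _ \<Rightarrow> 'k)"
    by (simp add: restrict0_def fun_eq_iff)
  then have "D (restrict0 X (\<lambda>_. 1)) p = D (restrict0 X (\<lambda>_. 1) * restrict0 X (\<lambda>_. 1)) p" by simp
  also have "\<dots> = D (restrict0 X (\<lambda>_. 1)) p + D (restrict0 X (\<lambda>_. 1)) p"
    using vector_fieldsD(5)[OF D 1 1] p by simp
  finally have "D (restrict0 X (\<lambda>_. 1)) p = 0" by simp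
  moreover have "restrict0 X (\<lambda>_. c) = fscale c (restrict0 X (\<lambda>_. 1))"
    by (auto simp: restrict0_def fscale_def fun_eq_iff)
  ultimately show ?case
    using vector_fieldsD(4)[OF D 1, of c] by (simp add: fscale_def)
next
  case (coord j)
  show ?case by (simp add: vf_vec_def coord_on_def)
next
  case (add f g)
  then have "D (restrict0 X (f + g)) p = dir_deriv p (vf_vec X D p) (f + g)"
    using vector_fieldsD(3)[OF D restrict0_in_coord_ring restrict0_in_coord_ring, of f g]
    by (simp add: restrict0_add dir_deriv_add del: plus_fun_apply) simp
  then show ?case by (simp add: plus_fun_def)
next
  case (mult f g)
  then have "D (restrict0 X (f * g)) p = dir_deriv p (vf_vec X D p) (f * g)"
    using vector_fieldsD(5)[OF D restrict0_in_coord_ring restrict0_in_coord_ring, of f g] p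
    by (simp add: restrict0_mult dir_deriv_mult)
  then show ?case by (simp add: times_fun_def)
qed

text \<open>The sum runs over indices instead of elements of the image, as \<open>v\<close> need not
  be injective.\<close>

lemma span_image_sum:
  fixes s :: "'k::comm_ring_1 \<Rightarrow> 'v::ab_group_add \<Rightarrow> 'v"
  assumes s: "module s" and x: "x \<in> module.span s (v ` {1..n::nat})"
  shows "\<exists>c. x = (\<Sum>k\<in>{1..n}. s (c k) (v k))"
proof -
  interpret module s by fact
  have "module.span s (v ` {1..n}) \<subseteq> {x. \<exists>c. x = (\<Sum>k\<in>{1..n}. s (c k) (v k))}"
  proof (rule span_minimal)
    show "v ` {1..n} \<subseteq> {x. \<exists>c. x = (\<Sum>k\<in>{1..n}. s (c k) (v k))}"
    proof
      fix y assume "y \<in> v ` {1..n}"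
      then obtain k where k: "k \<in> {1..n}" "y = v k" by auto
      have "(\<Sum>i\<in>{1..n}. s (if i = k then 1 else 0) (v i)) = (\<Sum>i\<in>{1..n}. if i = k then v k else 0)"
        by (intro sum.cong) auto
      then show "y \<in> {x. \<exists>c. x = (\<Sum>k\<in>{1..n}. s (c k) (v k))}"
        using k by (auto intro!: exI[of _ "\<lambda>i. if i = k then 1 else 0"])
    qed
    show "subspace {x. \<exists>c. x = (\<Sum>k\<in>{1..n}. s (c k) (v k))}"
    proof (rule subspaceI)
      show "0 \<in> {x. \<exists>c. x = (\<Sum>k\<in>{1..n}. s (c k) (v k))}"
        by (auto intro!: exI[of _ "\<lambda>_. 0"])
    next
      fix x y assume "x \<in> {x. \<exists>c. x = (\<Sum>k\<in>{1..n}. s (c k) (v k))}" "y \<in> {x. \<exists>c. x = (\<Sum>k\<in>{1..n}. s (c k) (v k))}"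
      then obtain c d where "x = (\<Sum>k\<in>{1..n}. s (c k) (v k))" "y = (\<Sum>k\<in>{1..n}. s (d k) (v k))" by auto
      then show "x + y \<in> {x. \<exists>c. x = (\<Sum>k\<in>{1..n}. s (c k) (v k))}"
        by (auto intro!: exI[of _ "\<lambda>k. c k + d k"] simp: scale_left_distrib sum.distrib)
    next
      fix a x assume "x \<in> {x. \<exists>c. x = (\<Sum>k\<in>{1..n}. s (c k) (v k))}"
      then obtain c where "x = (\<Sum>k\<in>{1..n}. s (c k) (v k))" by auto
      then show "s a x \<in> {x. \<exists>c. x = (\<Sum>k\<in>{1..n}. s (c k) (v k))}"
        by (auto intro!: exI[of _ "\<lambda>k. a * c k"] simp: scale_sum_right)
    qed
  qed
  then show ?thesis using x by blast
qed

definition vanishing :: "('k::comm_ring_1 ^ 'i) set \<Rightarrow> ('k ^ 'i \<Rightarrow> 'k) set" where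
  "vanishing X = {f\<in>poly_funs. \<forall>p\<in>X. f p = 0}"

text \<open>If \<open>v\<close> is killed by the differentials of all functions vanishing on
  \<open>X\<close>, the derivative along \<open>v\<close> of a polynomial extension of a regular
  function does not depend on the extension. It is thus a point derivation, to which the spanning
  hypothesis applies; evaluation on the coordinates leads back to vectors.\<close>

lemma tangent_vector_in_span:
  fixes X :: "('k::field_char_0 ^ 'i) set"
  assumes p: "p \<in> X" and V: "\<forall>k\<in>{1..n}. V k \<in> vector_fields X" and span: "spans_tangent_spaces X n V"
    and v: "\<And>f. f \<in> vanishing X \<Longrightarrow> dir_deriv p v f = 0"
  shows "\<exists>c. v = (\<Sum>k\<in>{1..n}. c k *s vf_vec X (V k) p)"
proof -
  define ext where "ext f = (SOME g. g \<in> poly_funs \<and> f = restrict0 X g)" for f :: "'k ^ 'i \<Rightarrow> 'k"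
  define \<delta> where "\<delta> f = (if f \<in> coord_ring X then dir_deriv p v (ext f) else 0)" for f
  have eq: "\<delta> (restrict0 X f) = dir_deriv p v f" if f: "f \<in> poly_funs" for f
  proof -
    define g where "g = ext (restrict0 X f)"
    have g: "g \<in> poly_funs \<and> restrict0 X f = restrict0 X g"
      unfolding g_def ext_def by (rule someI[of _ f]) (simp add: f)
    have "(g - f) q = 0" if "q \<in> X" for q
    proof -
      have "restrict0 X g q = restrict0 X f q" using g by metis
      then show ?thesis using that by simp
    qed
    then have "g - f \<in> vanishing X"
      using g f subring_set_closed(5)[OF poly_funs_subring] by (auto simp: vanishing_def)
    then have "dir_deriv p v (g - f) = 0" "g - f \<in> poly_funs" using v by (auto simp: vanishing_def)
    then have "dir_deriv p v (f + (g - f)) = dir_deriv p v f"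
      using dir_deriv_add[OF f, of "g - f" p v] by (simp only: add_0_right)
    moreover have "f + (g - f) = g" by (simp add: fun_eq_iff)
    ultimately have "dir_deriv p v g = dir_deriv p v f" by (simp only:)
    then show ?thesis using restrict0_in_coord_ring[OF f] by (simp add: \<delta>_def g_def)
  qed
  have "\<delta> \<in> tangent_space X p"
    unfolding tangent_space_def
  proof (intro CollectI conjI ballI allI impI)
    fix f assume "f \<notin> coord_ring X" then show "\<delta> f = 0" by (simp add: \<delta>_def)
  next
    fix f g assume "f \<in> coord_ring X" "g \<in> coord_ring X"
    then obtain f' g' where fg: "f' \<in> poly_funs" "f = restrict0 X f'" "g' \<in> poly_funs" "g = restrict0 X g'"
      by (auto elim!: coord_ring_cases)
    show "\<delta> (f + g) = \<delta> f + \<delta> g"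
      unfolding fg(2,4) restrict0_add[symmetric]
      using fg(1,3) by (simp only: eq poly_funs.add dir_deriv_add)
    show "\<delta> (f * g) = f p * \<delta> g + g p * \<delta> f"
      unfolding fg(2,4) restrict0_mult[symmetric]
      using fg(1,3) p by (simp only: eq poly_funs.mult dir_deriv_mult restrict0_apply)
  next
    fix c f assume "f \<in> coord_ring X"
    then obtain f' where f: "f' \<in> poly_funs" "f = restrict0 X f'" by (rule coord_ring_cases)
    have "fscale c f = restrict0 X ((\<lambda>_. c) * f')" by (auto simp: f(2) fscale_def restrict0_def fun_eq_iff)
    then show "\<delta> (fscale c f) = c * \<delta> f"
      using f eq[of "(\<lambda>_. c) * f'"] eq[of f'] by (simp add: poly_funs.intros dir_deriv_scale)
  qed
  then have "\<delta> \<in> module.span fscale ((\<lambda>k. vf_at (V k) p) ` {1..n})"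
    using span p by (auto simp: spans_tangent_spaces_def)
  from span_image_sum[OF module_fscale this]
  obtain c where c: "\<delta> = (\<Sum>k\<in>{1..n}. fscale (c k) (vf_at (V k) p))" by blast
  have "v = (\<Sum>k\<in>{1..n}. c k *s vf_vec X (V k) p)"
  proof (subst vec_eq_iff, rule allI)
    fix j
    have "v $ j = \<delta> (coord_on X j)" using eq[OF poly_funs.coord, of j] by (simp add: coord_on_def)
    also have "\<dots> = (\<Sum>k\<in>{1..n}. c k * V k (coord_on X j) p)"
      by (simp add: c sum_fun_apply fscale_def vf_at_def)
    finally show "v $ j = (\<Sum>k\<in>{1..n}. c k *s vf_vec X (V k) p) $ j"
      by (simp add: vf_vec_def)
  qed
  then show ?thesis by blast
qed

lemma vanishing_ideal: "ideal_of poly_funs (vanishing X)"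
proof -
  have "f + g \<in> vanishing X" if "f \<in> vanishing X" "g \<in> vanishing X" for f g
    using that by (auto simp: vanishing_def poly_funs.add simp del: plus_fun_apply) (simp add: poly_funs.add)
  moreover have "r * f \<in> vanishing X" if "r \<in> poly_funs" "f \<in> vanishing X" for r f
    using that by (auto simp: vanishing_def poly_funs.mult)
  moreover have "0 \<in> vanishing X"
    using subring_set_closed(1)[OF poly_funs_subring] by (auto simp: vanishing_def)
  ultimately show ?thesis unfolding ideal_of_def by (auto simp: vanishing_def)
qed

lemma point_ideal: "ideal_of poly_funs {f\<in>poly_funs. f p = 0}"
  using vanishing_ideal[of "{p}"] by (simp add: vanishing_def)

lemma module_family: "module (\<lambda>r (w :: 'i \<Rightarrow> 'a) j. r * w j :: 'a::comm_ring_1)"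
  by unfold_locales (auto simp: fun_eq_iff algebra_simps)

lemma module_mult: "module ((*) :: 'a::comm_ring_1 \<Rightarrow> 'a \<Rightarrow> 'a)"
  by unfold_locales (auto simp: algebra_simps)

lemma poly_funs_sum: "(\<And>i. i \<in> S \<Longrightarrow> f i \<in> poly_funs) \<Longrightarrow> sum f S \<in> poly_funs"
  by (rule subring_set_sum[OF poly_funs_subring])

lemma poly_funs_diff: "f \<in> poly_funs \<Longrightarrow> g \<in> poly_funs \<Longrightarrow> f - g \<in> poly_funs"
  by (rule subring_set_closed(5)[OF poly_funs_subring])

lemma dir_deriv_sum:
  assumes "f \<in> poly_funs"
  shows "dir_deriv p (\<Sum>i\<in>S. c i *s v i) f = (\<Sum>i\<in>S. c i * dir_deriv p (v i) f)"
proof -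
  interpret Vector_Spaces.linear "(*s)" "(*)" "\<lambda>v. dir_deriv p v f"
    by (rule linear_dir_deriv[OF assms])
  show ?thesis by (simp add: sum scale)
qed

lemma dir_deriv_vec_add:
  assumes "f \<in> poly_funs"
  shows "dir_deriv p (v + w) f = dir_deriv p v f + dir_deriv p w f"
proof -
  interpret Vector_Spaces.linear "(*s)" "(*)" "\<lambda>v. dir_deriv p v f"
    by (rule linear_dir_deriv[OF assms])
  show ?thesis by (rule add)
qed

lemma dir_deriv_vec_scale:
  assumes "f \<in> poly_funs"
  shows "dir_deriv p (c *s v) f = c * dir_deriv p v f"
proof -
  interpret Vector_Spaces.linear "(*s)" "(*)" "\<lambda>v. dir_deriv p v f"
    by (rule linear_dir_deriv[OF assms])
  show ?thesis by (rule scale)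
qed

lemma vf_kills_vanishing:
  fixes X :: "('k::field_char_0 ^ 'i) set"
  assumes D: "D \<in> vector_fields X" and f: "f \<in> vanishing X" and p: "p \<in> X"
  shows "dir_deriv p (vf_vec X D p) f = 0"
proof -
  have "restrict0 X f = fscale 0 (restrict0 X f)"
    using f by (auto simp: vanishing_def restrict0_def fscale_def fun_eq_iff)
  moreover have fp: "f \<in> poly_funs" using f by (simp add: vanishing_def)
  ultimately have "D (restrict0 X f) = fscale 0 (D (restrict0 X f))"
    using vector_fieldsD(4)[OF D restrict0_in_coord_ring[OF fp], of 0] by simp
  then have "D (restrict0 X f) p = 0" by (metis fscale_def mult_zero_left)
  then show ?thesis using vf_eq_dir_deriv[OF D fp p] by simp
qed

lemma vf_vec_poly_funs:
  assumes "D \<in> vector_fields X"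
  obtains P where "\<And>j. P j \<in> poly_funs" "\<And>p. p \<in> X \<Longrightarrow> vf_vec X D p = (\<chi> j. P j p)"
proof -
  have "\<exists>P. P \<in> poly_funs \<and> D (coord_on X j) = restrict0 X P" for j
    using vector_fieldsD(2)[OF assms coord_on_in] by (auto elim: coord_ring_cases)
  then obtain P where P: "\<And>j. P j \<in> poly_funs" "\<And>j. D (coord_on X j) = restrict0 X (P j)" by metis
  show ?thesis by (rule that[of P]) (auto simp: P vf_vec_def)
qed

text \<open>Near \<open>p\<close> the ambient space is generated by the \<open>V k\<close> and by constant vectors dual to
  differentials of functions vanishing on \<open>X\<close>; these differentials annihilate \<open>D\<close>, so that
  \<open>D\<close> has no component along the constant vectors.\<close>

lemma locally_generated:
  fixes X :: "('k::field_char_0 ^ 'i) set"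
  assumes p: "p \<in> X" and V: "\<forall>k\<in>{1..n}. V k \<in> vector_fields X" and span: "spans_tangent_spaces X n V"
    and D: "D \<in> vector_fields X"
  shows "\<exists>h a. h \<in> poly_funs \<and> h p \<noteq> 0 \<and> (\<forall>k. a k \<in> poly_funs) \<and>
    (\<forall>q\<in>X. h q *s vf_vec X D q = (\<Sum>k\<in>{1..n}. a k q *s vf_vec X (V k) q))"
proof -
  define F where "F = (\<lambda>f v. dir_deriv p v f) ` vanishing X"
  have van_poly: "f \<in> poly_funs" if "f \<in> vanishing X" for f using that by (simp add: vanishing_def)
  have F_lin: "Vector_Spaces.linear (*s) (*) f" if "f \<in> F" for f
    using that linear_dir_deriv van_poly by (auto simp: F_def)
  have F_add: "(\<lambda>v. f v + g v) \<in> F" if fg: "f \<in> F" "g \<in> F" for f g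
  proof -
    obtain f' g' where fg': "f' \<in> vanishing X" "g' \<in> vanishing X" "f = (\<lambda>v. dir_deriv p v f')" "g = (\<lambda>v. dir_deriv p v g')"
      using fg unfolding F_def by blast
    then have "(\<lambda>v. f v + g v) = (\<lambda>v. dir_deriv p v (f' + g'))"
      using dir_deriv_add[OF van_poly van_poly] by auto
    moreover have "f' + g' \<in> vanishing X" using \<open>f' \<in> vanishing X\<close> \<open>g' \<in> vanishing X\<close> vanishing_ideal by (auto simp: ideal_of_def)
    ultimately show ?thesis unfolding F_def by blast
  qed
  have F_scale: "(\<lambda>v. c * f v) \<in> F" if fF: "f \<in> F" for c f
  proof -
    obtain f' where f: "f' \<in> vanishing X" "f = (\<lambda>v. dir_deriv p v f')"
      using fF unfolding F_def by blast
    then have "(\<lambda>v. c * f v) = (\<lambda>v. dir_deriv p v ((\<lambda>_. c) * f'))"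
      using dir_deriv_scale[OF van_poly] by auto
    moreover have "(\<lambda>_. c) * f' \<in> vanishing X"
      using f vanishing_ideal poly_funs.const unfolding ideal_of_def by blast
    ultimately show ?thesis unfolding F_def by blast
  qed
  obtain E g where E: "finite E" "\<forall>b\<in>E. g b \<in> F"
    "\<forall>a\<in>E. \<forall>b\<in>E. g a b = (if a = b then 1 else 0)"
    "\<forall>v. (\<forall>b\<in>E. g b v = 0) \<longrightarrow> (\<forall>f\<in>F. f v = 0)"
    using exists_dual_family[OF F_lin F_add F_scale] by blast
  have "\<forall>b\<in>E. \<exists>f. f \<in> vanishing X \<and> g b = (\<lambda>v. dir_deriv p v f)" using E(2) by (auto simp: F_def)
  then obtain G where G: "\<And>b. b \<in> E \<Longrightarrow> G b \<in> vanishing X" "\<And>b. b \<in> E \<Longrightarrow> g b = (\<lambda>v. dir_deriv p v (G b))"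
    by metis
  have Gp: "G b \<in> poly_funs" if "b \<in> E" for b using G(1)[OF that] by (rule van_poly)

  have "\<forall>k\<in>{1..n}. \<exists>P. (\<forall>j. P j \<in> poly_funs) \<and> (\<forall>q\<in>X. vf_vec X (V k) q = (\<chi> j. P j q))"
    using V vf_vec_poly_funs by metis
  then obtain P where P: "\<And>k j. k \<in> {1..n} \<Longrightarrow> P k j \<in> poly_funs"
    "\<And>k q. k \<in> {1..n} \<Longrightarrow> q \<in> X \<Longrightarrow> vf_vec X (V k) q = (\<chi> j. P k j q)" by metis
  obtain Q where Q: "\<And>j. Q j \<in> poly_funs" "\<And>q. q \<in> X \<Longrightarrow> vf_vec X D q = (\<chi> j. Q j q)"
    using vf_vec_poly_funs[OF D] by metis

  \<comment> \<open>Removing from a basis vector its components along \<open>E\<close> leaves a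
    vector killed by every \<open>g a\<close>, hence by all differentials in \<open>F\<close>, and
    therefore tangent to \<open>X\<close> at \<open>p\<close>.\<close>
  have "\<exists>c. axis j 1 = (\<Sum>k\<in>{1..n}. c k *s vf_vec X (V k) p) + (\<Sum>b\<in>E. g b (axis j 1) *s b)" for j
  proof -
    define v where "v = axis j 1 + (\<Sum>b\<in>E. (- g b (axis j 1)) *s b)"
    have "g a v = 0" if a: "a \<in> E" for a
    proof -
      have "g a v = g a (axis j 1) + (\<Sum>b\<in>E. - g b (axis j 1) * g a b)"
        unfolding v_def using G(2)[OF a] Gp[OF a]
        by (simp only: dir_deriv_vec_add dir_deriv_sum)
      also have "(\<Sum>b\<in>E. - g b (axis j 1) * g a b) = (\<Sum>b\<in>E. if b = a then - g a (axis j 1) else 0)"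
        using E(3) a by (intro sum.cong) auto
      finally show ?thesis using a E(1) by simp
    qed
    then have Fv: "\<forall>f\<in>F. f v = 0" using E(4) by simp
    have "dir_deriv p v f = 0" if "f \<in> vanishing X" for f
    proof -
      have "(\<lambda>v. dir_deriv p v f) \<in> F" unfolding F_def using that by (rule imageI)
      from bspec[OF Fv this] show ?thesis .
    qed
    then obtain c where "v = (\<Sum>k\<in>{1..n}. c k *s vf_vec X (V k) p)"
      using tangent_vector_in_span[OF p V span, of v] by blast
    moreover have "v = axis j 1 - (\<Sum>b\<in>E. g b (axis j 1) *s b)"
      unfolding v_def vec.scale_minus_left sum_negf by (rule add_uminus_conv_diff)
    then have "axis j 1 = v + (\<Sum>b\<in>E. g b (axis j 1) *s b)" by (simp only: diff_add_cancel)
    ultimately show ?thesis by (intro exI[of _ c]) (simp only:)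
  qed
  then have "\<forall>j. \<exists>c. axis j 1 = (\<Sum>k\<in>{1..n}. c k *s vf_vec X (V k) p) + (\<Sum>b\<in>E. g b (axis j 1) *s b)"
    by (rule allI)
  from choice[OF this] obtain c where c: "\<forall>j. axis j 1 = (\<Sum>k\<in>{1..n}. c j k *s vf_vec X (V k) p) + (\<Sum>b\<in>E. g b (axis j 1) *s b)"
    by (rule exE)

  define m where "m = {f\<in>poly_funs. f p = (0::'k)}"
  have idm: "ideal_of poly_funs m" unfolding m_def by (rule point_ideal)
  then have one_m: "1 - 1 \<in> m" using ideal_of_closed(1)[OF poly_funs_subring] by simp
  define e :: "'i \<Rightarrow> 'i \<Rightarrow> 'k ^ 'i \<Rightarrow> 'k" where "e j = (\<lambda>i _. if i = j then 1 else 0)" for j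
  \<comment> \<open>A family of polynomials indexed by \<open>'i\<close> is regarded as a vector
    field on the ambient space. \<open>comb a C\<close> combines polynomial extensions of the
    \<open>V k\<close> with the constant vectors in \<open>E\<close>, and \<open>W\<close> is the
    submodule of all such combinations.\<close>
  define comb where "comb a C = (\<lambda>i. (\<Sum>k\<in>{1..n}. a k * P k i) + (\<Sum>b\<in>E. C b * (\<lambda>_. b $ i)))"
    for a :: "nat \<Rightarrow> 'k ^ 'i \<Rightarrow> 'k" and C :: "'k ^ 'i \<Rightarrow> 'k ^ 'i \<Rightarrow> 'k"
  define W where "W = {comb a C | a C. (\<forall>k. a k \<in> poly_funs) \<and> (\<forall>b. C b \<in> poly_funs)}"
  have WI: "comb a C \<in> W" if "\<And>k. a k \<in> poly_funs" "\<And>b. C b \<in> poly_funs" for a C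
    unfolding W_def using that by blast

  \<comment> \<open>Extending the coefficients found at \<open>p\<close> as constants expresses each
    basis field up to an error that vanishes at \<open>p\<close>; the components of this error are
    the coefficients in \<open>m\<close>. The resulting \<open>h\<close> takes the value 1 at
    \<open>p\<close>.\<close>
  have "\<exists>h. 1 - h \<in> m \<and> (\<forall>j\<in>UNIV. (\<lambda>i. h * e j i) \<in> W)"
  proof (rule module.nakayama[OF module_family poly_funs_subring idm])
    show "0 \<in> W"
    proof -
      have "0 = comb (\<lambda>_ _. 0) (\<lambda>_ _. 0)" by (simp add: comb_def fun_eq_iff sum_fun_apply)
      moreover have "\<dots> \<in> W" by (intro WI poly_funs.const)
      ultimately show ?thesis by (simp only:)
    qed
  next
    fix x y assume "x \<in> W" "y \<in> W"
    then obtain a C a' C' where x: "x = comb a C" "\<forall>k. a k \<in> poly_funs" "\<forall>b. C b \<in> poly_funs"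
      and y: "y = comb a' C'" "\<forall>k. a' k \<in> poly_funs" "\<forall>b. C' b \<in> poly_funs" by (auto simp: W_def)
    have "x + y = comb (\<lambda>k. a k + a' k) (\<lambda>b. C b + C' b)"
      by (simp add: x y comb_def fun_eq_iff sum_fun_apply sum.distrib algebra_simps)
    moreover have "\<dots> \<in> W"
      by (rule WI) (rule poly_funs.add[OF spec[OF x(2)] spec[OF y(2)]] poly_funs.add[OF spec[OF x(3)] spec[OF y(3)]])+
    ultimately show "x + y \<in> W" by (simp only:)
  next
    fix r :: "'k ^ 'i \<Rightarrow> 'k" and x assume r: "r \<in> poly_funs" and "x \<in> W"
    then obtain a C where x: "x = comb a C" "\<forall>k. a k \<in> poly_funs" "\<forall>b. C b \<in> poly_funs" by (auto simp: W_def)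
    have "(\<lambda>j. r * x j) = comb (\<lambda>k. r * a k) (\<lambda>b. r * C b)"
      by (intro ext) (simp only: x(1) comb_def times_fun_apply plus_fun_apply sum_fun_apply
          distrib_left sum_distrib_left mult.assoc)
    moreover have "\<dots> \<in> W"
      by (rule WI) (rule poly_funs.mult[OF r spec[OF x(2)]] poly_funs.mult[OF r spec[OF x(3)]])+
    ultimately show "(\<lambda>j. r * x j) \<in> W" by (simp only:)
  next
    fix j
    define w where "w = comb (\<lambda>k _. c j k) (\<lambda>b _. g b (axis j 1))"
    have "w \<in> W" unfolding w_def by (intro WI poly_funs.const)
    moreover have "\<forall>l\<in>UNIV. e j l - w l \<in> m"
    proof
      fix l
      have "e j l \<in> poly_funs" by (auto simp: e_def intro: poly_funs.const)
      moreover have "w l \<in> poly_funs"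
        unfolding w_def comb_def by (intro poly_funs.intros poly_funs_sum P)
      moreover have "w l p = e j l p"
      proof -
        have "w l p = ((\<Sum>k\<in>{1..n}. c j k *s vf_vec X (V k) p) + (\<Sum>b\<in>E. g b (axis j 1) *s b)) $ l"
          by (simp add: w_def comb_def sum_fun_apply P(2)[OF _ p])
        then show ?thesis unfolding spec[OF c, of j, symmetric] by (simp add: e_def axis_def)
      qed
      ultimately show "e j l - w l \<in> m" by (auto simp: m_def intro: poly_funs_diff)
    qed
    moreover have "(\<lambda>i. 1 * e j i) = w + (\<Sum>l\<in>UNIV. (\<lambda>i. (e j l - w l) * e l i))"
    proof
      fix i
      have "(\<Sum>l\<in>UNIV. (e j l - w l) * e l i) = (\<Sum>l\<in>UNIV. if l = i then e j i - w i else 0)"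
        by (intro sum.cong) (auto simp: e_def fun_eq_iff)
      then show "1 * e j i = (w + (\<Sum>l\<in>UNIV. (\<lambda>i. (e j l - w l) * e l i))) i"
        by (simp add: sum_fun_apply[where x = i])
    qed
    ultimately show "\<exists>h w \<mu>. 1 - h \<in> m \<and> w \<in> W \<and> (\<forall>l\<in>UNIV. \<mu> l \<in> m) \<and>
        (\<lambda>i. h * e j i) = w + (\<Sum>l\<in>UNIV. (\<lambda>i. \<mu> l * e l i))"
      using one_m by (intro exI[of _ 1] exI[of _ w] exI[of _ "\<lambda>l. e j l - w l"] conjI)
  qed simp
  then obtain h where h: "1 - h \<in> m" "\<And>j. (\<lambda>i. h * e j i) \<in> W" by blast
  have "\<forall>j. \<exists>a C. (\<lambda>i. h * e j i) = comb a C \<and> (\<forall>k. a k \<in> poly_funs) \<and> (\<forall>b. C b \<in> poly_funs)"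
    using h(2) by (auto simp: W_def)
  then obtain a C where aC: "\<And>j. (\<lambda>i. h * e j i) = comb (a j) (C j)" "\<And>j k. a j k \<in> poly_funs" "\<And>j b. C j b \<in> poly_funs"
    by metis

  define A where "A k = (\<Sum>j\<in>UNIV. Q j * a j k)" for k
  define B where "B b = (\<Sum>j\<in>UNIV. Q j * C j b)" for b
  have AB: "A k \<in> poly_funs" "B b \<in> poly_funs" for k b
    unfolding A_def B_def by (intro poly_funs_sum poly_funs.mult Q aC)+
  have hD: "h q *s vf_vec X D q = (\<Sum>k\<in>{1..n}. A k q *s vf_vec X (V k) q) + (\<Sum>b\<in>E. B b q *s b)"
    if q: "q \<in> X" for q
  proof (subst vec_eq_iff, rule allI)
    fix i
    have *: "h q * e j i q = (\<Sum>k\<in>{1..n}. a j k q * P k i q) + (\<Sum>b\<in>E. C j b q * b $ i)" for j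
      using fun_cong[OF fun_cong[OF aC(1)[of j]], of i q] by (simp add: comb_def sum_fun_apply)
    have "(h q *s vf_vec X D q) $ i = h q * (\<Sum>j\<in>UNIV. if j = i then Q j q else 0)"
      by (simp add: Q(2)[OF q])
    also have "\<dots> = (\<Sum>j\<in>UNIV. Q j q * (h q * e j i q))"
      unfolding sum_distrib_left by (intro sum.cong) (auto simp: e_def)
    also have "\<dots> = (\<Sum>j\<in>UNIV. \<Sum>k\<in>{1..n}. Q j q * a j k q * P k i q) + (\<Sum>j\<in>UNIV. \<Sum>b\<in>E. Q j q * C j b q * b $ i)"
      unfolding * by (simp add: sum.distrib distrib_left sum_distrib_left mult.assoc)
    also have "\<dots> = (\<Sum>k\<in>{1..n}. \<Sum>j\<in>UNIV. Q j q * a j k q * P k i q) + (\<Sum>b\<in>E. \<Sum>j\<in>UNIV. Q j q * C j b q * b $ i)"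
      by (intro arg_cong2[of _ _ _ _ "(+)"] sum.swap)
    also have "\<dots> = ((\<Sum>k\<in>{1..n}. A k q *s vf_vec X (V k) q) + (\<Sum>b\<in>E. B b q *s b)) $ i"
      by (simp add: A_def B_def sum_fun_apply sum_distrib_right P(2)[OF _ q])
    finally show "(h q *s vf_vec X D q) $ i = \<dots>" .
  qed

  \<comment> \<open>Differentiating \<open>G b\<close> along both sides of \<open>hD\<close> at
    points of \<open>X\<close> leaves only the constant vectors, and hence a linear system for the
    \<open>B a\<close> modulo \<open>vanishing X\<close>. Its matrix is the identity at
    \<open>p\<close> by duality, so its difference from the identity has entries in
    \<open>m\<close>.\<close>
  have "\<exists>h'. 1 - h' \<in> m \<and> (\<forall>b\<in>E. h' * B b \<in> vanishing X)"
  proof (rule module.nakayama[OF module_mult poly_funs_subring idm])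
    fix b assume b: "b \<in> E"
    define L where "L a = (\<lambda>q. dir_deriv q a (G b))" for a
    have L: "L a \<in> poly_funs" for a unfolding L_def by (rule dir_deriv_poly_funs[OF Gp[OF b]])
    define \<mu> where "\<mu> a = (\<lambda>_. if a = b then 1 else 0) - L a" for a
    have "\<mu> a \<in> m" if "a \<in> E" for a
    proof -
      have "dir_deriv p a (G b) = (if b = a then 1 else 0)"
        using fun_cong[OF G(2)[OF b], of a] E(3) b that by simp
      moreover have "\<mu> a \<in> poly_funs"
        unfolding \<mu>_def by (intro poly_funs_diff poly_funs.const L)
      ultimately show ?thesis by (simp add: m_def \<mu>_def L_def)
    qed
    moreover have "(\<Sum>a\<in>E. B a * L a) \<in> vanishing X"
    proof -
      have "(\<Sum>a\<in>E. B a * L a) q = 0" if q: "q \<in> X" for q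
      proof -
        have "h q * dir_deriv q (vf_vec X D q) (G b) =
          (\<Sum>k\<in>{1..n}. A k q * dir_deriv q (vf_vec X (V k) q) (G b)) + (\<Sum>a\<in>E. B a q * dir_deriv q a (G b))"
          using arg_cong[OF hD[OF q], of "\<lambda>v. dir_deriv q v (G b)"] Gp[OF b]
          by (simp only: dir_deriv_vec_add dir_deriv_sum dir_deriv_vec_scale)
        then show ?thesis
          using vf_kills_vanishing[OF D G(1)[OF b] q] vf_kills_vanishing[OF _ G(1)[OF b] q] V
          by (simp add: sum_fun_apply L_def)
      qed
      moreover have "(\<Sum>a\<in>E. B a * L a) \<in> poly_funs" by (intro poly_funs_sum poly_funs.mult AB L)
      ultimately show ?thesis by (simp add: vanishing_def)
    qed
    moreover have "1 * B b = (\<Sum>a\<in>E. B a * L a) + (\<Sum>a\<in>E. \<mu> a * B a)"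
    proof -
      have "(\<Sum>a\<in>E. B a * L a) + (\<Sum>a\<in>E. \<mu> a * B a) = (\<Sum>a\<in>E. if a = b then B b else 0)"
        unfolding sum.distrib[symmetric] by (intro sum.cong) (auto simp: \<mu>_def fun_eq_iff algebra_simps)
      then show ?thesis using b E(1) by simp
    qed
    ultimately show "\<exists>h w \<mu>. 1 - h \<in> m \<and> w \<in> vanishing X \<and> (\<forall>l\<in>E. \<mu> l \<in> m) \<and>
        h * B b = w + (\<Sum>l\<in>E. \<mu> l * B l)"
      using one_m by (intro exI[of _ 1] exI[of _ "\<Sum>a\<in>E. B a * L a"] exI[of _ \<mu>] conjI ballI)
  qed (use vanishing_ideal[of X] E(1) in \<open>auto simp: ideal_of_def\<close>)
  then obtain h' where h': "1 - h' \<in> m" "\<And>b. b \<in> E \<Longrightarrow> h' * B b \<in> vanishing X" by blast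

  have unit: "r \<in> poly_funs \<and> r p = 1" if "1 - r \<in> m" for r
  proof -
    have "1 - (1 - r) \<in> poly_funs"
      by (rule poly_funs_diff[OF subring_set_closed(2)[OF poly_funs_subring]])
        (use that in \<open>simp add: m_def\<close>)
    then have "r \<in> poly_funs" by simp
    then show ?thesis using that by (simp add: m_def)
  qed
  have "(h' * h) q *s vf_vec X D q = (\<Sum>k\<in>{1..n}. (h' * A k) q *s vf_vec X (V k) q)" if q: "q \<in> X" for q
  proof -
    have "(h' * h) q *s vf_vec X D q = h' q *s (h q *s vf_vec X D q)" by (simp add: vec.scale_scale)
    also have "\<dots> = (\<Sum>k\<in>{1..n}. (h' * A k) q *s vf_vec X (V k) q) + (\<Sum>b\<in>E. (h' * B b) q *s b)"
      unfolding hD[OF q] by (simp add: vec.scale_right_distrib vec.scale_sum_right vec.scale_scale)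
    also have "(\<Sum>b\<in>E. (h' * B b) q *s b) = 0"
    proof (intro sum.neutral ballI)
      fix b assume "b \<in> E"
      then have "(h' * B b) q = 0" using h'(2) q unfolding vanishing_def by blast
      then show "(h' * B b) q *s b = 0" by simp
    qed
    finally show ?thesis by simp
  qed
  moreover have "h' * h \<in> poly_funs" "(h' * h) p \<noteq> 0" "\<forall>k. h' * A k \<in> poly_funs"
    using unit[OF h(1)] unit[OF h'(1)] AB by (auto intro: poly_funs.mult)
  ultimately show ?thesis by (intro exI[of _ "h' * h"] exI[of _ "\<lambda>k. h' * A k"] conjI ballI)
qed

text \<open>\<open>J\<close> is the ideal of denominators for \<open>D\<close>. It has no zero on
  \<open>X\<close> by \<open>locally_generated\<close>, and none outside because it contains the
  functions that vanish on \<open>X\<close>. Having 1 in \<open>J\<close> makes the coefficients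
  global.\<close>

theorem vector_fields_generated:
  fixes X :: "('k::{alg_closed_field, field_char_0} ^ 'i) set"
  assumes X: "affine_variety X" and V: "\<forall>k\<in>{1..n}. V k \<in> vector_fields X"
    and span: "spans_tangent_spaces X n V" and D: "D \<in> vector_fields X"
  shows "\<exists>f. (\<forall>k. f k \<in> coord_ring X) \<and> D = (\<Sum>k\<in>{1..n}. vf_mult (f k) (V k))"
proof -
  define J where "J = {h\<in>poly_funs. \<exists>a. (\<forall>k. a k \<in> poly_funs) \<and>
    (\<forall>q\<in>X. h q *s vf_vec X D q = (\<Sum>k\<in>{1..n}. a k q *s vf_vec X (V k) q))}"
  have JI: "h \<in> J" if "h \<in> poly_funs" "\<And>k. a k \<in> poly_funs"
    "\<And>q. q \<in> X \<Longrightarrow> h q *s vf_vec X D q = (\<Sum>k\<in>{1..n}. a k q *s vf_vec X (V k) q)" for h a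
    using that unfolding J_def by blast
  have van: "h \<in> J" if "h \<in> vanishing X" for h
    using that by (intro JI[of h "\<lambda>_ _. 0"]) (auto simp: vanishing_def intro: poly_funs.const)
  have "ideal_of poly_funs J"
    unfolding ideal_of_def
  proof (intro conjI ballI)
    show "J \<subseteq> poly_funs" by (auto simp: J_def)
    show "0 \<in> J" using van vanishing_ideal by (auto simp: ideal_of_def)
  next
    fix x y assume "x \<in> J" "y \<in> J"
    then obtain a b where a: "x \<in> poly_funs" "\<forall>k. a k \<in> poly_funs"
      "\<forall>q\<in>X. x q *s vf_vec X D q = (\<Sum>k\<in>{1..n}. a k q *s vf_vec X (V k) q)"
      and b: "y \<in> poly_funs" "\<forall>k. b k \<in> poly_funs"
      "\<forall>q\<in>X. y q *s vf_vec X D q = (\<Sum>k\<in>{1..n}. b k q *s vf_vec X (V k) q)" by (auto simp: J_def)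
    show "x + y \<in> J"
    proof (rule JI[of _ "\<lambda>k. a k + b k"])
      fix q assume "q \<in> X"
      then show "(x + y) q *s vf_vec X D q = (\<Sum>k\<in>{1..n}. (a k + b k) q *s vf_vec X (V k) q)"
        using a b by (simp add: vec.scale_left_distrib sum.distrib)
    qed (use a b in \<open>auto intro: poly_funs.add simp del: plus_fun_apply\<close>)
  next
    fix r x :: "'k ^ 'i \<Rightarrow> 'k" assume r: "r \<in> poly_funs" and "x \<in> J"
    then obtain a where a: "x \<in> poly_funs" "\<forall>k. a k \<in> poly_funs"
      "\<forall>q\<in>X. x q *s vf_vec X D q = (\<Sum>k\<in>{1..n}. a k q *s vf_vec X (V k) q)" by (auto simp: J_def)
    show "r * x \<in> J"
    proof (rule JI[of _ "\<lambda>k. r * a k"])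
      fix q assume "q \<in> X"
      then have "r q *s (x q *s vf_vec X D q) = (\<Sum>k\<in>{1..n}. (r * a k) q *s vf_vec X (V k) q)"
        using a by (simp add: vec.scale_sum_right vec.scale_scale)
      then show "(r * x) q *s vf_vec X D q = (\<Sum>k\<in>{1..n}. (r * a k) q *s vf_vec X (V k) q)"
        by (simp add: vec.scale_scale)
    qed (use a r in \<open>auto intro: poly_funs.mult\<close>)
  qed
  moreover have "\<exists>f\<in>J. f p \<noteq> 0" for p
  proof (cases "p \<in> X")
    case True
    then show ?thesis using locally_generated[OF True V span D] unfolding J_def by blast
  next
    case False
    obtain S where "S \<subseteq> poly_funs" "X = {p. \<forall>f\<in>S. f p = 0}" using X by (auto simp: affine_variety_def)
    then obtain f where "f \<in> vanishing X" "f p \<noteq> 0" using False by (auto simp: vanishing_def)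
    then show ?thesis using van by blast
  qed
  ultimately have "1 \<in> J" by (rule nullstellensatz)
  then obtain a where a: "\<forall>k. a k \<in> poly_funs"
    "\<And>q. q \<in> X \<Longrightarrow> vf_vec X D q = (\<Sum>k\<in>{1..n}. a k q *s vf_vec X (V k) q)" by (auto simp: J_def)
  have "D = (\<Sum>k\<in>{1..n}. vf_mult (restrict0 X (a k)) (V k))"
  proof (intro ext)
    fix f q
    have "(\<Sum>k\<in>{1..n}. vf_mult (restrict0 X (a k)) (V k)) f q = (\<Sum>k\<in>{1..n}. restrict0 X (a k) q * V k f q)"
      by (simp add: sum_fun_apply vf_mult_def)
    also have "\<dots> = D f q"
    proof (cases "f \<in> coord_ring X \<and> q \<in> X")
      case True
      then obtain f' where f': "f' \<in> poly_funs" "f = restrict0 X f'" by (auto elim: coord_ring_cases)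
      have q: "q \<in> X" using True by simp
      have "D f q = dir_deriv q (\<Sum>k\<in>{1..n}. a k q *s vf_vec X (V k) q) f'"
        using vf_eq_dir_deriv[OF D f'(1) q] a(2)[OF q] f'(2) by simp
      also have "\<dots> = (\<Sum>k\<in>{1..n}. a k q * V k f q)"
        unfolding dir_deriv_sum[OF f'(1)] using V vf_eq_dir_deriv[OF _ f'(1) q] f'(2)
        by (intro sum.cong) auto
      finally show ?thesis using q by simp
    next
      case False
      then have "B f q = 0" if "B \<in> vector_fields X" for B
        using vector_fieldsD(1,2)[OF that, of f] coord_ring_outside[of "B f" X q]
        by (cases "f \<in> coord_ring X") auto
      then show ?thesis using D V by (simp add: sum.neutral)
    qed
    finally show "D f q = (\<Sum>k\<in>{1..n}. vf_mult (restrict0 X (a k)) (V k)) f q" by simp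
  qed
  then show ?thesis using a(1) restrict0_in_coord_ring by (intro exI[of _ "\<lambda>k. restrict0 X (a k)"]) auto
qed

section \<open>The grading and the Lie algebra of vector fields\<close>

text \<open>The factor \<open>t ^ m\<close> clears the negative exponents, \<open>m\<close> being at
  least the absolute value of each of them. The polynomial so obtained vanishes for
  \<open>t \<noteq> 0\<close>, and one more factor \<open>[:0, 1:]\<close> covers
  \<open>t = 0\<close>.\<close>

lemma laurent_coefficients_zero:
  fixes a :: "int \<Rightarrow> 'k::field_char_0"
  assumes Q: "finite Q" and zero: "\<And>t. t \<noteq> 0 \<Longrightarrow> (\<Sum>q\<in>Q. t powi q * a q) = 0" and q: "q \<in> Q"
  shows "a q = 0"
proof -
  define m where "m = (\<Sum>q\<in>Q. nat \<bar>q\<bar>)"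
  have m: "0 \<le> r + int m" if "r \<in> Q" for r
  proof -
    have "nat \<bar>r\<bar> \<le> m" unfolding m_def by (rule member_le_sum) (use that Q in auto)
    then show ?thesis by arith
  qed
  define P where "P = (\<Sum>q\<in>Q. monom (a q) (nat (q + int m)))"
  have "poly P t = 0" if t: "t \<noteq> 0" for t
  proof -
    have "t ^ nat (r + int m) = t ^ m * t powi r" if "r \<in> Q" for r
    proof -
      have "t ^ nat (r + int m) = t powi (r + int m)" using m[OF that] by (simp add: power_int_def)
      then show ?thesis using t by (simp add: power_int_add mult.commute)
    qed
    then have "poly P t = (\<Sum>q\<in>Q. t ^ m * (t powi q * a q))"
      by (auto simp: P_def poly_sum poly_monom algebra_simps intro!: sum.cong)
    then show ?thesis using zero[OF t] by (simp add: sum_distrib_left[symmetric])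
  qed
  then have "poly ([:0, 1:] * P) t = poly 0 t" for t by (cases "t = 0") auto
  then have "[:0, 1:] * P = 0" using poly_eq_poly_eq_iff by blast
  then have "P = 0" by (simp del: mult_pCons_left)
  then have "0 = coeff P (nat (q + int m))" by simp
  also have "\<dots> = (\<Sum>r\<in>Q. if r = q then a q else 0)"
  proof -
    have "nat (r + int m) = nat (q + int m) \<longleftrightarrow> r = q" if "r \<in> Q" for r
      using m[OF that] m[OF q] by auto
    then show ?thesis by (auto simp: P_def coeff_sum intro!: sum.cong)
  qed
  finally show ?thesis using Q q by simp
qed

text \<open>The components are the Laurent coefficients of the pullback of \<open>f\<close>; putting
  \<open>t = 1\<close> shows that they add up to \<open>f\<close>. Comparing coefficients in the
  group law shows that the action multiplies \<open>g q\<close> by the power \<open>q\<close> of the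
  parameter. So the pullback of \<open>g q\<close> has a single term, and the generator multiplies
  \<open>g q\<close> by \<open>q\<close>.\<close>

lemma homogeneous_decomposition:
  fixes X :: "('k::field_char_0 ^ 'i) set"
  assumes H: "induces_Gm_action X H" and f: "f \<in> coord_ring X"
  shows "\<exists>Q g. finite Q \<and> (\<forall>q\<in>Q. g q \<in> coord_ring X \<and> H (g q) = fscale (of_int q) (g q)) \<and> f = sum g Q"
proof -
  obtain \<phi> where act: "algebraic_Gm_action X \<phi>" and gen: "infinitesimal_generator X \<phi> H"
    using H by (auto simp: induces_Gm_action_def)
  have "\<exists>Q g. laurent_expansion X (\<lambda>t p. f (\<phi> t p)) Q g"
    using act f unfolding algebraic_Gm_action_def by blast
  then obtain Q g where Q: "finite Q" "\<And>q. q \<in> Q \<Longrightarrow> g q \<in> coord_ring X"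
    and exp: "\<And>t p. t \<noteq> 0 \<Longrightarrow> p \<in> X \<Longrightarrow> f (\<phi> t p) = (\<Sum>q\<in>Q. t powi q * g q p)"
    unfolding laurent_expansion_def by blast
  have \<phi>: "\<phi> t p \<in> X" "\<phi> 1 p = p" "s \<noteq> 0 \<Longrightarrow> \<phi> (s * t) p = \<phi> s (\<phi> t p)" if "t \<noteq> 0" "p \<in> X" for s t p
    using act that by (auto simp: algebraic_Gm_action_def)
  have hom: "g q (\<phi> s p) = s powi q * g q p" if q: "q \<in> Q" and s: "s \<noteq> 0" and p: "p \<in> X" for q s p
  proof -
    have "g q (\<phi> s p) - s powi q * g q p = 0"
    proof (rule laurent_coefficients_zero[OF Q(1) _ q])
      fix t :: 'k assume t: "t \<noteq> 0"
      have "(\<Sum>q\<in>Q. t powi q * g q (\<phi> s p)) = f (\<phi> (t * s) p)"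
        using exp[OF t \<phi>(1)[OF s p]] \<phi>(3)[OF s p t] by simp
      also have "\<dots> = (\<Sum>q\<in>Q. t powi q * (s powi q * g q p))"
        using exp[of "t * s" p] s t p by (simp add: power_int_mult_distrib mult.assoc)
      finally show "(\<Sum>q\<in>Q. t powi q * (g q (\<phi> s p) - s powi q * g q p)) = 0"
        by (simp add: right_diff_distrib sum_subtractf)
    qed
    then show ?thesis by simp
  qed
  have "H (g q) = fscale (of_int q) (g q)" if q: "q \<in> Q" for q
  proof -
    have "laurent_expansion X (\<lambda>t p. g q (\<phi> t p)) {q} g"
      using Q(2)[OF q] hom[OF q] by (auto simp: laurent_expansion_def)
    then have "H (g q) = (\<Sum>q\<in>{q}. fscale (of_int q) (g q))"
      using gen Q(2)[OF q] unfolding infinitesimal_generator_def by blast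
    then show ?thesis by simp
  qed
  moreover have "f = sum g Q"
  proof
    fix p
    show "f p = sum g Q p"
    proof (cases "p \<in> X")
      case True
      then show ?thesis using exp[of 1 p] \<phi>(2)[of 1 p] by (simp add: sum_fun_apply)
    next
      case False
      have "f p = 0" "\<And>q. q \<in> Q \<Longrightarrow> g q p = 0"
        using coord_ring_outside[OF f False] coord_ring_outside[OF Q(2) False] by auto
      then show ?thesis by (simp add: sum_fun_apply)
    qed
  qed
  ultimately show ?thesis using Q by blast
qed

section \<open>Vector fields as a module and as a Lie algebra\<close>

lemma coord_ring_const: "const_on X c \<in> coord_ring X"
  by (simp add: const_on_def restrict0_in_coord_ring poly_funs.const)

lemma coord_ring_closed:
  assumes "f \<in> coord_ring X" "g \<in> coord_ring X"
  shows "f + g \<in> coord_ring X" "f - g \<in> coord_ring X" "f * g \<in> coord_ring X" "fscale c f \<in> coord_ring X"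
proof -
  obtain f' g' where fg: "f' \<in> poly_funs" "g' \<in> poly_funs" "f = restrict0 X f'" "g = restrict0 X g'"
    using assms by (auto elim!: coord_ring_cases)
  have "f + g = restrict0 X (f' + g')" "f - g = restrict0 X (f' - g')" "f * g = restrict0 X (f' * g')"
    "fscale c f = restrict0 X ((\<lambda>_. c) * f')"
    by (auto simp: fg restrict0_def fscale_def fun_eq_iff)
  then show "f + g \<in> coord_ring X" "f - g \<in> coord_ring X" "f * g \<in> coord_ring X" "fscale c f \<in> coord_ring X"
    using fg(1,2) by (simp_all only: restrict0_in_coord_ring poly_funs.intros poly_funs_diff)
qed

lemma coord_ring_zero: "0 \<in> coord_ring X"
  using coord_ring_const[of X 0] by (simp add: const_on_def restrict0_def zero_fun_def)

lemma coord_ring_sum: "(\<And>i. i \<in> S \<Longrightarrow> f i \<in> coord_ring X) \<Longrightarrow> sum f S \<in> coord_ring X"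
  by (induction S rule: infinite_finite_induct) (auto simp: coord_ring_zero intro: coord_ring_closed)

lemma vf_zero: "D \<in> vector_fields X \<Longrightarrow> D 0 = 0"
  using vector_fieldsD(3)[of D X 0 0] coord_ring_zero by (metis add_0 add_cancel_left_right)

lemma vector_fields_closed:
  assumes A: "A \<in> vector_fields X" and B: "B \<in> vector_fields X"
  shows "A + B \<in> vector_fields X" "vscale c A \<in> vector_fields X"
    "r \<in> coord_ring X \<Longrightarrow> vf_mult r A \<in> vector_fields X" "vf_bracket A B \<in> vector_fields X"
proof -
  note AD = vector_fieldsD[OF A] and BD = vector_fieldsD[OF B]
  note R = coord_ring_closed
  show "A + B \<in> vector_fields X"
    by (auto simp: vector_fields_def AD BD intro!: R) (auto simp: fscale_def fun_eq_iff algebra_simps)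
  show "vscale c A \<in> vector_fields X"
    by (auto simp: vector_fields_def vscale_def AD intro!: R) (auto simp: fscale_def fun_eq_iff algebra_simps)
  show "vf_mult r A \<in> vector_fields X" if "r \<in> coord_ring X"
    using that
    by (auto simp: vector_fields_def vf_mult_def AD intro!: R) (auto simp: fscale_def fun_eq_iff algebra_simps)
  show "vf_bracket A B \<in> vector_fields X"
    unfolding vector_fields_def
  proof (intro CollectI conjI ballI allI impI)
    fix f assume "f \<notin> coord_ring X"
    then show "vf_bracket A B f = 0" by (simp add: vf_bracket_def AD(1) BD(1) vf_zero[OF A] vf_zero[OF B])
  next
    fix f assume "f \<in> coord_ring X"
    then show "vf_bracket A B f \<in> coord_ring X" by (simp add: vf_bracket_def AD(2) BD(2) R(2))
  next
    fix c f assume "f \<in> coord_ring X"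
    then show "vf_bracket A B (fscale c f) = fscale c (vf_bracket A B f)"
      by (simp add: vf_bracket_def AD(2,4) BD(2,4)) (simp add: fscale_def fun_eq_iff algebra_simps)
  next
    fix f g assume fg: "f \<in> coord_ring X" "g \<in> coord_ring X"
    then show "vf_bracket A B (f + g) = vf_bracket A B f + vf_bracket A B g"
      by (simp add: vf_bracket_def AD(2,3) BD(2,3))
    from fg show "vf_bracket A B (f * g) = f * vf_bracket A B g + g * vf_bracket A B f"
      by (simp add: vf_bracket_def AD BD R algebra_simps)
  qed
qed

lemma vector_fields_zero: "(0 :: ('k::comm_ring_1 ^ 'i \<Rightarrow> 'k) \<Rightarrow> 'k ^ 'i \<Rightarrow> 'k) \<in> vector_fields X"
  by (simp add: vector_fields_def coord_ring_zero fscale_def fun_eq_iff)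

lemma vf_bracket_add_right:
  assumes A: "A \<in> vector_fields X" and B: "B \<in> vector_fields X" "C \<in> vector_fields X"
  shows "vf_bracket A (B + C) = vf_bracket A B + vf_bracket A C"
proof
  fix f
  show "vf_bracket A (B + C) f = (vf_bracket A B + vf_bracket A C) f"
  proof (cases "f \<in> coord_ring X")
    case True
    then show ?thesis
      by (simp add: vf_bracket_def vector_fieldsD(2)[OF B(1)] vector_fieldsD(2)[OF B(2)] vector_fieldsD(3)[OF A])
  next
    case False
    then show ?thesis
      by (simp add: vf_bracket_def vector_fieldsD(1)[OF A] vector_fieldsD(1)[OF B(1)] vector_fieldsD(1)[OF B(2)]
          vf_zero[OF A] vf_zero[OF B(1)] vf_zero[OF B(2)])
  qed
qed

lemma vf_bracket_vscale_right:
  assumes A: "A \<in> vector_fields X" and B: "B \<in> vector_fields X"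
  shows "vf_bracket A (vscale c B) = vscale c (vf_bracket A B)"
proof
  fix f
  show "vf_bracket A (vscale c B) f = vscale c (vf_bracket A B) f"
  proof (cases "f \<in> coord_ring X")
    case True
    then show ?thesis
      by (simp add: vf_bracket_def vscale_def vector_fieldsD(2)[OF B] vector_fieldsD(4)[OF A])
        (simp add: fscale_def fun_eq_iff algebra_simps)
  next
    case False
    then show ?thesis
      using vf_zero[OF A]
      by (simp add: vf_bracket_def vscale_def vector_fieldsD(1)[OF A] vector_fieldsD(1)[OF B]
          vf_zero[OF A] vf_zero[OF B] fscale_def zero_fun_def[symmetric])
  qed
qed

lemma vf_bracket_vscale_left:
  assumes A: "A \<in> vector_fields X" and B: "B \<in> vector_fields X"
  shows "vf_bracket (vscale c A) B = vscale c (vf_bracket A B)"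
proof -
  have swap: "vf_bracket C D = vscale (-1) (vf_bracket D C)" for C D :: "('a ^ 'b \<Rightarrow> 'a) \<Rightarrow> 'a ^ 'b \<Rightarrow> 'a"
    by (simp add: vf_bracket_def vscale_def fscale_def fun_eq_iff)
  show ?thesis
    unfolding swap[of "vscale c A" B] swap[of A B] vf_bracket_vscale_right[OF B A]
    by (simp add: vscale_def fscale_def fun_eq_iff)
qed

lemma vf_bracket_mult_right:
  assumes A: "A \<in> vector_fields X" and B: "B \<in> vector_fields X" and r: "r \<in> coord_ring X"
  shows "vf_bracket A (vf_mult r B) = vf_mult (A r) B + vf_mult r (vf_bracket A B)"
proof
  fix f
  show "vf_bracket A (vf_mult r B) f = (vf_mult (A r) B + vf_mult r (vf_bracket A B)) f"
  proof (cases "f \<in> coord_ring X")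
    case True
    then show ?thesis
      using r by (simp add: vf_bracket_def vf_mult_def vector_fieldsD(2)[OF B] vector_fieldsD(5)[OF A] algebra_simps)
  next
    case False
    then show ?thesis
      by (simp add: vf_bracket_def vf_mult_def vector_fieldsD(1)[OF A] vector_fieldsD(1)[OF B]
          vf_zero[OF A] vf_zero[OF B])
  qed
qed

lemma vf_bracket_mult_left:
  assumes A: "A \<in> vector_fields X" and B: "B \<in> vector_fields X" and r: "r \<in> coord_ring X"
  shows "vf_bracket (vf_mult r A) B = vf_mult r (vf_bracket A B) - vf_mult (B r) A"
proof -
  have swap: "vf_bracket C D = - vf_bracket D C" for C D :: "('a ^ 'b \<Rightarrow> 'a) \<Rightarrow> 'a ^ 'b \<Rightarrow> 'a"
    by (simp add: vf_bracket_def fun_eq_iff)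
  show ?thesis
    unfolding swap[of "vf_mult r A" B] swap[of A B] vf_bracket_mult_right[OF B A r]
    by (simp add: vf_mult_def fun_eq_iff)
qed

lemma const_on_mult:
  assumes "D \<in> vector_fields X"
  shows "vf_mult (const_on X c) D = vscale c D"
proof (intro ext)
  fix f p
  show "vf_mult (const_on X c) D f p = vscale c D f p"
  proof (cases "p \<in> X")
    case False
    then have "D f p = 0"
      using coord_ring_outside[of "D f" X p] vector_fieldsD(1,2)[OF assms, of f]
      by (cases "f \<in> coord_ring X") auto
    then show ?thesis by (simp add: vf_mult_def vscale_def fscale_def)
  qed (simp add: vf_mult_def vscale_def fscale_def const_on_def)
qed

section \<open>Bracket width\<close>

lemma sum_of_brackets_add:
  assumes "sum_of_brackets br L m z" "sum_of_brackets br L m' z'"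
  shows "sum_of_brackets br L (m + m') (z + z')"
proof -
  obtain y w where y: "\<forall>i\<in>{1..m}. y i \<in> L \<and> w i \<in> L" "z = (\<Sum>i\<in>{1..m}. br (y i) (w i))"
    using assms(1) unfolding sum_of_brackets_def by blast
  obtain y' w' where y': "\<forall>i\<in>{1..m'}. y' i \<in> L \<and> w' i \<in> L" "z' = (\<Sum>i\<in>{1..m'}. br (y' i) (w' i))"
    using assms(2) unfolding sum_of_brackets_def by blast
  define u where "u i = (if i \<le> m then y i else y' (i - m))" for i
  define v where "v i = (if i \<le> m then w i else w' (i - m))" for i
  have split: "{1..m + m'} = {1..m} \<union> {1 + m..m' + m}" by auto
  have "(\<Sum>i\<in>{1..m + m'}. br (u i) (v i)) =
      (\<Sum>i\<in>{1..m}. br (u i) (v i)) + (\<Sum>i\<in>{1 + m..m' + m}. br (u i) (v i))"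
    unfolding split by (rule sum.union_disjoint) auto
  also have "(\<Sum>i\<in>{1 + m..m' + m}. br (u i) (v i)) = (\<Sum>i\<in>{1..m'}. br (u (i + m)) (v (i + m)))"
    by (rule sum.shift_bounds_cl_nat_ivl)
  also have "\<dots> = z'" unfolding y'(2) by (intro sum.cong) (auto simp: u_def v_def)
  also have "(\<Sum>i\<in>{1..m}. br (u i) (v i)) = z" unfolding y(2) by (intro sum.cong) (auto simp: u_def v_def)
  finally have "z + z' = (\<Sum>i\<in>{1..m + m'}. br (u i) (v i))" by (rule sym)
  moreover have "\<forall>i\<in>{1..m + m'}. u i \<in> L \<and> v i \<in> L"
  proof
    fix i assume i: "i \<in> {1..m + m'}"
    show "u i \<in> L \<and> v i \<in> L"
    proof (cases "i \<le> m")
      case True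
      then show ?thesis using i y(1) by (simp add: u_def v_def)
    next
      case False
      then have "i - m \<in> {1..m'}" using i by auto
      with False show ?thesis using y'(1) by (simp add: u_def v_def)
    qed
  qed
  ultimately show ?thesis unfolding sum_of_brackets_def by (intro exI[of _ u] exI[of _ v] conjI)
qed

lemma sum_of_brackets_single:
  "a \<in> L \<Longrightarrow> b \<in> L \<Longrightarrow> sum_of_brackets br L 1 (br a b)"
  unfolding sum_of_brackets_def by (intro exI[of _ "\<lambda>_. a"] exI[of _ "\<lambda>_. b"]) simp

lemma sum_of_brackets_sum:
  assumes "finite S" "\<And>k. k \<in> S \<Longrightarrow> sum_of_brackets br L 1 (f k)"
  shows "sum_of_brackets br L (card S) (sum f S)"
  using assms
proof (induction S)
  case empty
  show ?case by (simp add: sum_of_brackets_def)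
next
  case (insert k S)
  have "sum_of_brackets br L (1 + card S) (f k + sum f S)"
    using insert by (intro sum_of_brackets_add) auto
  then show ?case
    unfolding sum.insert[OF insert.hyps] card_insert_disjoint[OF insert.hyps] by (simp only: plus_1_eq_Suc)
qed

text \<open>The vector fields form a subspace closed under brackets and so contain the derived
  algebra. The bound is asked of every vector field because the normal forms provide it for all of
  them.\<close>

lemma bracket_width_le:
  fixes X :: "('k::comm_ring_1 ^ 'i) set"
  assumes "\<And>D. D \<in> vector_fields X \<Longrightarrow> sum_of_brackets vf_bracket (vector_fields X) m D"
  shows "bracket_width (vscale :: 'k \<Rightarrow> _) vf_bracket (vector_fields X) \<le> enat m"
proof -
  interpret module "vscale :: 'k \<Rightarrow> (('k ^ 'i \<Rightarrow> 'k) \<Rightarrow> 'k ^ 'i \<Rightarrow> 'k) \<Rightarrow> _" by (rule module_vscale)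
  have "derived_algebra (vscale :: 'k \<Rightarrow> _) vf_bracket (vector_fields X) \<subseteq> vector_fields X"
    unfolding derived_algebra_def
    by (rule span_minimal) (auto intro!: subspaceI vector_fields_closed vector_fields_zero)
  then have "bracket_length vf_bracket (vector_fields X) D \<le> enat m"
    if "D \<in> derived_algebra (vscale :: 'k \<Rightarrow> _) vf_bracket (vector_fields X)" for D
    unfolding bracket_length_def using assms that by (intro INF_lower) auto
  then show ?thesis unfolding bracket_width_def by (intro SUP_least)
qed

text \<open>The spanning condition enters only through \<open>generated\<close> and the action only
  through \<open>decomposition\<close>; from here on the argument is purely algebraic.\<close>

locale graded_vector_fields =
  fixes X :: "('k::field_char_0 ^ 'i) set"
    and x :: "nat \<Rightarrow> 'k ^ 'i \<Rightarrow> 'k"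
    and V :: "nat \<Rightarrow> ('k ^ 'i \<Rightarrow> 'k) \<Rightarrow> 'k ^ 'i \<Rightarrow> 'k"
    and H :: "('k ^ 'i \<Rightarrow> 'k) \<Rightarrow> 'k ^ 'i \<Rightarrow> 'k"
    and c d :: "nat \<Rightarrow> int"
    and n N :: nat
  assumes x: "l \<in> {1..N} \<Longrightarrow> x l \<in> coord_ring X"
    and K_plus_ideal: "coord_ring X = {const_on X a + g | a g. g \<in> gen_ideal X N x}"
    and V: "k \<in> {1..n} \<Longrightarrow> V k \<in> vector_fields X"
    and generated: "D \<in> vector_fields X \<Longrightarrow>
      \<exists>f. (\<forall>k. f k \<in> coord_ring X) \<and> D = (\<Sum>k\<in>{1..n}. vf_mult (f k) (V k))"
    and H: "H \<in> vector_fields X"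
    and decomposition: "f \<in> coord_ring X \<Longrightarrow> \<exists>Q g. finite Q \<and>
      (\<forall>q\<in>Q. g q \<in> coord_ring X \<and> H (g q) = fscale (of_int q) (g q)) \<and> f = sum g Q"
    and bracket_V: "k \<in> {1..n} \<Longrightarrow> vf_bracket H (V k) = vscale (of_int (c k)) (V k)"
    and d_nonzero: "l \<in> {1..N} \<Longrightarrow> d l \<noteq> 0"
    and H_x: "l \<in> {1..N} \<Longrightarrow> H (x l) = fscale (of_int (d l)) (x l)"
begin

section \<open>Vector fields obtained from brackets with fixed left entries\<close>

abbreviation "Vec \<equiv> vector_fields X"

text \<open>The left entries of the brackets are fixed, so that these elements form a subspace.\<close>

definition absorbed :: "(('k ^ 'i \<Rightarrow> 'k) \<Rightarrow> 'k ^ 'i \<Rightarrow> 'k) set" where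
  "absorbed = {vf_bracket H Y + (\<Sum>l\<in>{1..N}. vf_bracket (vf_mult (x l) H) (Z l)) | Y Z.
     Y \<in> Vec \<and> (\<forall>l. Z l \<in> Vec)}"

lemma xH: "l \<in> {1..N} \<Longrightarrow> vf_mult (x l) H \<in> Vec"
  by (rule vector_fields_closed(3)[OF H H x])

lemma vf_bracket_zero_right: "A \<in> Vec \<Longrightarrow> vf_bracket A 0 = 0"
  using vf_bracket_add_right[of A X 0 0] vector_fields_zero[of X] by simp

lemma absorbedI:
  assumes "Y \<in> Vec" "\<And>l. Z l \<in> Vec"
  shows "vf_bracket H Y + (\<Sum>l\<in>{1..N}. vf_bracket (vf_mult (x l) H) (Z l)) \<in> absorbed"
  using assms unfolding absorbed_def by blast

lemma absorbed_H:
  assumes "Y \<in> Vec"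
  shows "vf_bracket H Y \<in> absorbed"
proof -
  have "(\<Sum>l\<in>{1..N}. vf_bracket (vf_mult (x l) H) 0) = 0"
    by (intro sum.neutral ballI vf_bracket_zero_right xH)
  then show ?thesis using absorbedI[of Y "\<lambda>_. 0", OF assms vector_fields_zero] by (simp only: add_0_right)
qed

lemma absorbed_x:
  assumes "l \<in> {1..N}" "Y \<in> Vec"
  shows "vf_bracket (vf_mult (x l) H) Y \<in> absorbed"
proof -
  have "(\<Sum>i\<in>{1..N}. vf_bracket (vf_mult (x i) H) (if i = l then Y else 0)) =
      (\<Sum>i\<in>{1..N}. if i = l then vf_bracket (vf_mult (x l) H) Y else 0)"
    by (intro sum.cong refl) (simp add: vf_bracket_zero_right xH)
  also have "\<dots> = vf_bracket (vf_mult (x l) H) Y" using assms(1) by simp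
  finally have eq: "(\<Sum>i\<in>{1..N}. vf_bracket (vf_mult (x i) H) (if i = l then Y else 0)) = \<dots>" .
  have "vf_bracket H 0 + (\<Sum>i\<in>{1..N}. vf_bracket (vf_mult (x i) H) (if i = l then Y else 0)) \<in> absorbed"
    by (rule absorbedI) (use assms vector_fields_zero in auto)
  then show ?thesis unfolding eq vf_bracket_zero_right[OF H] by (simp only: add_0_left)
qed

lemma absorbed_add:
  assumes "A \<in> absorbed" "B \<in> absorbed"
  shows "A + B \<in> absorbed"
proof -
  obtain Y Z Y' Z' where A: "A = vf_bracket H Y + (\<Sum>l\<in>{1..N}. vf_bracket (vf_mult (x l) H) (Z l))"
      "Y \<in> Vec" "\<And>l. Z l \<in> Vec"
    and B: "B = vf_bracket H Y' + (\<Sum>l\<in>{1..N}. vf_bracket (vf_mult (x l) H) (Z' l))"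
      "Y' \<in> Vec" "\<And>l. Z' l \<in> Vec"
    using assms unfolding absorbed_def by blast
  have "(\<Sum>l\<in>{1..N}. vf_bracket (vf_mult (x l) H) (Z l + Z' l)) =
    (\<Sum>l\<in>{1..N}. vf_bracket (vf_mult (x l) H) (Z l)) + (\<Sum>l\<in>{1..N}. vf_bracket (vf_mult (x l) H) (Z' l))"
    unfolding sum.distrib[symmetric] using A B by (intro sum.cong refl vf_bracket_add_right[OF xH])
  then have "A + B = vf_bracket H (Y + Y') + (\<Sum>l\<in>{1..N}. vf_bracket (vf_mult (x l) H) (Z l + Z' l))"
    unfolding A(1) B(1) vf_bracket_add_right[OF H A(2) B(2)] by (simp only: add_ac)
  also have "\<dots> \<in> absorbed" using A B by (intro absorbedI vector_fields_closed(1))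
  finally show ?thesis .
qed

lemma absorbed_scale:
  assumes "A \<in> absorbed"
  shows "vscale a A \<in> absorbed"
proof -
  interpret module "vscale :: 'k \<Rightarrow> (('k ^ 'i \<Rightarrow> 'k) \<Rightarrow> 'k ^ 'i \<Rightarrow> 'k) \<Rightarrow> _" by (rule module_vscale)
  obtain Y Z where A: "A = vf_bracket H Y + (\<Sum>l\<in>{1..N}. vf_bracket (vf_mult (x l) H) (Z l))"
      "Y \<in> Vec" "\<And>l. Z l \<in> Vec"
    using assms unfolding absorbed_def by blast
  have "vscale a A = vf_bracket H (vscale a Y) + (\<Sum>l\<in>{1..N}. vf_bracket (vf_mult (x l) H) (vscale a (Z l)))"
    unfolding A(1) scale_right_distrib scale_sum_right vf_bracket_vscale_right[OF H A(2)]
    by (intro arg_cong2[of _ _ _ _ "(+)"] sum.cong refl vf_bracket_vscale_right[symmetric, OF xH A(3)])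
  also have "\<dots> \<in> absorbed" using A by (intro absorbedI vector_fields_closed(2))
  finally show ?thesis .
qed

lemma absorbed_zero: "0 \<in> absorbed"
  using absorbed_H[OF vector_fields_zero] by (simp only: vf_bracket_zero_right[OF H])

lemma absorbed_sum: "(\<And>i. i \<in> S \<Longrightarrow> f i \<in> absorbed) \<Longrightarrow> sum f S \<in> absorbed"
  by (induction S rule: infinite_finite_induct) (auto intro: absorbed_zero absorbed_add)

lemma absorbed_sum_of_brackets:
  assumes "A \<in> absorbed"
  shows "sum_of_brackets vf_bracket Vec (1 + N) A"
proof -
  obtain Y Z where A: "A = vf_bracket H Y + (\<Sum>l\<in>{1..N}. vf_bracket (vf_mult (x l) H) (Z l))"
      "Y \<in> Vec" "\<And>l. Z l \<in> Vec"
    using assms unfolding absorbed_def by blast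
  have "sum_of_brackets vf_bracket Vec (card {1..N}) (\<Sum>l\<in>{1..N}. vf_bracket (vf_mult (x l) H) (Z l))"
    using A xH by (intro sum_of_brackets_sum sum_of_brackets_single) auto
  then show ?thesis
    unfolding A(1) using A(2) H by (intro sum_of_brackets_add sum_of_brackets_single) auto
qed

text \<open>\<open>D\<close> is the bracket of \<open>H\<close> with \<open>D\<close> divided by its
  weight.\<close>

lemma eigenvector_absorbed:
  assumes D: "D \<in> Vec" "vf_bracket H D = vscale (of_int e) D" and e: "e \<noteq> 0"
  shows "D \<in> absorbed"
proof -
  have "vf_bracket H (vscale (1 / of_int e) D) = D"
    unfolding vf_bracket_vscale_right[OF H D(1)] D(2)
    using e by (simp add: vscale_def fscale_def fun_eq_iff)
  then show ?thesis using absorbed_H[OF vector_fields_closed(2)[OF D(1) D(1)], of "1 / of_int e"] by (simp only:)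
qed

lemma homogeneous_mult:
  assumes "D \<in> Vec" "vf_bracket H D = vscale (of_int e) D"
    and "g \<in> coord_ring X" "H g = fscale (of_int q) g"
  shows "vf_bracket H (vf_mult g D) = vscale (of_int (q + e)) (vf_mult g D)"
  unfolding vf_bracket_mult_right[OF H assms(1,3)] assms(2,4)
  by (simp add: vscale_def vf_mult_def fscale_def fun_eq_iff algebra_simps)

lemma vf_mult_mult: "vf_mult f (vf_mult g D) = vf_mult (f * g) (D :: ('k ^ 'i \<Rightarrow> 'k) \<Rightarrow> 'k ^ 'i \<Rightarrow> 'k)"
  by (simp add: vf_mult_def mult.assoc)

lemma vf_mult_sum: "vf_mult (sum f S) D = (\<Sum>i\<in>S. vf_mult (f i) (D :: ('k ^ 'i \<Rightarrow> 'k) \<Rightarrow> 'k ^ 'i \<Rightarrow> 'k))"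
  by (simp add: vf_mult_def fun_eq_iff sum_fun_apply sum_distrib_right)

lemma vf_mult_add: "vf_mult (f + g) D = vf_mult f D + vf_mult g (D :: ('k ^ 'i \<Rightarrow> 'k) \<Rightarrow> 'k ^ 'i \<Rightarrow> 'k)"
  by (simp add: vf_mult_def fun_eq_iff algebra_simps)

lemma gen_ideal_cases:
  assumes "r \<in> gen_ideal X N x"
  obtains g where "r = (\<Sum>l\<in>{1..N}. x l * g l)" "\<And>l. l \<in> {1..N} \<Longrightarrow> g l \<in> coord_ring X"
  using assms unfolding gen_ideal_def by blast

lemma gen_ideal_closed:
  assumes "r \<in> gen_ideal X N x" "s \<in> coord_ring X"
  shows "r \<in> coord_ring X" "s * r \<in> gen_ideal X N x"
proof -
  obtain g where g: "r = (\<Sum>l\<in>{1..N}. x l * g l)" "\<And>l. l \<in> {1..N} \<Longrightarrow> g l \<in> coord_ring X"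
    using gen_ideal_cases[OF assms(1)] by metis
  show "r \<in> coord_ring X" unfolding g(1) by (intro coord_ring_sum coord_ring_closed(3) x g(2))
  have "s * r = (\<Sum>l\<in>{1..N}. x l * (s * g l))"
    unfolding g(1) sum_distrib_left by (intro sum.cong refl) (simp only: mult_ac)
  moreover have "\<forall>l\<in>{1..N}. s * g l \<in> coord_ring X" using g(2) assms(2) coord_ring_closed(3) by blast
  ultimately show "s * r \<in> gen_ideal X N x"
    unfolding gen_ideal_def by (intro CollectI exI[of _ "\<lambda>l. s * g l"] conjI)
qed

text \<open>For homogeneous \<open>g\<close> of the critical weight, the correction
  \<open>U (x l) * H\<close> with \<open>U = g * H\<close> is itself a multiple of
  \<open>x l * g * H\<close>, so no error is left. In all other weights \<open>x l * g * H\<close>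
  is an eigenvector of \<open>H\<close>.\<close>

lemma ideal_times_H_absorbed:
  assumes "r \<in> gen_ideal X N x"
  shows "vf_mult r H \<in> absorbed"
proof -
  have HH: "vf_bracket H H = vscale (of_int 0) H"
    by (simp add: vf_bracket_def vscale_def fscale_def fun_eq_iff)
  have hom: "vf_mult (x l * g) H \<in> absorbed"
    if l: "l \<in> {1..N}" and g: "g \<in> coord_ring X" "H g = fscale (of_int q) g" for l g q
  proof (cases "d l + q = 0")
    case False
    have gH: "vf_mult g H \<in> Vec" by (rule vector_fields_closed(3)[OF H H g(1)])
    have "vf_bracket H (vf_mult (x l) (vf_mult g H)) = vscale (of_int (d l + (q + 0))) (vf_mult (x l) (vf_mult g H))"
      by (rule homogeneous_mult[OF gH homogeneous_mult[OF H HH g] x[OF l] H_x[OF l]])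
    then have "vf_mult (x l) (vf_mult g H) \<in> absorbed"
      using False by (intro eigenvector_absorbed[OF vector_fields_closed(3)[OF gH gH x[OF l]]]) auto
    then show ?thesis by (simp only: vf_mult_mult)
  next
    case True
    then have q: "q = - d l" by simp
    have gH: "vf_mult g H \<in> Vec" by (rule vector_fields_closed(3)[OF H H g(1)])
    define B where "B = vf_bracket (vf_mult (x l) H) (vf_mult g H)"
    have "B = vf_mult (x l) (vf_bracket H (vf_mult g H)) - vf_mult ((vf_mult g H) (x l)) H"
      unfolding B_def by (rule vf_bracket_mult_left[OF H gH x[OF l]])
    \<comment> \<open>The contributions of \<open>H g\<close> and \<open>H (x l)\<close> add up with
      the same sign because the weights are opposite. This gives the factor 2, which is invertible
      in characteristic zero.\<close>
    then have "B = vscale (- 2 * of_int (d l)) (vf_mult (x l * g) H)"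
      unfolding homogeneous_mult[OF H HH g] q
      by (simp add: vf_mult_def H_x[OF l] vscale_def fscale_def fun_eq_iff algebra_simps)
    then have "vf_mult (x l * g) H = vscale (- 1 / (2 * of_int (d l))) B"
      using d_nonzero[OF l] by (simp add: vscale_def fscale_def fun_eq_iff)
    also have "\<dots> \<in> absorbed"
      unfolding B_def by (intro absorbed_scale absorbed_x l gH)
    finally show ?thesis .
  qed
  obtain g where g: "r = (\<Sum>l\<in>{1..N}. x l * g l)" "\<And>l. l \<in> {1..N} \<Longrightarrow> g l \<in> coord_ring X"
    using gen_ideal_cases[OF assms] by metis
  have "vf_mult (x l * g l) H \<in> absorbed" if l: "l \<in> {1..N}" for l
  proof -
    obtain Q h where h: "\<forall>q\<in>Q. h q \<in> coord_ring X \<and> H (h q) = fscale (of_int q) (h q)" "g l = sum h Q"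
      using decomposition[OF g(2)[OF l]] by blast
    show ?thesis
      unfolding h(2) sum_distrib_left vf_mult_sum by (intro absorbed_sum) (use h(1) hom[OF l] in blast)
  qed
  then show ?thesis unfolding g(1) vf_mult_sum by (intro absorbed_sum)
qed

text \<open>If \<open>U\<close> has weight \<open>- d l\<close>, then \<open>x l * U\<close> is a multiple of the bracket of \<open>x l * H\<close> and \<open>U\<close>
  up to the correction \<open>U (x l) * H\<close>.\<close>

lemma x_times_homogeneous:
  assumes l: "l \<in> {1..N}" and U: "U \<in> Vec" "vf_bracket H U = vscale (of_int e) U"
  shows "\<exists>s. vf_mult (x l) U + vscale s (vf_mult (U (x l)) H) \<in> absorbed"
proof (cases "d l + e = 0")
  case False
  have "vf_mult (x l) U \<in> absorbed"
    using False by (intro eigenvector_absorbed[OF _ homogeneous_mult[OF U x[OF l] H_x[OF l]]]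
        vector_fields_closed(3)[OF U(1) U(1) x[OF l]])
  moreover have "vscale 0 (vf_mult (U (x l)) H) = 0" by (simp add: vscale_def fscale_def fun_eq_iff)
  ultimately show ?thesis by (intro exI[of _ 0]) (simp only: add_0_right)
next
  case True
  then have e: "e = - d l" by simp
  define B where "B = vf_bracket (vf_mult (x l) H) U"
  have "B = vf_mult (x l) (vscale (of_int e) U) - vf_mult (U (x l)) H"
    unfolding B_def vf_bracket_mult_left[OF H U(1) x[OF l]] U(2) ..
  moreover have "e \<noteq> 0" using d_nonzero[OF l] e by simp
  ultimately have "vscale (1 / of_int e) B = vf_mult (x l) U + vscale (- 1 / of_int e) (vf_mult (U (x l)) H)"
    by (simp add: vf_mult_def vscale_def fscale_def fun_eq_iff field_simps)
  moreover have "vscale (1 / of_int e) B \<in> absorbed"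
    unfolding B_def by (intro absorbed_scale absorbed_x l U(1))
  ultimately show ?thesis by (intro exI[of _ "- 1 / of_int e"]) (simp only:)
qed

text \<open>This is the decomposition argument common to both normal forms, which differ only in
  what becomes of the corrections. \<open>T\<close> is assumed closed under addition alone, so the
  scalars are written out in \<open>constants\<close> and \<open>corrections\<close>.\<close>

lemma Vec_subset:
  assumes add: "\<And>A B. A \<in> T \<Longrightarrow> B \<in> T \<Longrightarrow> A + B \<in> T" and absorbed: "absorbed \<subseteq> T"
    and constants: "\<And>k a. k \<in> {1..n} \<Longrightarrow> c k = 0 \<Longrightarrow> vscale a (V k) \<in> T"
    and corrections: "\<And>k l g s. k \<in> {1..n} \<Longrightarrow> l \<in> {1..N} \<Longrightarrow> g \<in> coord_ring X \<Longrightarrow>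
      vscale s (vf_mult (g * V k (x l)) H) \<in> T"
    and D: "D \<in> Vec"
  shows "D \<in> T"
proof -
  have sum: "sum f S \<in> T" if "\<And>i. i \<in> S \<Longrightarrow> f i \<in> T" for f and S :: "'c set"
    using that absorbed_zero absorbed
    by (induction S rule: infinite_finite_induct) (auto intro: add)
  have hom: "vf_mult (x l * g) (V k) \<in> T"
    if k: "k \<in> {1..n}" and l: "l \<in> {1..N}" and g: "g \<in> coord_ring X" "H g = fscale (of_int q) g" for k l g q
  proof -
    have gV: "vf_mult g (V k) \<in> Vec" by (rule vector_fields_closed(3)[OF V[OF k] V[OF k] g(1)])
    obtain s where s: "vf_mult (x l) (vf_mult g (V k)) + vscale s (vf_mult (vf_mult g (V k) (x l)) H) \<in> absorbed"
      using x_times_homogeneous[OF l gV homogeneous_mult[OF V[OF k] bracket_V[OF k] g]] by blast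
    have "vscale (- s) (vf_mult (g * V k (x l)) H) \<in> T" by (rule corrections[OF k l g(1)])
    from add[OF subsetD[OF absorbed s] this]
    have "vf_mult (x l) (vf_mult g (V k)) + vscale s (vf_mult (vf_mult g (V k) (x l)) H)
      + vscale (- s) (vf_mult (g * V k (x l)) H) \<in> T" .
    moreover have "vf_mult (x l) (vf_mult g (V k)) + vscale s (vf_mult (vf_mult g (V k) (x l)) H)
      + vscale (- s) (vf_mult (g * V k (x l)) H) = vf_mult (x l * g) (V k)"
      by (simp add: vf_mult_def vscale_def fscale_def fun_eq_iff mult.assoc)
    ultimately show ?thesis by (simp only:)
  qed
  have const: "vscale a (V k) \<in> T" if k: "k \<in> {1..n}" for k a
  proof (cases "c k = 0")
    case False
    then have "V k \<in> absorbed" by (rule eigenvector_absorbed[OF V[OF k] bracket_V[OF k]])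
    then show ?thesis using absorbed absorbed_scale by blast
  qed (rule constants[OF k])
  have fV: "vf_mult f (V k) \<in> T" if f: "f \<in> coord_ring X" and k: "k \<in> {1..n}" for f k
  proof -
    obtain a r where ar: "f = const_on X a + r" "r \<in> gen_ideal X N x"
      using f K_plus_ideal by blast
    obtain g where g: "r = (\<Sum>l\<in>{1..N}. x l * g l)" "\<And>l. l \<in> {1..N} \<Longrightarrow> g l \<in> coord_ring X"
      using gen_ideal_cases[OF ar(2)] by metis
    have "vf_mult (x l * g l) (V k) \<in> T" if l: "l \<in> {1..N}" for l
    proof -
      obtain Q h where h: "\<forall>q\<in>Q. h q \<in> coord_ring X \<and> H (h q) = fscale (of_int q) (h q)" "g l = sum h Q"
        using decomposition[OF g(2)[OF l]] by blast
      show ?thesis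
        unfolding h(2) sum_distrib_left vf_mult_sum by (intro sum) (use h(1) hom[OF k l] in blast)
    qed
    then have "vf_mult r (V k) \<in> T" unfolding g(1) vf_mult_sum by (intro sum)
    then show ?thesis
      unfolding ar(1) vf_mult_add const_on_mult[OF V[OF k]] by (intro add const[OF k])
  qed
  obtain f where "\<forall>k. f k \<in> coord_ring X" "D = (\<Sum>k\<in>{1..n}. vf_mult (f k) (V k))"
    using generated[OF D] by blast
  then show ?thesis using fV by (auto intro!: sum)
qed

text \<open>The coefficients are collected for each \<open>k\<close> before any bracket is counted.
  However many constants arise, each \<open>V k\<close> of weight zero then costs one bracket, since
  a scalar can be moved into \<open>W\<close>.\<close>

definition weight_zero_part :: "(nat \<Rightarrow> 'k) \<Rightarrow> ('k ^ 'i \<Rightarrow> 'k) \<Rightarrow> 'k ^ 'i \<Rightarrow> 'k" where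
  "weight_zero_part a = (\<Sum>k\<in>{k\<in>{1..n}. c k = 0}. vscale (a k) (V k))"

lemma weight_zero_part_add: "weight_zero_part a + weight_zero_part b = weight_zero_part (\<lambda>k. a k + b k)"
  unfolding weight_zero_part_def module.scale_left_distrib[OF module_vscale] sum.distrib ..

lemma weight_zero_part_zero: "weight_zero_part (\<lambda>_. 0) = 0"
  by (simp add: weight_zero_part_def vscale_def fscale_def fun_eq_iff sum_fun_apply)

lemma weight_zero_part_single:
  assumes "k \<in> {1..n}" "c k = 0"
  shows "weight_zero_part (\<lambda>i. if i = k then a else 0) = vscale a (V k)"
proof -
  have "weight_zero_part (\<lambda>i. if i = k then a else 0) = (\<Sum>i\<in>{k\<in>{1..n}. c k = 0}. if i = k then vscale a (V k) else 0)"
    unfolding weight_zero_part_def by (intro sum.cong refl) (auto simp: vscale_def fscale_def fun_eq_iff)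
  also have "\<dots> = vscale a (V k)" using assms by simp
  finally show ?thesis .
qed

lemma weight_zero_part_sum_of_brackets:
  assumes "\<And>k. k \<in> {1..n} \<Longrightarrow> c k = 0 \<Longrightarrow> \<exists>W\<in>Vec. \<exists>W'\<in>Vec. vf_bracket W W' = V k"
  shows "sum_of_brackets vf_bracket Vec (card {k\<in>{1..n}. c k = 0}) (weight_zero_part a)"
  unfolding weight_zero_part_def
proof (rule sum_of_brackets_sum)
  fix k assume "k \<in> {k\<in>{1..n}. c k = 0}"
  then obtain W W' where W: "W \<in> Vec" "W' \<in> Vec" "vf_bracket W W' = V k" using assms by blast
  have "sum_of_brackets vf_bracket Vec 1 (vf_bracket (vscale (a k) W) W')"
    using W by (intro sum_of_brackets_single vector_fields_closed(2))
  then show "sum_of_brackets vf_bracket Vec 1 (vscale (a k) (V k))"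
    by (simp only: vf_bracket_vscale_left[OF W(1,2)] W(3))
qed simp

text \<open>Under this hypothesis every correction is an element of the ideal times
  \<open>H\<close>, and these are absorbed.\<close>

lemma Vec_normal_form_ideal:
  assumes ideal: "\<And>k l. k \<in> {1..n} \<Longrightarrow> l \<in> {1..N} \<Longrightarrow> V k (x l) \<in> gen_ideal X N x" and D: "D \<in> Vec"
  shows "\<exists>E a. E \<in> absorbed \<and> D = E + weight_zero_part a"
proof -
  define T where "T = {E + weight_zero_part a | E a. E \<in> absorbed}"
  have TI: "E + weight_zero_part a \<in> T" if "E \<in> absorbed" for E a using that unfolding T_def by blast
  have absT: "absorbed \<subseteq> T"
  proof
    fix E assume "E \<in> absorbed"
    from TI[OF this, of "\<lambda>_. 0"] show "E \<in> T" by (simp only: weight_zero_part_zero add_0_right)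
  qed
  have "D \<in> T"
  proof (rule Vec_subset[OF _ absT _ _ D])
    fix A B assume "A \<in> T" "B \<in> T"
    then obtain E a E' a' where E: "E \<in> absorbed" "E' \<in> absorbed" "A = E + weight_zero_part a" "B = E' + weight_zero_part a'"
      unfolding T_def by blast
    have "A + B = (E + E') + weight_zero_part (\<lambda>k. a k + a' k)"
      unfolding E(3,4) weight_zero_part_add[symmetric] by (simp only: add_ac)
    then show "A + B \<in> T" using TI[OF absorbed_add[OF E(1,2)]] by (simp only:)
  next
    fix k a assume "k \<in> {1..n}" "c k = 0"
    then show "vscale a (V k) \<in> T"
      using TI[OF absorbed_zero, of "\<lambda>i. if i = k then a else 0"] by (simp only: weight_zero_part_single add_0_left)
  next
    fix k l g s assume "k \<in> {1..n}" "l \<in> {1..N}" "g \<in> coord_ring X"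
    then have "vf_mult (g * V k (x l)) H \<in> absorbed"
      by (intro ideal_times_H_absorbed gen_ideal_closed(2) ideal)
    then show "vscale s (vf_mult (g * V k (x l)) H) \<in> T" using absT absorbed_scale by blast
  qed
  then show ?thesis unfolding T_def by blast
qed

text \<open>The function in a correction is a constant plus an element of the ideal. The second part
  is absorbed, so that only constant multiples of \<open>H\<close> remain, and they add up to a
  single one.\<close>

lemma Vec_normal_form:
  assumes D: "D \<in> Vec"
  shows "\<exists>E a b. E \<in> absorbed \<and> D = E + weight_zero_part a + vscale b H"
proof -
  define T where "T = {E + weight_zero_part a + vscale b H | E a b. E \<in> absorbed}"
  interpret module "vscale :: 'k \<Rightarrow> (('k ^ 'i \<Rightarrow> 'k) \<Rightarrow> 'k ^ 'i \<Rightarrow> 'k) \<Rightarrow> _" by (rule module_vscale)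
  have TI: "E + weight_zero_part a + vscale b H \<in> T" if "E \<in> absorbed" for E a b using that unfolding T_def by blast
  have absT: "absorbed \<subseteq> T"
  proof
    fix E assume "E \<in> absorbed"
    from TI[OF this, of "\<lambda>_. 0" 0] show "E \<in> T" by (simp only: weight_zero_part_zero scale_zero_left add_0_right)
  qed
  have add: "A + B \<in> T" if "A \<in> T" "B \<in> T" for A B
  proof -
    obtain E a b E' a' b' where E: "E \<in> absorbed" "E' \<in> absorbed"
      "A = E + weight_zero_part a + vscale b H" "B = E' + weight_zero_part a' + vscale b' H"
      using \<open>A \<in> T\<close> \<open>B \<in> T\<close> unfolding T_def by blast
    have "A + B = (E + E') + weight_zero_part (\<lambda>k. a k + a' k) + vscale (b + b') H"
      unfolding E(3,4) weight_zero_part_add[symmetric] scale_left_distrib by (simp only: add_ac)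
    then show "A + B \<in> T" using TI[OF absorbed_add[OF E(1,2)]] by (simp only:)
  qed
  have "D \<in> T"
  proof (rule Vec_subset[OF add absT _ _ D])
    fix k a assume "k \<in> {1..n}" "c k = 0"
    then show "vscale a (V k) \<in> T"
      using TI[OF absorbed_zero, of "\<lambda>i. if i = k then a else 0" 0]
      by (simp only: weight_zero_part_single add_0_left scale_zero_left add_0_right)
  next
    fix k l g s assume kl: "k \<in> {1..n}" "l \<in> {1..N}" "g \<in> coord_ring X"
    have "g * V k (x l) \<in> coord_ring X"
      by (intro coord_ring_closed(3) kl(3) vector_fieldsD(2)[OF V[OF kl(1)] x[OF kl(2)]])
    then obtain a r where ar: "g * V k (x l) = const_on X a + r" "r \<in> gen_ideal X N x"
      using K_plus_ideal by blast
    have "vscale s (vf_mult (g * V k (x l)) H) = vscale s (vf_mult r H) + weight_zero_part (\<lambda>_. 0) + vscale (s * a) H"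
      unfolding ar(1) vf_mult_add const_on_mult[OF H] scale_right_distrib weight_zero_part_zero
      by (simp only: scale_scale add_0_right add_0_left add_ac)
    then show "vscale s (vf_mult (g * V k (x l)) H) \<in> T"
      using TI[OF absorbed_scale[OF ideal_times_H_absorbed[OF ar(2)]]] by (simp only:)
  qed
  then show ?thesis unfolding T_def by blast
qed

end

section \<open>From normal forms to the two bounds\<close>

lemma INF_enat_attained:
  assumes "(INF m\<in>S. enat m) \<noteq> \<infinity>"
  obtains m where "m \<in> S" "(INF m\<in>S. enat m) = enat m"
proof -
  have ne: "enat ` S \<noteq> {}" using assms by (auto simp: Inf_enat_def)
  then have "(INF m\<in>S. enat m) = (LEAST y. y \<in> enat ` S)" by (simp add: Inf_enat_def)
  also have "\<dots> \<in> enat ` S" by (rule LeastI_ex) (use ne in blast)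
  finally show ?thesis using that by blast
qed

text \<open>The scalar moves into the left entries, so the number of brackets stays the
  same.\<close>

lemma sum_of_brackets_vscale:
  assumes "sum_of_brackets vf_bracket (vector_fields X) m D"
  shows "sum_of_brackets vf_bracket (vector_fields X) m (vscale b D)"
proof -
  obtain y y' where y: "\<forall>i\<in>{1..m}. y i \<in> vector_fields X \<and> y' i \<in> vector_fields X"
    "D = (\<Sum>i\<in>{1..m}. vf_bracket (y i) (y' i))"
    using assms unfolding sum_of_brackets_def by blast
  have "vscale b D = (\<Sum>i\<in>{1..m}. vf_bracket (vscale b (y i)) (y' i))"
    unfolding y(2) module.scale_sum_right[OF module_vscale]
    using y(1) by (intro sum.cong refl vf_bracket_vscale_left[symmetric]) auto
  moreover have "\<forall>i\<in>{1..m}. vscale b (y i) \<in> vector_fields X \<and> y' i \<in> vector_fields X"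
    using y(1) vector_fields_closed(2) by blast
  ultimately show ?thesis
    unfolding sum_of_brackets_def by (intro exI[of _ "\<lambda>i. vscale b (y i)"] exI[of _ y'] conjI)
qed

theorem proposition3p2:
  fixes X :: "('k::{alg_closed_field, field_char_0} ^ 'i) set"
    and x :: "nat \<Rightarrow> 'k ^ 'i \<Rightarrow> 'k"
    and V :: "nat \<Rightarrow> ('k ^ 'i \<Rightarrow> 'k) \<Rightarrow> 'k ^ 'i \<Rightarrow> 'k"
    and H :: "('k ^ 'i \<Rightarrow> 'k) \<Rightarrow> 'k ^ 'i \<Rightarrow> 'k"
    and c d :: "nat \<Rightarrow> int"
    and n N M :: nat
    and \<Delta> :: enat
  assumes X: "affine_variety X"
    and x: "\<forall>l\<in>{1..N}. x l \<in> coord_ring X - range (const_on X)"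
    and K_plus_ideal: "coord_ring X = {const_on X a + g | a g. g \<in> gen_ideal X N x}"
    and V: "\<forall>k\<in>{1..n}. V k \<in> vector_fields X"
    and V_span: "spans_tangent_spaces X n V"
    and H: "H \<in> vector_fields X" "induces_Gm_action X H"
    and hyp1: "\<forall>k\<in>{1..n}. vf_bracket H (V k) = vscale (of_int (c k)) (V k)"
    and M: "M = card {k\<in>{1..n}. c k = 0}"
    and hyp2: "\<forall>l\<in>{1..N}. d l \<noteq> 0 \<and> H (x l) = fscale (of_int (d l)) (x l)"
    and hyp3: "\<forall>k\<in>{1..n}. c k = 0 \<longrightarrow>
      (\<exists>W\<in>vector_fields X. \<exists>W'\<in>vector_fields X. vf_bracket W W' = V k)"
    and \<Delta>: "\<Delta> = bracket_number_mod X N x H"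
  shows "((\<forall>k\<in>{1..n}. \<forall>l\<in>{1..N}. V k (x l) \<in> gen_ideal X N x) \<longrightarrow>
           bracket_width (vscale :: 'k \<Rightarrow> _) vf_bracket (vector_fields X)
             \<le> enat (1 + N + M)) \<and>
         ((\<exists>k\<in>{1..n}. \<exists>l\<in>{1..N}. V k (x l) \<notin> gen_ideal X N x) \<longrightarrow>
           bracket_width (vscale :: 'k \<Rightarrow> _) vf_bracket (vector_fields X)
             \<le> enat (1 + N + M) + \<Delta>)"
proof -
  interpret graded_vector_fields X x V H c d n N
  proof
    show "coord_ring X = {const_on X a + g |a g. g \<in> gen_ideal X N x}" by (rule K_plus_ideal)
    show "\<exists>f. (\<forall>k. f k \<in> coord_ring X) \<and> D = (\<Sum>k\<in>{1..n}. vf_mult (f k) (V k))" if "D \<in> vector_fields X" for D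
      by (rule vector_fields_generated[OF X V V_span that])
    show "\<exists>Q g. finite Q \<and> (\<forall>q\<in>Q. g q \<in> coord_ring X \<and> H (g q) = fscale (of_int q) (g q)) \<and> f = sum g Q"
      if "f \<in> coord_ring X" for f by (rule homogeneous_decomposition[OF H(2) that])
  qed (use x V H(1) hyp1 hyp2 in blast)+
  have zero_part: "sum_of_brackets vf_bracket Vec M (weight_zero_part a)" for a
    unfolding M by (rule weight_zero_part_sum_of_brackets) (use hyp3 in blast)
  show ?thesis
  proof (intro conjI impI)
    assume a: "\<forall>k\<in>{1..n}. \<forall>l\<in>{1..N}. V k (x l) \<in> gen_ideal X N x"
    show "bracket_width (vscale :: 'k \<Rightarrow> _) vf_bracket Vec \<le> enat (1 + N + M)"
    proof (rule bracket_width_le)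
      fix D assume "D \<in> Vec"
      then obtain E r where "E \<in> absorbed" "D = E + weight_zero_part r"
        using Vec_normal_form_ideal a by blast
      then show "sum_of_brackets vf_bracket Vec (1 + N + M) D"
        by (simp only: sum_of_brackets_add[OF absorbed_sum_of_brackets zero_part])
    qed
  next
    \<comment> \<open>If \<Delta> is infinite the bound is void. Otherwise the infimum is attained,
      which supplies an actual \<open>r\<close> and actual brackets.\<close>
    show "bracket_width (vscale :: 'k \<Rightarrow> _) vf_bracket Vec \<le> enat (1 + N + M) + \<Delta>"
    proof (cases "\<Delta> = \<infinity>")
      case False
      then obtain m r where m: "\<Delta> = enat m" and r: "r \<in> gen_ideal X N x"
        and H_r: "sum_of_brackets vf_bracket Vec m (H + vf_mult r H)"
        unfolding \<Delta> bracket_number_mod_def by (elim INF_enat_attained) auto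
      have "bracket_width (vscale :: 'k \<Rightarrow> _) vf_bracket Vec \<le> enat (1 + N + M + m)"
      proof (rule bracket_width_le)
        fix D assume "D \<in> Vec"
        then obtain E a b where E: "E \<in> absorbed" "D = E + weight_zero_part a + vscale b H"
          using Vec_normal_form by blast
        \<comment> \<open>The term \<open>b * H\<close> is rewritten as
          \<open>b * (H + r * H)\<close> minus \<open>b * r * H\<close>. The subtracted part is
          absorbed because \<open>r\<close> lies in the ideal, which is why writing \<open>H\<close>
          modulo the ideal times \<open>H\<close> suffices.\<close>
        define E' where "E' = E + vscale (- b) (vf_mult r H)"
        have "E' \<in> absorbed"
          unfolding E'_def by (intro absorbed_add absorbed_scale ideal_times_H_absorbed E(1) r)
        moreover have "D = E' + weight_zero_part a + vscale b (H + vf_mult r H)"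
          by (simp add: E(2) E'_def vscale_def vf_mult_def fscale_def fun_eq_iff algebra_simps)
        ultimately show "sum_of_brackets vf_bracket Vec (1 + N + M + m) D"
          by (simp only: sum_of_brackets_add absorbed_sum_of_brackets zero_part
              sum_of_brackets_vscale[OF H_r])
      qed
      then show ?thesis by (simp add: m)
    qed simp
  qed
qed

end
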